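(* Let $\Omega\subset\mathbb{C}\setminus\{0\}$ be open, $V,W\in\{L^2_\sigma(\mathbb{R}^d),L^2(\mathbb{R}^d;\mathbb{C}^{d\times d})\}$ and $(T(z))_{z\in\Omega}\subset\mathcal{L}(V,W)$. Assume that $(T(z))_{z\in\Omega}$ satisfies $L^2$-$L^q$ decay estimates of order $\nu>d$ for some $q\in[2,\infty]$ and $L^2$-$L^p$ bounds for some $p>q$. Then $(T(z))_{z\in\Omega}$ is uniformly $L^r$-bounded for all $r\in[q,p_\theta)$, where $$\frac1{p_\theta}=\frac{1-\theta}q+\frac\theta p\qquad\text{and}\qquad\theta=\sup\{\vartheta\in(0,1):\nu(1-\vartheta)>d\}.$$
   Context: Here $d\ge2$ and $L^2_\sigma(\mathbb{R}^d)=\{f\in L^2(\mathbb{R}^d;\mathbb{C}^d):\operatorname{div}f=0\}$. For an open ball $B=B(x,\rho)$ put $B_n=B(x,2^n\rho)$, $C_0(B)=B$, $C_n(B)=B_n\setminus\overline{B_{n-1}}$ for $n\ge1$. Definition ($L^2$-$L^p$ decay estimates): $(T(z))_{z\in\Omega}\subset\mathcal{L}(V,W)$ satisfies $L^2$-$L^p$ decay estimates of order $\nu\ge0$ for $p\in[2,\infty]$ if there exist $M,N\ge0$ and a constant $C>0$ such that $$\|T(z)f\|_{L^p(B)}\le C\,\rho^{-d(\frac12-\frac1p)}\max\Big\{\Big(\frac{\rho^2}{|z|}\Big)^M,\Big(\frac{\rho^2}{|z|}\Big)^{-N}\Big\}\bigg(\sum_{n=0}^\infty2^{-\nu n}\|f\|_{L^2(C_n(B))}^2\bigg)^{\frac12}$$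 for all $z\in\Omega$, all balls $B=B(x,\rho)\subset\mathbb{R}^d$ and all $f\in V$. Definition ($L^2$-$L^p$ bounds): for $2\le p\le\infty$, $(T(z))_{z\in\Omega}\subset\mathcal{L}(V,W)$ satisfies $L^2$-$L^p$ bounds if there is $C>0$ with $\|T(z)f\|_{L^p}\le C|z|^{-\frac d2(\frac12-\frac1p)}\|f\|_{L^2}$ for all $z\in\Omega$ and $f\in V$. Uniformly $L^r$-bounded means: there is $C>0$ such that $\|T(z)f\|_{L^r}\le C\|f\|_{L^r}$ for all $z\in\Omega$ and $f\in V\cap L^r$. *)

theory Defs
  imports "HOL-Probability.Essential_Supremum"
begin

section \<open>Lebesgue norms\<close>

text \<open>
  Norms take values in \<^typ>\<open>ennreal\<close>, so that \<open>\<infinity>\<close> means ``not in the space''.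
  The function \<open>epowr\<close> is only used with exponents \<open>a > 0\<close>; \<open>erecip p\<close> is the real number
  \<open>1/p\<close>, with \<open>1/\<infinity> = 0\<close>.
\<close>

definition epowr :: "ennreal \<Rightarrow> real \<Rightarrow> ennreal" where
  "epowr x a = (if x = \<infinity> then \<infinity> else ennreal (enn2real x powr a))"

definition erecip :: "ennreal \<Rightarrow> real" where
  "erecip p = enn2real (1 / p)"

definition Lp_norm :: "ennreal \<Rightarrow> 'a::euclidean_space set \<Rightarrow> ('a \<Rightarrow> 'b::real_normed_vector) \<Rightarrow> ennreal" where
  "Lp_norm p S f =
     (if p = \<infinity> then esssup (lebesgue_on S) (\<lambda>x. ennreal (norm (f x)))
      else epowr (\<integral>\<^sup>+x. ennreal (norm (f x) powr enn2real p) \<partial>lebesgue_on S) (1 / enn2real p))"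

text \<open>
  Elements of Lebesgue spaces are represented by functions; functions that agree almost everywhere
  are different members of the set but stand for the same element.
\<close>

definition Lp_space :: "ennreal \<Rightarrow> ('a::euclidean_space \<Rightarrow> 'b::real_normed_vector) set" where
  "Lp_space p = {f \<in> borel_measurable lebesgue. Lp_norm p UNIV f < \<infinity>}"


section \<open>Solenoidal vector fields\<close>

definition partial_deriv :: "'d \<Rightarrow> (real^'d::finite \<Rightarrow> 'b::real_normed_vector) \<Rightarrow> real^'d \<Rightarrow> 'b" where
  "partial_deriv i f x = frechet_derivative f (at x) (axis i 1)"

fun C_times :: "nat \<Rightarrow> (real^'d::finite \<Rightarrow> 'b::real_normed_vector) \<Rightarrow> bool" where
  "C_times 0 f \<longleftrightarrow> continuous_on UNIV f"
| "C_times (Suc k) f \<longleftrightarrow> (\<forall>x. f differentiable at x) \<and> (\<forall>i. C_times k (partial_deriv i f))"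

definition test_functions :: "(real^'d::finite \<Rightarrow> complex) set" where
  "test_functions = {\<phi>. (\<forall>k. C_times k \<phi>) \<and> compact (closure {x. \<phi> x \<noteq> 0})}"

text \<open>The condition \<open>div f = 0\<close> is understood in the sense of distributions.\<close>

definition div_free :: "(real^'d::finite \<Rightarrow> complex^'d) \<Rightarrow> bool" where
  "div_free f \<longleftrightarrow>
     (\<forall>\<phi>\<in>test_functions. (LINT x|lebesgue. (\<Sum>i\<in>UNIV. f x $ i * partial_deriv i \<phi> x)) = 0)"

definition L2_sigma :: "(real^'d::finite \<Rightarrow> complex^'d) set" where
  "L2_sigma = {f \<in> Lp_space 2. div_free f}"

text \<open>The norm of \<^typ>\<open>complex^'d^'d\<close> is the Frobenius norm.\<close>

definition L2_matrix :: "(real^'d::finite \<Rightarrow> complex^'d^'d) set" where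
  "L2_matrix = Lp_space 2"


section \<open>Operator families\<close>

definition matrix_scale :: "complex \<Rightarrow> complex^'n::finite^'m::finite \<Rightarrow> complex^'n^'m" where
  "matrix_scale c A = (\<chi> i j. c * A $ i $ j)"

text \<open>
  Bounded complex-linear operators from \<open>V\<close> to \<open>W\<close>, both carrying the \<open>L\<^sup>2\<close> norm. The parameters
  \<open>sV\<close> and \<open>sW\<close> are the scalar multiplications of the value spaces. Linearity is required up to
  null sets; together with boundedness it makes \<open>A\<close> respect almost everywhere equality, so that
  \<open>A\<close> induces an operator between the spaces of equivalence classes.
\<close>

definition bounded_operator ::
  "(complex \<Rightarrow> 'v \<Rightarrow> 'v) \<Rightarrow> (complex \<Rightarrow> 'w \<Rightarrow> 'w) \<Rightarrow>
   ('a::euclidean_space \<Rightarrow> 'v::real_normed_vector) set \<Rightarrow> ('a \<Rightarrow> 'w::real_normed_vector) set \<Rightarrow>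
   (('a \<Rightarrow> 'v) \<Rightarrow> ('a \<Rightarrow> 'w)) \<Rightarrow> bool" where
  "bounded_operator sV sW V W A \<longleftrightarrow>
     (\<forall>f\<in>V. A f \<in> W) \<and>
     (\<forall>f\<in>V. \<forall>g\<in>V. AE x in lebesgue. A (\<lambda>y. f y + g y) x = A f x + A g x) \<and>
     (\<forall>c. \<forall>f\<in>V. AE x in lebesgue. A (\<lambda>y. sV c (f y)) x = sW c (A f x)) \<and>
     (\<exists>K\<ge>0. \<forall>f\<in>V. Lp_norm 2 UNIV (A f) \<le> ennreal K * Lp_norm 2 UNIV f)"

definition annulus :: "'a::euclidean_space \<Rightarrow> real \<Rightarrow> nat \<Rightarrow> 'a set" where
  "annulus x \<rho> n =
     (if n = 0 then ball x \<rho> else ball x (2 ^ n * \<rho>) - closure (ball x (2 ^ (n - 1) * \<rho>)))"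

definition L2_Lp_decay ::
  "complex set \<Rightarrow> ('a::euclidean_space \<Rightarrow> 'v::real_normed_vector) set \<Rightarrow>
   (complex \<Rightarrow> ('a \<Rightarrow> 'v) \<Rightarrow> ('a \<Rightarrow> 'w::real_normed_vector)) \<Rightarrow> real \<Rightarrow> ennreal \<Rightarrow> bool" where
  "L2_Lp_decay \<Omega> V T \<nu> p \<longleftrightarrow>
     (\<exists>M N C :: real. M \<ge> 0 \<and> N \<ge> 0 \<and> C > 0 \<and>
       (\<forall>z\<in>\<Omega>. \<forall>x. \<forall>\<rho>>0. \<forall>f\<in>V.
          Lp_norm p (ball x \<rho>) (T z f) \<le>
            ennreal (C * \<rho> powr (- real DIM('a) * (1/2 - erecip p)) *
                     max ((\<rho>\<^sup>2 / cmod z) powr M) ((\<rho>\<^sup>2 / cmod z) powr (- N))) *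
            epowr (\<Sum>n. ennreal (2 powr (- \<nu> * real n)) * (Lp_norm 2 (annulus x \<rho> n) f)\<^sup>2) (1/2)))"

definition L2_Lp_bounds ::
  "complex set \<Rightarrow> ('a::euclidean_space \<Rightarrow> 'v::real_normed_vector) set \<Rightarrow>
   (complex \<Rightarrow> ('a \<Rightarrow> 'v) \<Rightarrow> ('a \<Rightarrow> 'w::real_normed_vector)) \<Rightarrow> ennreal \<Rightarrow> bool" where
  "L2_Lp_bounds \<Omega> V T p \<longleftrightarrow>
     (\<exists>C>0. \<forall>z\<in>\<Omega>. \<forall>f\<in>V.
        Lp_norm p UNIV (T z f) \<le>
          ennreal (C * cmod z powr (- (real DIM('a) / 2) * (1/2 - erecip p))) * Lp_norm 2 UNIV f)"

definition uniformly_Lr_bounded ::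
  "complex set \<Rightarrow> ('a::euclidean_space \<Rightarrow> 'v::real_normed_vector) set \<Rightarrow>
   (complex \<Rightarrow> ('a \<Rightarrow> 'v) \<Rightarrow> ('a \<Rightarrow> 'w::real_normed_vector)) \<Rightarrow> ennreal \<Rightarrow> bool" where
  "uniformly_Lr_bounded \<Omega> V T r \<longleftrightarrow>
     (\<exists>C>0. \<forall>z\<in>\<Omega>. \<forall>f\<in>V \<inter> Lp_space r.
        Lp_norm r UNIV (T z f) \<le> ennreal C * Lp_norm r UNIV f)"

end

theory Submission
  imports Defs
begin

text \<open>
  Why the theorem holds. Fix \<open>z\<close> and put \<open>\<rho> = sqrt \<bar>z\<bar>\<close>, the radius for which the factor
  \<open>max {(\<rho>\<^sup>2/\<bar>z\<bar>)^M, (\<rho>\<^sup>2/\<bar>z\<bar>)^(-N)}\<close> of the decay estimate equals 1. Around a centre \<open>x\<close> write \<open>f\<close>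
  as a telescoping sum of pieces \<open>f\<^sub>k\<close> of \<open>V\<close> such that \<open>f\<^sub>k\<close> vanishes on \<open>B(x, 2^(k-1) \<rho>)\<close> and has
  its \<open>L\<^sup>2\<close> norm controlled by that of \<open>f\<close> on \<open>B(x, L 2^k \<rho>)\<close>. On \<open>B(x, \<rho>)\<close> the decay estimate
  gives \<open>T f\<^sub>k\<close> a factor \<open>2^(-\<nu>k/2)\<close> in \<open>L^q\<close>, while the \<open>L\<^sup>2\<close>-\<open>L^p\<close> bound has the same scaling in
  \<open>\<rho>\<close> but gains nothing; interpolating the two gives \<open>2^(-\<nu>(1-t)k/2)\<close> in \<open>L^r\<close> (lemma
  \<open>local_estimate\<close>). Replacing \<open>L\<^sup>2\<close> by \<open>L^r\<close> norms of \<open>f\<close> costs powers of the radius, and the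
  outcome (lemma \<open>ball_estimate\<close>) is
    \<open>\<integral>\<^bsub>B(x,\<rho>)\<^esub> \<bar>T f\<bar>^r \<le> C \<Sum>\<^sub>k 2^(-\<kappa>k) \<integral>\<^bsub>B(x, L 2^k \<rho>)\<^esub> \<bar>f\<bar>^r\<close>   with \<open>\<kappa> > d\<close>,
  the last inequality being exactly the condition \<open>\<nu> (1 - t) > d\<close> that \<open>r < p\<^sub>\<theta>\<close> guarantees.
  Integrating over all centres \<open>x\<close> turns each integral over a ball into the volume of the ball times
  the full integral, and the remaining series \<open>\<Sum>\<^sub>k 2^((d-\<kappa>)k)\<close> converges (lemma \<open>extrapolation\<close>).

  The space \<open>V\<close> enters only through the pieces \<open>f\<^sub>k\<close>, that is, through the property
  \<open>has_local_extensions\<close>. For matrix fields one multiplies by the indicator of a ball. For solenoidal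
  fields one keeps \<open>f\<close> on a cube \<open>Q\<close>, puts a correction \<open>h\<close> on the annulus \<open>A\<close> between \<open>Q\<close> and the
  cube of twice the size, and 0 outside; the result is solenoidal if
    \<open>\<integral>\<^sub>A h \<cdot> \<nabla>\<psi> = - \<integral>\<^sub>Q f \<cdot> \<nabla>\<psi>\<close>   for all test functions \<open>\<psi>\<close>.
  Riesz representation in \<open>L\<^sup>2(A)\<close> yields such an \<open>h\<close>, with a bound, once the right side is at most a
  constant times \<open>\<parallel>f\<parallel> \<parallel>\<nabla>\<psi>\<parallel>\<close> with both norms taken in \<open>L\<^sup>2(A)\<close>. To see this, test \<open>div f = 0\<close> with
  \<open>\<eta> (\<psi> - c)\<close>, where the cutoff \<open>\<eta>\<close> is 1 on \<open>Q\<close> and vanishes near the outer boundary: this moves the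
  integral from \<open>Q\<close> to \<open>A\<close>, and the Poincare inequality on \<open>A\<close> controls \<open>\<psi> - c\<close>. The annulus is a
  union of \<open>2d\<close> convex slabs which, as \<open>d \<ge> 2\<close>, overlap enough to hang together, so that the
  inequality follows from the convex case.
\<close>

section \<open>Power integrals and interpolation\<close>

lemma ennreal_norm_add_square_le:
  fixes a b :: "'a::real_normed_vector"
  shows "ennreal ((norm (a + b))\<^sup>2) \<le> 2 * ennreal ((norm a)\<^sup>2) + 2 * ennreal ((norm b)\<^sup>2)"
proof -
  have "(norm (a + b))\<^sup>2 \<le> (norm a + norm b)\<^sup>2" by (intro power_mono norm_triangle_ineq) auto
  also have "\<dots> \<le> 2 * (norm a)\<^sup>2 + 2 * (norm b)\<^sup>2"
    using sum_squares_bound[of "norm a" "norm b"] by (simp add: power2_sum)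
  finally show ?thesis by (simp add: ennreal_leI flip: ennreal_mult ennreal_plus ennreal_numeral)
qed

definition power_integral :: "real \<Rightarrow> 'a::euclidean_space set \<Rightarrow> ('a \<Rightarrow> 'b::real_normed_vector) \<Rightarrow> ennreal" where
  "power_integral r S f = (\<integral>\<^sup>+x\<in>S. ennreal (norm (f x) powr r) \<partial>lebesgue)"

lemma Lp_norm_eq_power_integral:
  assumes "S \<in> sets lebesgue" "p \<noteq> \<infinity>"
  shows "Lp_norm p S f = epowr (power_integral (enn2real p) S f) (1 / enn2real p)"
  using assms by (simp add: Lp_norm_def power_integral_def nn_integral_restrict_space)

lemma epowr_root_le_iff:
  assumes "0 < r" "0 \<le> a"
  shows "epowr m (1 / r) \<le> ennreal a \<longleftrightarrow> m \<le> ennreal (a powr r)"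
proof (cases m)
  case (real b)
  have "b powr (1/r) \<le> a \<longleftrightarrow> b \<le> a powr r"
  proof
    assume "b powr (1/r) \<le> a"
    then have "(b powr (1/r)) powr r \<le> a powr r" using assms by (intro powr_mono2) auto
    then show "b \<le> a powr r" using assms real by (simp add: powr_powr)
  next
    assume "b \<le> a powr r"
    then have "b powr (1/r) \<le> (a powr r) powr (1/r)" using assms real by (intro powr_mono2) auto
    then show "b powr (1/r) \<le> a" using assms by (simp add: powr_powr)
  qed
  then show ?thesis using real assms by (simp add: epowr_def)
qed (simp add: epowr_def top_unique)

lemma Lp_norm_le_iff:
  assumes "S \<in> sets lebesgue" "p \<noteq> \<infinity>" "0 < p" "0 \<le> a"
  shows "Lp_norm p S f \<le> ennreal a \<longleftrightarrow> power_integral (enn2real p) S f \<le> ennreal (a powr enn2real p)"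
proof -
  have "0 < enn2real p" using assms by (auto simp: enn2real_positive_iff less_top)
  then show ?thesis using assms by (simp add: Lp_norm_eq_power_integral epowr_root_le_iff)
qed

lemma power_integral_mono_set:
  "S \<subseteq> T \<Longrightarrow> power_integral r S f \<le> power_integral r T f"
  unfolding power_integral_def by (intro nn_integral_mono) (auto simp: indicator_def)

text \<open>
  Below the threshold \<open>\<kappa>\<close> the first term on the right dominates, above it the second. Integrating this
  and choosing \<open>\<kappa>\<close> well takes the place of Hoelder's inequality, at the price of a factor 2.
\<close>
lemma powr_le_split:
  assumes "0 \<le> t" "0 < \<kappa>" "q \<le> r" "r \<le> (p::real)"
  shows "t powr r \<le> \<kappa> powr (r - q) * t powr q + \<kappa> powr (r - p) * t powr p"
proof (cases "t = 0")
  case False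
  then have t: "t > 0" using assms by simp
  show ?thesis
  proof (cases "t \<le> \<kappa>")
    case True
    have "t powr r = t powr (r - q) * t powr q" using t by (simp flip: powr_add)
    also have "\<dots> \<le> \<kappa> powr (r - q) * t powr q"
      using True t assms by (intro mult_right_mono powr_mono2) auto
    finally show ?thesis using t by (simp add: add_increasing2)
  next
    case False
    have "t powr r = t powr (r - p) * t powr p" using t by (simp flip: powr_add)
    also have "\<dots> \<le> \<kappa> powr (r - p) * t powr p"
      using False t assms by (intro mult_right_mono powr_mono2') auto
    finally show ?thesis using t by (simp add: add_increasing)
  qed
qed simp

lemma power_integral_split:
  assumes [measurable]: "f \<in> borel_measurable lebesgue" "S \<in> sets lebesgue"
    and "0 < \<kappa>" "q \<le> r" "r \<le> p"
  shows "power_integral r S f \<le>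
    ennreal (\<kappa> powr (r - q)) * power_integral q S f + ennreal (\<kappa> powr (r - p)) * power_integral p S f"
proof -
  have "power_integral r S f \<le> (\<integral>\<^sup>+x. ennreal (\<kappa> powr (r - q)) * (ennreal (norm (f x) powr q) * indicator S x) +
     ennreal (\<kappa> powr (r - p)) * (ennreal (norm (f x) powr p) * indicator S x) \<partial>lebesgue)"
    unfolding power_integral_def
    using powr_le_split[of _ \<kappa> q r p] assms
    by (intro nn_integral_mono) (auto simp: indicator_def simp flip: ennreal_mult ennreal_plus)
  also have "\<dots> = ennreal (\<kappa> powr (r - q)) * power_integral q S f + ennreal (\<kappa> powr (r - p)) * power_integral p S f"
    unfolding power_integral_def by (subst nn_integral_add) (auto simp: nn_integral_cmult)
  finally show ?thesis .
qed

lemma power_integral_eq_0_iff: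
  assumes [measurable]: "f \<in> borel_measurable lebesgue" "S \<in> sets lebesgue"
  shows "power_integral r S f = 0 \<longleftrightarrow> (AE x in lebesgue. x \<in> S \<longrightarrow> f x = 0)"
  unfolding power_integral_def
  by (subst nn_integral_0_iff_AE) (auto simp: indicator_def intro!: AE_cong)

text \<open>
  This settles the degenerate cases in which no threshold \<open>\<kappa> > 0\<close> balances the two terms.
\<close>
lemma Lp_norm_eq_0_imp:
  assumes [measurable]: "f \<in> borel_measurable lebesgue" "S \<in> sets lebesgue"
    and 0: "Lp_norm p S f = 0" and "0 < p"
  shows "power_integral r S f = 0"
proof (cases "p = \<infinity>")
  case True
  have "AE x in lebesgue_on S. ennreal (norm (f x)) \<le> esssup (lebesgue_on S) (\<lambda>x. ennreal (norm (f x)))"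
    by (rule esssup_AE)
  then have "AE x in lebesgue_on S. f x = 0" using 0 True by (simp add: Lp_norm_def)
  then show ?thesis by (simp add: power_integral_eq_0_iff AE_restrict_space_iff)
next
  case False
  then have "power_integral (enn2real p) S f \<le> ennreal (0 powr enn2real p)"
    using Lp_norm_le_iff[of S p 0 f] assms by simp
  then show ?thesis using assms by (simp add: power_integral_eq_0_iff)
qed

text \<open>
  Logarithmic convexity of Lebesgue norms, up to a factor 2. For finite \<open>p\<close> it is
  \<open>power_integral_split\<close> at the threshold that makes its two terms equal; for \<open>p = \<infinity>\<close> one factors
  \<open>\<bar>f\<bar>^r = \<bar>f\<bar>^(r-q) \<bar>f\<bar>^q\<close> and bounds the first factor by \<open>\<beta>^(r-q)\<close>.
\<close>
lemma Lp_interpolation: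
  assumes [measurable]: "f \<in> borel_measurable lebesgue" "S \<in> sets lebesgue"
    and q: "0 < q" "q \<le> r" "r < p" and t: "0 \<le> t" "t < 1"
    and rec: "erecip r = (1 - t) * erecip q + t * erecip p"
    and \<alpha>: "Lp_norm q S f \<le> ennreal \<alpha>" "0 \<le> \<alpha>" and \<beta>: "Lp_norm p S f \<le> ennreal \<beta>" "0 \<le> \<beta>"
  shows "power_integral (enn2real r) S f \<le> ennreal (2 * (\<alpha> powr (1 - t) * \<beta> powr t) powr enn2real r)"
proof (cases "\<alpha> = 0 \<or> \<beta> = 0")
  case True
  then have "Lp_norm q S f = 0 \<or> Lp_norm p S f = 0" using \<alpha> \<beta> by auto
  then have "power_integral (enn2real r) S f = 0" using Lp_norm_eq_0_imp[of f S] q by (meson assms less_trans order_less_le_trans)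
  then show ?thesis by simp
next
  case False
  define a b where "a = ln \<alpha>" and "b = ln \<beta>"
  have \<alpha>e: "\<alpha> = exp a" and \<beta>e: "\<beta> = exp b" using False \<alpha> \<beta> by (auto simp: a_def b_def)
  obtain q' where q': "q = ennreal q'" "q' > 0"
    using q by (cases q) (auto simp: top_unique)
  obtain r' where r': "r = ennreal r'" "q' \<le> r'"
    using q q' by (cases r) auto
  have mq: "power_integral q' S f \<le> ennreal (\<alpha> powr q')"
    using Lp_norm_le_iff[of S q \<alpha> f] q' \<alpha> by simp
  have er: "erecip r = 1 / r'" "erecip q = 1 / q'"
    using q' r' by (auto simp: erecip_def divide_ennreal simp flip: ennreal_1)
  show ?thesis
  proof (cases "p = \<infinity>")
    case True
    have t': "1 / r' = (1 - t) / q'" using rec True er by (simp add: erecip_def)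
    then have tr: "(1 - t) * r' = q'" using q' r' by (simp add: field_simps)
    have "AE x in lebesgue_on S. ennreal (norm (f x)) \<le> esssup (lebesgue_on S) (\<lambda>x. ennreal (norm (f x)))"
      by (rule esssup_AE)
    then have "AE x in lebesgue_on S. norm (f x) \<le> \<beta>" 
    proof eventually_elim
      case (elim x)
      then have "ennreal (norm (f x)) \<le> ennreal \<beta>"
        by (rule order_trans) (use \<beta> True in \<open>simp add: Lp_norm_def\<close>)
      then show ?case using \<beta> by simp
    qed
    then have AE: "AE x in lebesgue. x \<in> S \<longrightarrow> norm (f x) \<le> \<beta>" by (simp add: AE_restrict_space_iff)
    have "power_integral r' S f \<le> (\<integral>\<^sup>+x. ennreal (\<beta> powr (r' - q')) * (ennreal (norm (f x) powr q') * indicator S x) \<partial>lebesgue)"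
      unfolding power_integral_def
    proof (intro nn_integral_mono_AE, use AE in eventually_elim, goal_cases)
      case (1 x)
      have "norm (f x) powr r' \<le> \<beta> powr (r' - q') * norm (f x) powr q'" if "norm (f x) \<le> \<beta>"
      proof (cases "norm (f x) = 0")
        case False
        then have "norm (f x) powr r' = norm (f x) powr (r' - q') * norm (f x) powr q'" by (simp flip: powr_add)
        also have "\<dots> \<le> \<beta> powr (r' - q') * norm (f x) powr q'"
          using that r' by (intro mult_right_mono powr_mono2) auto
        finally show ?thesis .
      qed simp
      then show ?case using 1 by (auto simp: indicator_def simp flip: ennreal_mult)
    qed
    also have "\<dots> = ennreal (\<beta> powr (r' - q')) * power_integral q' S f"
      unfolding power_integral_def by (simp add: nn_integral_cmult)
    also have "\<dots> \<le> ennreal (\<beta> powr (r' - q')) * ennreal (\<alpha> powr q')"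
      using mq by (intro mult_left_mono) auto
    also have "\<dots> = ennreal ((\<alpha> powr (1 - t) * \<beta> powr t) powr r')"
    proof -
      have "t * r' = r' - q'" using tr by (simp add: algebra_simps)
      then have "\<beta> powr (r' - q') * \<alpha> powr q' = (\<alpha> powr (1 - t) * \<beta> powr t) powr r'"
        using \<alpha> \<beta> by (simp add: powr_mult powr_powr tr)
      then show ?thesis by (simp flip: ennreal_mult)
    qed
    also have "\<dots> \<le> ennreal (2 * (\<alpha> powr (1 - t) * \<beta> powr t) powr r')" by (intro ennreal_leI) auto
    finally show ?thesis using r' q' by simp
  next
    case False
    then obtain p' where p': "p = ennreal p'" "r' < p'"
      using q r' q' by (cases p) (auto simp: ennreal_less_iff)
    have mp: "power_integral p' S f \<le> ennreal (\<beta> powr p')"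
      using Lp_norm_le_iff[of S p \<beta> f] p' r' q' \<beta> by simp
    have ep: "erecip p = 1 / p'"
      using p' q' r' by (auto simp: erecip_def divide_ennreal simp flip: ennreal_1)
    have pos: "p' > 0" "r' > 0" "p' - q' > 0" using p' q' r' by auto
    have "1 / r' = (1 - t) / q' + t / p'" using rec ep er by simp
    then have teq: "t * (r' * (p' - q')) = p' * (r' - q')" using pos q' by (simp add: field_simps)
    \<comment> \<open>The logarithm of the threshold at which both terms of the splitting
      coincide.\<close>
    define l where "l = (p' * b - q' * a) / (p' - q')"
    define \<kappa> where "\<kappa> = exp l"
    have exps: "(r' - q') * l + q' * a = r' * ((1 - t) * a + t * b)" "(r' - p') * l + p' * b = r' * ((1 - t) * a + t * b)"
    proof -
      have *: "l * (p' - q') = p' * b - q' * a" using pos by (simp add: l_def)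
      have "((r' - q') * l + q' * a) * (p' - q') = (r' * ((1 - t) * a + t * b)) * (p' - q')"
        using * teq by algebra
      then show "(r' - q') * l + q' * a = r' * ((1 - t) * a + t * b)" using pos by simp
      have "((r' - p') * l + p' * b) * (p' - q') = (r' * ((1 - t) * a + t * b)) * (p' - q')"
        using * teq by algebra
      then show "(r' - p') * l + p' * b = r' * ((1 - t) * a + t * b)" using pos by simp
    qed
    have "power_integral r' S f \<le> ennreal (\<kappa> powr (r' - q')) * power_integral q' S f + ennreal (\<kappa> powr (r' - p')) * power_integral p' S f"
      using p' r' by (intro power_integral_split) (auto simp: \<kappa>_def)
    also have "\<dots> \<le> ennreal (\<kappa> powr (r' - q')) * ennreal (\<alpha> powr q') + ennreal (\<kappa> powr (r' - p')) * ennreal (\<beta> powr p')"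
      using mq mp by (intro add_mono mult_left_mono) auto
    also have "\<dots> = ennreal (\<kappa> powr (r' - q') * \<alpha> powr q' + \<kappa> powr (r' - p') * \<beta> powr p')"
      by (simp flip: ennreal_mult ennreal_plus)
    also have "\<kappa> powr (r' - q') * \<alpha> powr q' + \<kappa> powr (r' - p') * \<beta> powr p' = 2 * (\<alpha> powr (1 - t) * \<beta> powr t) powr r'"
    proof -
      have "\<kappa> powr (r' - q') * \<alpha> powr q' = exp ((r' - q') * l + q' * a)"
        "\<kappa> powr (r' - p') * \<beta> powr p' = exp ((r' - p') * l + p' * b)"
        by (simp_all add: \<kappa>_def \<alpha>e \<beta>e exp_powr_real mult.commute exp_add)
      moreover have "(\<alpha> powr (1 - t) * \<beta> powr t) powr r' = exp (r' * ((1 - t) * a + t * b))"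
        by (simp add: \<alpha>e \<beta>e exp_powr_real mult.commute flip: exp_add)
      ultimately show ?thesis using exps by simp
    qed
    finally show ?thesis using r' pos by simp
  qed
qed

text \<open>
  Hoelder's inequality against the constant function 1, by the same splitting.
\<close>
lemma power_integral_2_le:
  assumes [measurable]: "f \<in> borel_measurable lebesgue" "S \<in> sets lebesgue"
    and r: "2 \<le> r" and S: "emeasure lebesgue S = ennreal \<mu>" "0 < \<mu>"
    and E: "power_integral r S f = ennreal E" "0 \<le> E"
  shows "power_integral 2 S f \<le> ennreal (2 * \<mu> powr (1 - 2/r) * E powr (2/r))"
proof (cases "E = 0")
  case True
  then show ?thesis using E by (simp add: power_integral_eq_0_iff)
next
  case False
  \<comment> \<open>The threshold for which \<open>\<kappa>\<^sup>2 \<mu> = \<kappa>^(2-r)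
    E\<close>.\<close>
  define \<kappa> where "\<kappa> = (E / \<mu>) powr (1/r)"
  have pos: "\<kappa> > 0" "E > 0" using False E S by (auto simp: \<kappa>_def)
  have pw: "norm (f x) powr 2 \<le> \<kappa> powr 2 + \<kappa> powr (2 - r) * norm (f x) powr r" for x
  proof (cases "f x = 0")
    case False
    then show ?thesis using powr_le_split[of "norm (f x)" \<kappa> 0 2 r] pos r by simp
  qed simp
  have "power_integral 2 S f \<le> (\<integral>\<^sup>+x. ennreal (\<kappa> powr 2) * indicator S x +
     ennreal (\<kappa> powr (2 - r)) * (ennreal (norm (f x) powr r) * indicator S x) \<partial>lebesgue)"
    unfolding power_integral_def using pw
    by (intro nn_integral_mono) (auto simp: indicator_def simp flip: ennreal_mult ennreal_plus)
  also have "\<dots> = ennreal (\<kappa> powr 2) * ennreal \<mu> + ennreal (\<kappa> powr (2 - r)) * ennreal E"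
    using E S unfolding power_integral_def by (subst nn_integral_add) (auto simp: nn_integral_cmult)
  also have "\<dots> = ennreal (\<kappa> powr 2 * \<mu> + \<kappa> powr (2 - r) * E)"
    using pos S by (simp flip: ennreal_mult ennreal_plus)
  also have "\<kappa> powr 2 * \<mu> + \<kappa> powr (2 - r) * E = 2 * \<mu> powr (1 - 2/r) * E powr (2/r)"
  proof -
    define m e where "m = ln \<mu>" and "e = ln E"
    have *: "\<mu> = exp m" "E = exp e" using S pos by (auto simp: m_def e_def)
    have r0: "r \<noteq> 0" using r by simp
    have l: "\<kappa> = exp ((e - m) / r)" by (simp add: \<kappa>_def * exp_powr_real flip: exp_diff)
    have "\<kappa> powr 2 * \<mu> = exp (m * (1 - 2/r) + e * (2/r))"
      using r0 by (simp add: l * exp_powr_real flip: exp_add) (simp add: field_simps)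
    moreover have "\<kappa> powr (2-r) * E = exp (m * (1 - 2/r) + e * (2/r))"
      using r0 by (simp add: l * exp_powr_real flip: exp_add) (simp add: field_simps)
    ultimately show ?thesis by (simp add: * exp_powr_real exp_add)
  qed
  finally show ?thesis .
qed

section \<open>Extrapolation by telescoping over dyadic balls\<close>

text \<open>
  Members of \<open>V\<close> can be truncated without leaving \<open>V\<close>: \<open>g\<close> agrees with \<open>f\<close> on a ball, and its norm is
  paid for by \<open>f\<close> on a ball that is larger by a fixed factor.
\<close>
definition has_local_extensions :: "('a::euclidean_space \<Rightarrow> 'v::real_normed_vector) set \<Rightarrow> real \<Rightarrow> real \<Rightarrow> bool" where
  "has_local_extensions V L K \<longleftrightarrow>
     (\<forall>x. \<forall>R>0. \<forall>f\<in>V. \<exists>g\<in>V. (\<forall>y\<in>ball x R. g y = f y) \<and>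
        power_integral 2 UNIV g \<le> ennreal K * power_integral 2 (ball x (L * R)) f)"

lemma annulus_subset_ball:
  "0 < \<rho> \<Longrightarrow> annulus x \<rho> n \<subseteq> ball x (2 ^ n * \<rho>)"
  by (auto simp: annulus_def)

lemma annulus_sets: "annulus x \<rho> n \<in> sets lebesgue"
  by (auto simp: annulus_def)

text \<open>
  The annuli with \<open>n < k\<close> lie where \<open>u\<close> vanishes. Each of the others carries at most the full mass of
  \<open>u\<close>, so what remains is the tail of a geometric series.
\<close>
lemma decay_sum_le:
  fixes u :: "'a::euclidean_space \<Rightarrow> 'v::real_normed_vector"
  assumes \<nu>: "0 < \<nu>" and \<rho>: "0 < \<rho>" and N: "0 \<le> N" "power_integral 2 UNIV u \<le> ennreal (N powr 2)"
    and van: "0 < k \<Longrightarrow> \<forall>y\<in>ball x (2 ^ (k - 1) * \<rho>). u y = 0"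
  shows "epowr (\<Sum>n. ennreal (2 powr (- \<nu> * real n)) * (Lp_norm 2 (annulus x \<rho> n) u)\<^sup>2) (1/2)
    \<le> ennreal (2 powr (- \<nu> / 2 * real k) * N / sqrt (1 - 2 powr - \<nu>))"
proof -
  define c where "c = 2 powr - \<nu>"
  have c: "0 < c" "c < 1" using \<nu> by (auto simp: c_def powr_less_one)
  have cn: "2 powr (- \<nu> * real n) = c ^ n" for n
    by (simp add: c_def powr_powr flip: powr_realpow)
  define b where "b n = (if n < k then 0 else c ^ n * N\<^sup>2)" for n
  have tm: "ennreal (2 powr (- \<nu> * real n)) * (Lp_norm 2 (annulus x \<rho> n) u)\<^sup>2 \<le> ennreal (b n)" for n
  proof -
    have Lp2: "Lp_norm 2 (annulus x \<rho> n) u \<le> ennreal a" 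
      if "power_integral 2 (annulus x \<rho> n) u \<le> ennreal (a powr 2)" "a \<ge> 0" for a
      using Lp_norm_le_iff[OF annulus_sets, of 2 a x \<rho> n u] that by simp
    show ?thesis
    proof (cases "n < k")
      case True
      have "annulus x \<rho> n \<subseteq> ball x (2 ^ n * \<rho>)" using \<rho> by (rule annulus_subset_ball)
      also have "\<dots> \<subseteq> ball x (2 ^ (k - 1) * \<rho>)"
        using True \<rho> by (intro subset_ball mult_right_mono power_increasing) auto
      finally have "u y = 0" if "y \<in> annulus x \<rho> n" for y using van True that by auto
      then have "power_integral 2 (annulus x \<rho> n) u = (\<integral>\<^sup>+y. 0 \<partial>(lebesgue::'a measure))"
        unfolding power_integral_def by (intro nn_integral_cong) (auto simp: indicator_def)
      then have "Lp_norm 2 (annulus x \<rho> n) u \<le> ennreal 0" by (intro Lp2) auto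
      then show ?thesis by simp
    next
      case False
      have "power_integral 2 (annulus x \<rho> n) u \<le> power_integral 2 UNIV u" by (rule power_integral_mono_set) simp
      then have "Lp_norm 2 (annulus x \<rho> n) u \<le> ennreal N" using N by (intro Lp2) auto
      then have "(Lp_norm 2 (annulus x \<rho> n) u)\<^sup>2 \<le> (ennreal N)\<^sup>2" by (rule power_mono) simp
      then have "ennreal (c ^ n) * (Lp_norm 2 (annulus x \<rho> n) u)\<^sup>2 \<le> ennreal (c ^ n) * ennreal (N\<^sup>2)"
        using N by (intro mult_left_mono) (auto simp: ennreal_power)
      then show ?thesis using False c N unfolding cn b_def by (simp add: ennreal_mult)
    qed
  qed
  have "(\<lambda>i. b (i + k)) = (\<lambda>i. (c ^ k * N\<^sup>2) * c ^ i)" by (auto simp: b_def power_add)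
  moreover have "(\<lambda>i. (c ^ k * N\<^sup>2) * c ^ i) sums ((c ^ k * N\<^sup>2) * (1 / (1 - c)))"
    using c by (intro sums_mult geometric_sums) auto
  ultimately have "b sums ((c ^ k * N\<^sup>2) * (1 / (1 - c)))"
    using sums_zero_iff_shift[of k b] by (auto simp: b_def[abs_def])
  then have suminf_b: "(\<Sum>n. ennreal (b n)) = ennreal ((c ^ k * N\<^sup>2) * (1 / (1 - c)))"
    using c by (intro suminf_ennreal_eq) (simp add: b_def)
  have "(\<Sum>n. ennreal (2 powr (- \<nu> * real n)) * (Lp_norm 2 (annulus x \<rho> n) u)\<^sup>2) \<le> (\<Sum>n. ennreal (b n))"
    by (intro suminf_le tm) auto
  also note suminf_b
  also have "(c ^ k * N\<^sup>2) * (1 / (1 - c)) = (2 powr (- \<nu> / 2 * real k) * N / sqrt (1 - c)) powr 2"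
  proof -
    have "(2 powr (- \<nu> / 2 * real k))\<^sup>2 = c ^ k" by (simp add: powr_power flip: cn)
    then show ?thesis using c N by (simp add: power_mult_distrib power_divide)
  qed
  finally show ?thesis using c N unfolding c_def by (subst epowr_root_le_iff) auto
qed

text \<open>
  On balls of radius \<open>sqrt \<bar>z\<bar>\<close> both hypotheses have the same scaling in \<open>z\<close>. The first improves by
  \<open>2^(-\<nu>k/2)\<close> when \<open>u\<close> vanishes near the ball, the second does not, so interpolation keeps the share
  \<open>1 - t\<close> of the exponent.
\<close>
lemma local_estimate:
  fixes T :: "complex \<Rightarrow> ('a::euclidean_space \<Rightarrow> 'v::real_normed_vector) \<Rightarrow> 'a \<Rightarrow> 'w::real_normed_vector"
  assumes decay: "L2_Lp_decay \<Omega> V T \<nu> q" and bounds: "L2_Lp_bounds \<Omega> V T p"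
    and \<Omega>: "0 \<notin> \<Omega>" and \<nu>: "0 < \<nu>" and q: "2 \<le> q" "q \<le> r" "r < p" and t: "0 \<le> t" "t < 1"
    and rec: "erecip r = (1 - t) * erecip q + t * erecip p"
    and meas: "\<And>z u. z \<in> \<Omega> \<Longrightarrow> u \<in> V \<Longrightarrow> T z u \<in> borel_measurable lebesgue"
  obtains C where "0 < C"
    and "\<And>z x k u N. \<lbrakk>z \<in> \<Omega>; u \<in> V; 0 \<le> N; power_integral 2 UNIV u \<le> ennreal (N powr 2);
      0 < k \<Longrightarrow> \<forall>y\<in>ball x (2 ^ (k - 1) * sqrt (cmod z)). u y = 0\<rbrakk> \<Longrightarrow>
      power_integral (enn2real r) (ball x (sqrt (cmod z))) (T z u) \<le>
        ennreal (C * (sqrt (cmod z) powr (- real DIM('a) * (1/2 - erecip r)) *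
          2 powr (- (\<nu> * (1 - t) / 2) * real k) * N) powr enn2real r)"
proof -
  let ?d = "real DIM('a)"
  obtain M N1 C1 where C1: "C1 > 0" and dec: "\<And>z x \<rho> f. z \<in> \<Omega> \<Longrightarrow> \<rho> > 0 \<Longrightarrow> f \<in> V \<Longrightarrow>
     Lp_norm q (ball x \<rho>) (T z f) \<le>
            ennreal (C1 * \<rho> powr (- ?d * (1/2 - erecip q)) *
                     max ((\<rho>\<^sup>2 / cmod z) powr M) ((\<rho>\<^sup>2 / cmod z) powr (- N1))) *
            epowr (\<Sum>n. ennreal (2 powr (- \<nu> * real n)) * (Lp_norm 2 (annulus x \<rho> n) f)\<^sup>2) (1/2)"
    using decay unfolding L2_Lp_decay_def by blast
  obtain C2 where C2: "C2 > 0" and bnd: "\<And>z f. z \<in> \<Omega> \<Longrightarrow> f \<in> V \<Longrightarrow> 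
      Lp_norm p UNIV (T z f) \<le>
          ennreal (C2 * cmod z powr (- (?d / 2) * (1/2 - erecip p))) * Lp_norm 2 UNIV f"
    using bounds unfolding L2_Lp_bounds_def by blast
  define S where "S = 1 / sqrt (1 - 2 powr - \<nu>)"
  have S: "S > 0" using \<nu> by (auto simp: S_def powr_less_one)
  define B where "B = (C1 * S) powr (1 - t) * C2 powr t"
  have B: "B > 0" using S C1 C2 by (simp add: B_def)
  show thesis
  proof
    show "0 < 2 * B powr enn2real r" using B by simp
    fix z x k u N
    assume z: "z \<in> \<Omega>" and u: "u \<in> V" and N: "0 \<le> N" "power_integral 2 UNIV u \<le> ennreal (N powr 2)"
      and van: "0 < k \<Longrightarrow> \<forall>y\<in>ball x (2 ^ (k - 1) * sqrt (cmod z)). u y = 0"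
    define \<rho> where "\<rho> = sqrt (cmod z)"
    have z0: "z \<noteq> 0" using z \<Omega> by auto
    then have \<rho>: "\<rho> > 0" by (simp add: \<rho>_def)
    have \<rho>2: "cmod z = \<rho> powr 2" using z0 by (simp add: \<rho>_def)
    define \<alpha> where "\<alpha> = C1 * \<rho> powr (- ?d * (1/2 - erecip q)) * (2 powr (- \<nu> / 2 * real k) * N * S)"
    define \<beta> where "\<beta> = C2 * \<rho> powr (- ?d * (1/2 - erecip p)) * N"
    have pos: "\<alpha> \<ge> 0" "\<beta> \<ge> 0" using N C1 C2 S by (auto simp: \<alpha>_def \<beta>_def)
    have "Lp_norm q (ball x \<rho>) (T z u) \<le>
            ennreal (C1 * \<rho> powr (- ?d * (1/2 - erecip q))) *
            epowr (\<Sum>n. ennreal (2 powr (- \<nu> * real n)) * (Lp_norm 2 (annulus x \<rho> n) u)\<^sup>2) (1/2)"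
      using dec[OF z \<rho> u, of x] \<rho> by (simp add: \<rho>2)
    also have "\<dots> \<le> ennreal (C1 * \<rho> powr (- ?d * (1/2 - erecip q))) * ennreal (2 powr (- \<nu> / 2 * real k) * N * S)"
      using decay_sum_le[OF \<nu> \<rho> N, of k x] van by (intro mult_left_mono) (auto simp: S_def \<rho>_def)
    also have "\<dots> = ennreal \<alpha>" unfolding \<alpha>_def using C1 N S by (subst ennreal_mult) auto
    finally have *: "Lp_norm q (ball x \<rho>) (T z u) \<le> ennreal \<alpha>" .
    have "Lp_norm p (ball x \<rho>) (T z u) \<le> Lp_norm p UNIV (T z u)"
    proof (cases "p = \<infinity>")
      case True
      have [measurable]: "T z u \<in> borel_measurable lebesgue" using meas z u by simp
      have "AE y in lebesgue. ennreal (norm (T z u y)) \<le> esssup lebesgue (\<lambda>x. ennreal (norm (T z u x)))"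
        by (rule esssup_AE)
      then have "AE y in lebesgue_on (ball x \<rho>). ennreal (norm (T z u y)) \<le> esssup lebesgue (\<lambda>x. ennreal (norm (T z u x)))"
        by (auto simp: AE_restrict_space_iff elim: eventually_mono)
      then show ?thesis using True
        by (auto simp: Lp_norm_def lebesgue_on_UNIV_eq intro!: esssup_I measurable_restrict_space1)
    next
      case False
      have "power_integral (enn2real p) (ball x \<rho>) (T z u) \<le> power_integral (enn2real p) UNIV (T z u)"
        by (rule power_integral_mono_set) simp
      then show ?thesis using False 
        by (auto simp: Lp_norm_eq_power_integral epowr_def top_unique less_top 
            intro!: ennreal_leI powr_mono2 enn2real_mono)
    qed
    also have "\<dots> \<le> ennreal (C2 * cmod z powr (- (?d / 2) * (1/2 - erecip p))) * Lp_norm 2 UNIV u"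
      using bnd[OF z u] .
    also have "\<dots> \<le> ennreal (C2 * \<rho> powr (- ?d * (1/2 - erecip p))) * ennreal N"
      using Lp_norm_le_iff[of UNIV 2 N u] N unfolding \<rho>2 powr_powr
      by (intro mult_mono) auto
    also have "\<dots> = ennreal \<beta>" unfolding \<beta>_def using C2 N by (subst ennreal_mult) auto
    finally have **: "Lp_norm p (ball x \<rho>) (T z u) \<le> ennreal \<beta>" .
    have "power_integral (enn2real r) (ball x \<rho>) (T z u) \<le> ennreal (2 * (\<alpha> powr (1 - t) * \<beta> powr t) powr enn2real r)"
      using q meas[OF z u] t rec * ** pos by (intro Lp_interpolation[where q = q and p = p]) (auto simp: less_le_trans[of 0 2 q])
    also have "\<alpha> powr (1 - t) * \<beta> powr t =
       B * (\<rho> powr (- ?d * (1/2 - erecip r)) * 2 powr (- (\<nu> * (1 - t) / 2) * real k) * N)"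
    proof (cases "N = 0")
      case False
      then have N0: "N > 0" using N by simp
      define l where "l = ln \<rho>"
      have \<rho>l: "\<rho> powr a = exp (l * a)" for a using \<rho> by (simp add: powr_def l_def)
      define m where "m = ln N"
      have N': "N = exp m" using N0 by (simp add: m_def)
      have two: "2 powr a = exp (ln 2 * a)" for a :: real by (simp add: powr_def)
      have "\<alpha> powr (1 - t) * \<beta> powr t = B * (exp (l * (- ?d * (1/2 - erecip q))) * exp (ln 2 * (- \<nu> / 2 * real k)) * exp m) powr (1 - t) *
          (exp (l * (- ?d * (1/2 - erecip p))) * exp m) powr t"
        using C1 C2 S unfolding \<alpha>_def \<beta>_def B_def \<rho>l two N' by (simp add: powr_mult)
      also have "\<dots> = B * exp ((1-t) * (l * (- ?d * (1/2 - erecip q)) + ln 2 * (- \<nu> / 2 * real k) + m) + t * (l * (- ?d * (1/2 - erecip p)) + m))"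
        by (simp add: exp_powr_real exp_add mult_ac flip: exp_add)
      also have "(1-t) * (l * (- ?d * (1/2 - erecip q)) + ln 2 * (- \<nu> / 2 * real k) + m) + t * (l * (- ?d * (1/2 - erecip p)) + m)
         = l * (- ?d * (1/2 - erecip r)) + ln 2 * (- (\<nu> * (1 - t) / 2) * real k) + m"
        unfolding rec by (simp add: algebra_simps) (simp add: field_simps)
      finally show ?thesis unfolding \<rho>l two N' by (simp only: exp_add mult.assoc)
    qed (auto simp: \<alpha>_def \<beta>_def)
    also have "2 * (B * (\<rho> powr (- ?d * (1/2 - erecip r)) * 2 powr (- (\<nu> * (1 - t) / 2) * real k) * N)) powr enn2real r
       = 2 * B powr enn2real r * (\<rho> powr (- ?d * (1/2 - erecip r)) * 2 powr (- (\<nu> * (1 - t) / 2) * real k) * N) powr enn2real r"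
      using B N by (simp add: powr_mult)
    finally show "power_integral (enn2real r) (ball x (sqrt (cmod z))) (T z u) \<le>
        ennreal (2 * B powr enn2real r * (sqrt (cmod z) powr (- ?d * (1/2 - erecip r)) *
          2 powr (- (\<nu> * (1 - t) / 2) * real k) * N) powr enn2real r)"
      by (simp add: \<rho>_def)
  qed
qed

text \<open>
  The sum is at most \<open>1/(1-c)\<close> times the largest \<open>b k / c^k\<close>, and a power of a maximum is at most
  the sum of the powers. Sacrificing the geometric factor \<open>c^k\<close> in this way serves as a substitute for
  Minkowski's inequality that stays within power integrals, which can then be integrated over centres.
\<close>
lemma sum_powr_le_weighted:
  fixes b :: "nat \<Rightarrow> real"
  assumes c: "0 < c" "c < 1" and r: "0 < r" and b: "\<And>k. 0 \<le> b k" and a: "0 \<le> a" "a \<le> (\<Sum>k\<le>n. b k)"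
  shows "a powr r \<le> (1 / (1 - c)) powr r * (\<Sum>k\<le>n. (b k / c ^ k) powr r)"
proof -
  define m where "m = Max ((\<lambda>k. b k / c ^ k) ` {..n})"
  have m: "b k / c ^ k \<le> m" if "k \<le> n" for k unfolding m_def using that by (intro Max_ge) auto
  have "m \<in> (\<lambda>k. b k / c ^ k) ` {..n}" unfolding m_def by (rule Max_in) auto
  then obtain j where j: "j \<le> n" "m = b j / c ^ j" by auto
  have m0: "0 \<le> m" using j b c by simp
  have "a \<le> (\<Sum>k\<le>n. c ^ k * m)"
    using a(2) by (rule order_trans) (use m c in \<open>auto intro!: sum_mono simp: field_simps\<close>)
  also have "\<dots> = (\<Sum>k\<le>n. c ^ k) * m" by (simp add: sum_distrib_right)
  also have "\<dots> \<le> (\<Sum>k. c ^ k) * m"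
    using c m0 by (intro mult_right_mono sum_le_suminf summable_geometric) auto
  also have "\<dots> = (1 / (1 - c)) * m" using c by (simp add: suminf_geometric)
  finally have "a powr r \<le> ((1 / (1 - c)) * m) powr r" using a r by (intro powr_mono2) auto
  also have "\<dots> = (1 / (1 - c)) powr r * m powr r" using powr_mult[of "1 / (1 - c)" m r] c m0 by simp
  also have "m powr r \<le> (\<Sum>k\<le>n. (b k / c ^ k) powr r)"
    unfolding j(2) by (rule member_le_sum) (use j in auto)
  finally show ?thesis using c by (simp add: mult_left_mono)
qed

text \<open>
  By Tonelli every point is counted with the volume of the ball. Averaging over all centres plays the
  role of a covering by balls with bounded overlap.
\<close>
lemma power_integral_average:
  fixes f :: "'a::euclidean_space \<Rightarrow> 'b::real_normed_vector"
  assumes f: "f \<in> borel_measurable lebesgue" 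
  shows "(\<lambda>x. power_integral r (ball x \<rho>) f) \<in> borel_measurable borel"
    and "(\<integral>\<^sup>+x. power_integral r (ball x \<rho>) f \<partial>lborel) = emeasure lborel (ball (0::'a) \<rho>) * power_integral r UNIV f"
proof -
  have "(\<lambda>y. ennreal (norm (f y) powr r)) \<in> borel_measurable lebesgue" using f by measurable
  then obtain \<phi> where [measurable]: "\<phi> \<in> borel_measurable lborel" and \<phi>: "AE y in lborel. ennreal (norm (f y) powr r) = \<phi> y"
    using completion_ex_borel_measurable by blast
  have eq: "power_integral r S f = (\<integral>\<^sup>+y. \<phi> y * indicator S y \<partial>lborel)" for S
    unfolding power_integral_def nn_integral_completion
    by (rule nn_integral_cong_AE) (use \<phi> in eventually_elim, auto)
  have ind: "indicator (ball x \<rho>) y = (indicator {p. dist (fst p) (snd p) < \<rho>} (x, y) :: ennreal)" for x y :: 'a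
    by (auto simp: indicator_def)
  have [measurable]: "{p::'a \<times> 'a. dist (fst p) (snd p) < \<rho>} \<in> sets (borel \<Otimes>\<^sub>M borel)"
    unfolding borel_prod by (intro borel_open open_Collect_less continuous_intros)
  have [measurable]: "case_prod (\<lambda>x y. \<phi> y * indicator (ball x \<rho>) y) \<in> borel_measurable (lborel \<Otimes>\<^sub>M lborel)"
    unfolding ind by measurable
  show "(\<lambda>x. power_integral r (ball x \<rho>) f) \<in> borel_measurable borel"
    unfolding eq by measurable
  have "(\<integral>\<^sup>+x. power_integral r (ball x \<rho>) f \<partial>lborel) = (\<integral>\<^sup>+y. \<integral>\<^sup>+x. \<phi> y * indicator (ball x \<rho>) y \<partial>lborel \<partial>lborel)"
    unfolding eq by (subst lborel_pair.Fubini') auto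
  also have "\<dots> = (\<integral>\<^sup>+y. \<phi> y * emeasure lborel (ball (0::'a) \<rho>) \<partial>lborel)"
  proof (intro nn_integral_cong)
    fix y :: 'a
    have "(\<integral>\<^sup>+x. \<phi> y * indicator (ball x \<rho>) y \<partial>lborel) = (\<integral>\<^sup>+x. \<phi> y * indicator (ball y \<rho>) x \<partial>lborel)"
      by (intro nn_integral_cong) (auto simp: indicator_def dist_commute)
    also have "\<dots> = \<phi> y * emeasure lborel (ball y \<rho>)"
      by (intro nn_integral_cmult_indicator) auto
    also have "emeasure lborel (ball y \<rho>) = emeasure lborel (ball (0::'a) \<rho>)"
      by (cases "\<rho> \<ge> 0") (auto simp: emeasure_ball ball_empty)
    finally show "(\<integral>\<^sup>+x. \<phi> y * indicator (ball x \<rho>) y \<partial>lborel) = \<phi> y * emeasure lborel (ball (0::'a) \<rho>)" .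
  qed
  also have "\<dots> = emeasure lborel (ball (0::'a) \<rho>) * power_integral r UNIV f"
    unfolding eq by (simp add: nn_integral_multc mult.commute)
  finally show "(\<integral>\<^sup>+x. power_integral r (ball x \<rho>) f \<partial>lborel) = emeasure lborel (ball (0::'a) \<rho>) * power_integral r UNIV f" .
qed

lemma power_integral_2_diff_le:
  fixes f g :: "'a::euclidean_space \<Rightarrow> 'b::euclidean_space"
  assumes [measurable]: "f \<in> borel_measurable lebesgue" "g \<in> borel_measurable lebesgue"
  shows "power_integral 2 UNIV (\<lambda>y. f y - g y) \<le> 2 * power_integral 2 UNIV f + 2 * power_integral 2 UNIV g"
proof -
  have "ennreal (norm (a - b) powr 2) \<le> 2 * ennreal (norm a powr 2) + 2 * ennreal (norm b powr 2)" for a b :: 'b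
    using ennreal_norm_add_square_le[of a "- b"] by simp
  then have "power_integral 2 UNIV (\<lambda>y. f y - g y) \<le> (\<integral>\<^sup>+y. 2 * ennreal (norm (f y) powr 2) + 2 * ennreal (norm (g y) powr 2) \<partial>lebesgue)"
    unfolding power_integral_def by (intro nn_integral_mono) (simp add: indicator_def)
  also have "\<dots> = 2 * power_integral 2 UNIV f + 2 * power_integral 2 UNIV g"
    unfolding power_integral_def by (subst nn_integral_add) (auto simp: nn_integral_cmult)
  finally show ?thesis .
qed

lemma power_integral_sum_le:
  fixes F :: "nat \<Rightarrow> 'a::euclidean_space \<Rightarrow> 'b::euclidean_space"
  assumes [measurable]: "\<And>k. F k \<in> borel_measurable lebesgue" "S \<in> sets lebesgue"
    and f: "AE y in lebesgue. f y = (\<Sum>k\<le>n. F k y)" and c: "0 < c" "c < 1" and r: "0 < r"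
  shows "power_integral r S f \<le> ennreal ((1 / (1 - c)) powr r) * (\<Sum>k\<le>n. ennreal ((1 / c ^ k) powr r) * power_integral r S (F k))"
proof -
  have "power_integral r S f \<le> (\<integral>\<^sup>+y. ennreal ((1 / (1 - c)) powr r) *
     (\<Sum>k\<le>n. ennreal ((1 / c ^ k) powr r) * (ennreal (norm (F k y) powr r) * indicator S y)) \<partial>lebesgue)"
    unfolding power_integral_def
  proof (intro nn_integral_mono_AE, use f in eventually_elim)
    fix y assume y: "f y = (\<Sum>k\<le>n. F k y)"
    have "norm (f y) powr r \<le> (1 / (1 - c)) powr r * (\<Sum>k\<le>n. (norm (F k y) / c ^ k) powr r)"
      using sum_powr_le_weighted[OF c r, of "\<lambda>k. norm (F k y)" "norm (f y)" n] unfolding y by (auto intro: norm_sum)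
    also have "(\<Sum>k\<le>n. (norm (F k y) / c ^ k) powr r) = (\<Sum>k\<le>n. (1 / c ^ k) powr r * norm (F k y) powr r)"
      using c by (intro sum.cong refl) (simp flip: powr_mult)
    finally have "ennreal (norm (f y) powr r) \<le> ennreal ((1 / (1 - c)) powr r) * (\<Sum>k\<le>n. ennreal ((1 / c ^ k) powr r) * ennreal (norm (F k y) powr r))"
      by (simp add: ennreal_leI sum_nonneg flip: ennreal_mult)
    then show "ennreal (norm (f y) powr r) * indicator S y \<le> ennreal ((1 / (1 - c)) powr r) *
      (\<Sum>k\<le>n. ennreal ((1 / c ^ k) powr r) * (ennreal (norm (F k y) powr r) * indicator S y))"
      by (auto simp: indicator_def)
  qed
  also have "\<dots> = ennreal ((1 / (1 - c)) powr r) * (\<Sum>k\<le>n. ennreal ((1 / c ^ k) powr r) * power_integral r S (F k))"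
    unfolding power_integral_def by (simp add: nn_integral_cmult nn_integral_sum)
  finally show ?thesis .
qed

text \<open>
  The power \<open>R^(d(r/2-1))\<close> is the price of passing from \<open>L\<^sup>2\<close> to \<open>L^r\<close> norms of \<open>f\<close>; its dyadic part
  has to be absorbed by the decay in \<open>k\<close>, and its part in \<open>\<rho>\<close> cancels the scaling of \<open>T\<close>.
\<close>
lemma power_integral_2_ball_powr_le:
  fixes f :: "'a::euclidean_space \<Rightarrow> 'b::real_normed_vector"
  assumes f: "f \<in> borel_measurable lebesgue" and r: "2 \<le> r" and R: "0 < R"
    and fin: "power_integral r UNIV f < \<infinity>"
  shows "ennreal (enn2real (power_integral 2 (ball x R) f) powr (r / 2)) \<le>
    ennreal (2 powr (r / 2) * (unit_ball_vol (real DIM('a)) * R powr real DIM('a)) powr (r / 2 - 1)) *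
      power_integral r (ball x R) f"
    and "power_integral 2 (ball x R) f < \<infinity>"
proof -
  have "power_integral r (ball x R) f \<le> power_integral r UNIV f" by (rule power_integral_mono_set) simp
  then have "power_integral r (ball x R) f < \<infinity>" using fin by (rule le_less_trans)
  then obtain E where E: "power_integral r (ball x R) f = ennreal E" "0 \<le> E" by (cases "power_integral r (ball x R) f") auto
  define \<mu> where "\<mu> = unit_ball_vol (real DIM('a)) * R powr real DIM('a)"
  have \<mu>: "emeasure lebesgue (ball x R) = ennreal \<mu>" "0 < \<mu>"
    using R by (auto simp: \<mu>_def emeasure_ball powr_realpow)
  have le: "power_integral 2 (ball x R) f \<le> ennreal (2 * \<mu> powr (1 - 2/r) * E powr (2/r))"
    by (rule power_integral_2_le[OF f _ r \<mu> E]) auto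
  then show "power_integral 2 (ball x R) f < \<infinity>" by (rule le_less_trans) simp
  have "enn2real (power_integral 2 (ball x R) f) \<le> 2 * \<mu> powr (1 - 2/r) * E powr (2/r)"
    using le by (intro enn2real_leI) auto
  then have "enn2real (power_integral 2 (ball x R) f) powr (r/2) \<le> (2 * \<mu> powr (1 - 2/r) * E powr (2/r)) powr (r/2)"
    using r by (intro powr_mono2) auto
  also have "\<dots> = 2 powr (r/2) * \<mu> powr (r/2 - 1) * E"
  proof -
    have "(1 - 2/r) * (r/2) = r/2 - 1" "(2/r) * (r/2) = 1" using r by (auto simp: field_simps)
    then show ?thesis using \<mu> E by (simp only: powr_mult powr_powr) simp
  qed
  finally show "ennreal (enn2real (power_integral 2 (ball x R) f) powr (r / 2)) \<le>
    ennreal (2 powr (r / 2) * (unit_ball_vol (real DIM('a)) * R powr real DIM('a)) powr (r / 2 - 1)) *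
      power_integral r (ball x R) f"
    unfolding E \<mu>_def[symmetric] using E by (simp flip: ennreal_mult)
qed

text \<open>
  Let \<open>g k\<close> extend \<open>f\<close> from the ball of radius \<open>2^k \<rho>\<close>. Then \<open>T f\<close> is the sum of \<open>T (u k)\<close> for
  \<open>k \<le> n\<close>, where \<open>u k = g k - g (k-1)\<close> vanishes on the ball of radius \<open>2^(k-1) \<rho>\<close>, and of
  \<open>T (f - g n)\<close>. The last term is small because \<open>f - g n\<close> vanishes on the ball of radius \<open>2^n \<rho>\<close> while
  its norm stays bounded, so one may let \<open>n\<close> tend to infinity.
  
  With \<open>s = \<nu>(1-t)/2\<close> the \<open>k\<close>-th term carries \<open>2^(-srk)\<close> from the decay and \<open>2^(d(r/2-1)k)\<close> from
  comparing \<open>L\<^sup>2\<close> with \<open>L^r\<close>, hence \<open>2^(-\<mu>k)\<close> with \<open>\<mu> - d = r (s - d/2) > 0\<close>. Half of this surplus is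
  spent on the weights \<open>c^k\<close> of \<open>sum_powr_le_weighted\<close>; the other half leaves \<open>\<kappa> > d\<close>.
\<close>
lemma ball_estimate:
  fixes T :: "complex \<Rightarrow> ('a::euclidean_space \<Rightarrow> 'v::euclidean_space) \<Rightarrow> 'a \<Rightarrow> 'w::euclidean_space"
  assumes ext: "has_local_extensions V L K" and L: "0 < L" and K: "0 < K"
    and V_sub: "V \<subseteq> Lp_space 2"
    and V_diff: "\<And>f g. f \<in> V \<Longrightarrow> g \<in> V \<Longrightarrow> (\<lambda>y. f y - g y) \<in> V"
    and T_meas: "\<And>z f. z \<in> \<Omega> \<Longrightarrow> f \<in> V \<Longrightarrow> T z f \<in> borel_measurable lebesgue"
    and T_diff: "\<And>z f g. z \<in> \<Omega> \<Longrightarrow> f \<in> V \<Longrightarrow> g \<in> V \<Longrightarrow> AE y in lebesgue. T z (\<lambda>y. f y - g y) y = T z f y - T z g y"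
    and decay: "L2_Lp_decay \<Omega> V T \<nu> q" and bounds: "L2_Lp_bounds \<Omega> V T p"
    and \<Omega>: "0 \<notin> \<Omega>" and \<nu>: "real DIM('a) < \<nu> * (1 - t)" and q: "2 \<le> q" "q \<le> r" "r < p" and t: "0 \<le> t" "t < 1"
    and rec: "erecip r = (1 - t) * erecip q + t * erecip p"
  obtains C \<kappa> where "0 < C" "real DIM('a) < \<kappa>"
    and "\<And>z f x. \<lbrakk>z \<in> \<Omega>; f \<in> V; power_integral (enn2real r) UNIV f < \<infinity>\<rbrakk> \<Longrightarrow>
      power_integral (enn2real r) (ball x (sqrt (cmod z))) (T z f) \<le>
        ennreal C * (\<Sum>k. ennreal (2 powr (- \<kappa> * real k)) *
          power_integral (enn2real r) (ball x (L * (2 ^ k * sqrt (cmod z)))) f)"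
proof -
  define d where "d = real DIM('a)"
  define r' where "r' = enn2real r"
  have d: "d > 0" by (simp add: d_def)
  have rr: "r = ennreal r'" "r' \<ge> 2"
  proof -
    have "r < \<infinity>" using q by (metis infinity_ennreal_def top.not_eq_extremum not_top_less)
    then show "r = ennreal r'" by (simp add: r'_def)
    moreover have "2 \<le> r" using q by simp
    ultimately show "r' \<ge> 2" unfolding r'_def
      by (metis \<open>r < \<infinity>\<close> enn2real_mono enn2real_numeral infinity_ennreal_def)
  qed
  have er: "erecip r = 1 / r'"
    unfolding erecip_def rr(1) using rr(2) by (simp add: divide_ennreal flip: ennreal_1)
  have \<nu>0: "\<nu> > 0" using \<nu> d t unfolding d_def by (intro zero_less_mult_pos2[of \<nu> "1 - t"]) auto
  obtain C where C: "0 < C" and est: "\<And>z x k u N. \<lbrakk>z \<in> \<Omega>; u \<in> V; 0 \<le> N; power_integral 2 UNIV u \<le> ennreal (N powr 2);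
      0 < k \<Longrightarrow> \<forall>y\<in>ball x (2 ^ (k - 1) * sqrt (cmod z)). u y = 0\<rbrakk> \<Longrightarrow>
      power_integral r' (ball x (sqrt (cmod z))) (T z u) \<le>
        ennreal (C * (sqrt (cmod z) powr (- d * (1/2 - 1 / r')) *
          2 powr (- (\<nu> * (1 - t) / 2) * real k) * N) powr r')"
    using local_estimate[OF decay bounds \<Omega> \<nu>0 q t rec T_meas] unfolding er d_def[symmetric] r'_def[symmetric] by blast
  define s a \<mu> \<epsilon> c \<kappa> where "s = \<nu> * (1 - t) / 2" and "a = d * (1/2 - 1 / r')" and "\<mu> = s * r' - a * r'"
    and "\<epsilon> = (s - d/2) / 2" and "c = 2 powr - \<epsilon>" and "\<kappa> = \<mu> - \<epsilon> * r'"
  have s: "s > d / 2" using \<nu> by (simp add: s_def d_def)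
  have \<epsilon>: "\<epsilon> > 0" "\<epsilon> < s" using s d by (auto simp: \<epsilon>_def)
  have c: "0 < c" "c < 1" using \<epsilon> by (auto simp: c_def powr_less_one)
  have ar: "a * r' = d * (r' / 2 - 1)" using rr(2) by (simp add: a_def field_simps)
  have \<kappa>: "d < \<kappa>"
  proof -
    have "\<kappa> - d = r' * (s - d/2) / 2" unfolding \<kappa>_def \<mu>_def ar \<epsilon>_def by (simp add: field_simps)
    moreover have "r' * (s - d/2) / 2 > 0" using s rr(2) by simp
    ultimately show ?thesis by linarith
  qed
  have cp: "(1 / c ^ k) powr r' = 2 powr (\<epsilon> * r' * real k)" for k
  proof -
    have "1 / c ^ k = 2 powr (\<epsilon> * real k)"
      by (simp add: c_def powr_minus field_simps powr_power)
    then show ?thesis by (simp add: powr_powr mult_ac)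
  qed
  define \<omega> where "\<omega> = unit_ball_vol (real DIM('a))"
  have \<omega>: "\<omega> > 0" by (simp add: \<omega>_def)
  define C3 where "C3 = C * (4 * K) powr (r' / 2) * 2 powr (r' / 2) * (\<omega> * L powr d) powr (r' / 2 - 1)"
  define W where "W = (1 / (1 - c)) powr r'"
  have W: "W > 0" using c by (simp add: W_def)
  have C3: "C3 > 0" using C K \<omega> L by (simp add: C3_def)
  show thesis
  proof
    show "0 < W * C3" using W C3 by simp
    show "real DIM('a) < \<kappa>" using \<kappa> by (simp add: d_def)
    fix z f x assume z: "z \<in> \<Omega>" and f: "f \<in> V" and fin: "power_integral (enn2real r) UNIV f < \<infinity>"
    define \<rho> where "\<rho> = sqrt (cmod z)"
    have \<rho>: "\<rho> > 0" using z \<Omega> by (auto simp: \<rho>_def)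
    have V_meas: "h \<in> borel_measurable lebesgue" if "h \<in> V" for h using V_sub that by (auto simp: Lp_space_def)
    define Nf where "Nf = enn2real (power_integral 2 UNIV f)"
    have Nf: "power_integral 2 UNIV f = ennreal Nf"
    proof -
      have "Lp_norm 2 UNIV f < \<infinity>" using f V_sub by (auto simp: Lp_space_def)
      then have "power_integral 2 UNIV f < \<infinity>" 
        by (auto simp: Lp_norm_eq_power_integral epowr_def less_top split: if_splits)
      then show ?thesis by (simp add: Nf_def)
    qed
    have Nf0: "Nf \<ge> 0" by (simp add: Nf_def)
    define J where "J k = enn2real (power_integral 2 (ball x (L * (2 ^ k * \<rho>))) f)" for k
    have J: "power_integral 2 (ball x (L * (2 ^ k * \<rho>))) f = ennreal (J k)" for k
      using power_integral_2_ball_powr_le(2)[OF V_meas[OF f] rr(2), of "L * (2 ^ k * \<rho>)" x] fin L \<rho>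
      by (simp add: J_def r'_def)
    have J0: "J k \<ge> 0" for k by (simp add: J_def)
    have JN: "J k \<le> Nf" for k
      using power_integral_mono_set[of "ball x (L * (2 ^ k * \<rho>))" UNIV 2 f] Nf0 by (simp add: J Nf)
    have J_mono: "J (k - 1) \<le> J k" for k
    proof -
      have "L * (2 ^ (k - 1) * \<rho>) \<le> L * (2 ^ k * \<rho>)"
        using L \<rho> by (intro mult_left_mono mult_right_mono power_increasing) auto
      then have "ball x (L * (2 ^ (k - 1) * \<rho>)) \<subseteq> ball x (L * (2 ^ k * \<rho>))" by (rule subset_ball)
      then show ?thesis using power_integral_mono_set[of _ _ 2 f] J0 by (metis J ennreal_le_iff)
    qed
    have "\<exists>g\<in>V. (\<forall>y\<in>ball x (2 ^ k * \<rho>). g y = f y) \<and> power_integral 2 UNIV g \<le> ennreal K * ennreal (J k)" for k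
      using ext f \<rho> unfolding has_local_extensions_def J[symmetric] by simp
    then obtain g where g: "\<And>k. g k \<in> V" "\<And>k y. y \<in> ball x (2 ^ k * \<rho>) \<Longrightarrow> g k y = f y"
      and g2: "\<And>k. power_integral 2 UNIV (g k) \<le> ennreal K * ennreal (J k)"
      by metis
    have diff2: "power_integral 2 UNIV (\<lambda>y. h y - h' y) \<le> ennreal (2 * A + 2 * B)"
      if "h \<in> V" "h' \<in> V" "power_integral 2 UNIV h \<le> ennreal A" "power_integral 2 UNIV h' \<le> ennreal B" "0 \<le> A" "0 \<le> B" for h h' A B
    proof -
      have "power_integral 2 UNIV (\<lambda>y. h y - h' y) \<le> 2 * power_integral 2 UNIV h + 2 * power_integral 2 UNIV h'"
        using that by (intro power_integral_2_diff_le V_meas)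
      also have "\<dots> \<le> 2 * ennreal A + 2 * ennreal B" using that by (intro add_mono mult_left_mono) auto
      also have "\<dots> = ennreal (2 * A + 2 * B)" using that by (simp add: ennreal_mult ennreal_plus)
      finally show ?thesis .
    qed
    define u where "u k = (if k = 0 then g 0 else (\<lambda>y. g k y - g (k - 1) y))" for k
    have uV: "u k \<in> V" for k using g V_diff by (auto simp: u_def)
    have u2: "power_integral 2 UNIV (u k) \<le> ennreal ((2 * sqrt (K * J k)) powr 2)" for k
    proof -
      have KJ: "power_integral 2 UNIV (g k) \<le> ennreal (K * J k)" for k using g2[of k] K J0 by (simp add: ennreal_mult)
      have "power_integral 2 UNIV (u k) \<le> ennreal (4 * (K * J k))"
      proof (cases "k = 0")
        case True
        then show ?thesis using KJ[of 0] K J0[of 0] by (auto simp: u_def intro: order_trans ennreal_leI)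
      next
        case False
        have "power_integral 2 UNIV (u k) \<le> ennreal (2 * (K * J k) + 2 * (K * J (k - 1)))"
          using diff2[OF g(1) g(1) KJ[of k] KJ[of "k - 1"]] False K J0 by (simp add: u_def)
        also have "\<dots> \<le> ennreal (4 * (K * J k))" using J_mono[of k] K by (intro ennreal_leI) simp
        finally show ?thesis .
      qed
      then show ?thesis using K J0 by simp
    qed
    have uz: "u k y = 0" if "0 < k" "y \<in> ball x (2 ^ (k - 1) * \<rho>)" for k y
    proof -
      have "ball x (2 ^ (k - 1) * \<rho>) \<subseteq> ball x (2 ^ k * \<rho>)"
        using \<rho> by (intro subset_ball mult_right_mono power_increasing) auto
      then show ?thesis using that g(2)[of y k] g(2)[of y "k - 1"] by (auto simp: u_def)
    qed
    define E where "E k = power_integral r' (ball x (L * (2 ^ k * \<rho>))) f" for k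
    have Tu: "power_integral r' (ball x \<rho>) (T z (u k)) \<le> ennreal C3 * (ennreal (2 powr (- \<mu> * real k)) * E k)" for k
    proof -
      have "power_integral r' (ball x \<rho>) (T z (u k)) \<le> 
        ennreal (C * (\<rho> powr (- a) * 2 powr (- s * real k) * (2 * sqrt (K * J k))) powr r')"
        using est[OF z uV _ u2, of k k x] uz[of k] K J0 unfolding \<rho>_def[symmetric] s_def a_def by simp
      also have "C * (\<rho> powr (- a) * 2 powr (- s * real k) * (2 * sqrt (K * J k))) powr r'
        = (C * (4 * K) powr (r' / 2) * \<rho> powr (- a * r') * 2 powr (- s * r' * real k)) * J k powr (r' / 2)"
      proof -
        have "2 * sqrt (K * J k) = (4 * K * J k) powr (1/2)" 
          using K J0 by (simp add: powr_half_sqrt real_sqrt_mult)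
        then have "(2 * sqrt (K * J k)) powr r' = (4 * K) powr (r' / 2) * J k powr (r' / 2)"
          using K J0[of k] by (simp add: powr_powr powr_mult)
        then show ?thesis using K J0[of k] by (simp add: powr_mult powr_powr mult_ac)
      qed
      also have "ennreal \<dots> = ennreal (C * (4 * K) powr (r' / 2) * \<rho> powr (- a * r') * 2 powr (- s * r' * real k)) * ennreal (J k powr (r' / 2))"
        using C K by (subst ennreal_mult) auto
      also have "\<dots> \<le> ennreal (C * (4 * K) powr (r' / 2) * \<rho> powr (- a * r') * 2 powr (- s * r' * real k)) *
         (ennreal (2 powr (r' / 2) * (\<omega> * (L * (2 ^ k * \<rho>)) powr d) powr (r' / 2 - 1)) * E k)"
        using power_integral_2_ball_powr_le(1)[OF V_meas[OF f] rr(2), of "L * (2 ^ k * \<rho>)" x] fin L \<rho>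
        by (intro mult_left_mono) (auto simp: J_def r'_def \<omega>_def d_def E_def)
      also have "\<dots> = ennreal ((C * (4 * K) powr (r' / 2) * \<rho> powr (- a * r') * 2 powr (- s * r' * real k)) *
         (2 powr (r' / 2) * (\<omega> * (L * (2 ^ k * \<rho>)) powr d) powr (r' / 2 - 1))) * E k"
        using C K by (simp add: ennreal_mult mult.assoc)
      also have "(\<omega> * (L * (2 ^ k * \<rho>)) powr d) powr (r' / 2 - 1) = (\<omega> * L powr d) powr (r' / 2 - 1) * 2 powr (a * r' * real k) * \<rho> powr (a * r')"
      proof -
        have "(2::real) ^ k = 2 powr real k" by (simp add: powr_realpow)
        then have "\<omega> * (L * (2 ^ k * \<rho>)) powr d = (\<omega> * L powr d) * 2 powr (real k * d) * \<rho> powr d"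
          using L \<rho> by (simp only: powr_mult powr_powr mult_ac)
        then show ?thesis unfolding ar using L \<rho> \<omega> by (simp only: powr_mult powr_powr mult_ac)
      qed
      also have "(C * (4 * K) powr (r' / 2) * \<rho> powr (- a * r') * 2 powr (- s * r' * real k)) *
         (2 powr (r' / 2) * ((\<omega> * L powr d) powr (r' / 2 - 1) * 2 powr (a * r' * real k) * \<rho> powr (a * r')))
        = C3 * (\<rho> powr (- a * r') * \<rho> powr (a * r')) * (2 powr (- s * r' * real k) * 2 powr (a * r' * real k))"
        by (simp add: C3_def mult_ac)
      also have "\<rho> powr (- a * r') * \<rho> powr (a * r') = 1" using \<rho> by (simp flip: powr_add)
      also have "2 powr (- s * r' * real k) * 2 powr (a * r' * real k) = 2 powr (- \<mu> * real k)"
        by (simp add: \<mu>_def algebra_simps flip: powr_add)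
      finally show ?thesis using C3 by (simp add: ennreal_mult mult.assoc)
    qed
    \<comment> \<open>A bound for the norm of all remainders \<open>f - g n\<close>; it only has to
      be independent of \<open>n\<close>.\<close>
    define N' where "N' = sqrt ((2 + 2 * K) * Nf)"
    define R0 where "R0 = C * (\<rho> powr (- a) * N') powr r'"
    have R0: "R0 \<ge> 0" using C by (simp add: R0_def)
    define v where "v n y = f y - g n y" for n y
    have vV: "v n \<in> V" for n unfolding v_def using V_diff f g by simp
    have Tv: "power_integral r' (ball x \<rho>) (T z (v n)) \<le> ennreal (R0 * 2 powr (- s * r' * real (Suc n)))" for n
    proof -
      have "power_integral 2 UNIV (v n) \<le> ennreal (2 * Nf + 2 * (K * Nf))"
        unfolding v_def
      proof (rule diff2)
        have "ennreal K * ennreal (J n) \<le> ennreal (K * Nf)" using JN[of n] K J0[of n] by (simp add: ennreal_leI flip: ennreal_mult)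
        then show "power_integral 2 UNIV (g n) \<le> ennreal (K * Nf)" using g2[of n] by (rule order_trans[rotated])
      qed (use f g Nf Nf0 K in auto)
      also have "2 * Nf + 2 * (K * Nf) = N' powr 2" using Nf0 K by (simp add: N'_def algebra_simps)
      finally have v2: "power_integral 2 UNIV (v n) \<le> ennreal (N' powr 2)" .
      have "N' \<ge> 0" using Nf0 K by (simp add: N'_def)
      have "power_integral r' (ball x \<rho>) (T z (v n)) \<le> ennreal (C * (\<rho> powr (- a) * 2 powr (- s * real (Suc n)) * N') powr r')"
        using est[OF z vV \<open>N' \<ge> 0\<close> v2, of "Suc n" x] g(2)[of _ n] unfolding \<rho>_def[symmetric] s_def a_def v_def by simp
      also have "C * (\<rho> powr (- a) * 2 powr (- s * real (Suc n)) * N') powr r' = R0 * 2 powr (- s * r' * real (Suc n))"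
        using \<open>N' \<ge> 0\<close> by (simp add: R0_def powr_mult powr_powr algebra_simps)
      finally show ?thesis .
    qed
    define \<Sigma> where "\<Sigma> = (\<Sum>k. ennreal (2 powr (- \<kappa> * real k)) * E k)"
    have main: "power_integral r' (ball x \<rho>) (T z f) \<le> ennreal W * (ennreal C3 * \<Sigma> + ennreal (R0 * (2 powr (- (s - \<epsilon>) * r')) ^ Suc n))" for n
    proof -
      define F where "F k = (if k \<le> n then T z (u k) else T z (v n))" for k
      have "AE y in lebesgue. \<forall>k. 0 < k \<longrightarrow> T z (\<lambda>y. g k y - g (k - 1) y) y = T z (g k) y - T z (g (k - 1)) y"
        using T_diff[OF z] g by (subst AE_all_countable) auto
      moreover have "AE y in lebesgue. T z (v n) y = T z f y - T z (g n) y"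
        unfolding v_def using T_diff[OF z f g(1)] .
      ultimately have sum: "AE y in lebesgue. T z f y = (\<Sum>k\<le>Suc n. F k y)"
      proof eventually_elim
        case (elim y)
        have "(\<Sum>k\<le>m. T z (u k) y) = T z (g m) y" for m
        proof (induction m)
          case (Suc m)
          then show ?case using elim(1)[rule_format, of "Suc m"] by (simp add: u_def)
        qed (simp add: u_def)
        then show ?case using elim(2) by (simp add: F_def)
      qed
      have "power_integral r' (ball x \<rho>) (T z f) \<le> ennreal W * (\<Sum>k\<le>Suc n. ennreal ((1 / c ^ k) powr r') * power_integral r' (ball x \<rho>) (F k))"
        unfolding W_def
        by (rule power_integral_sum_le[OF _ _ sum c]) (use rr T_meas[OF z] uV vV in \<open>auto simp: F_def\<close>)
      also have "\<dots> = ennreal W * ((\<Sum>k\<le>n. ennreal (2 powr (\<epsilon> * r' * real k)) * power_integral r' (ball x \<rho>) (T z (u k)))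
         + ennreal (2 powr (\<epsilon> * r' * real (Suc n))) * power_integral r' (ball x \<rho>) (T z (v n)))"
        unfolding cp by (simp add: F_def)
      also have "\<dots> \<le> ennreal W * ((\<Sum>k\<le>n. ennreal C3 * (ennreal (2 powr (- \<kappa> * real k)) * E k)) 
          + ennreal (R0 * (2 powr (- (s - \<epsilon>) * r')) ^ Suc n))"
      proof (intro mult_left_mono add_mono sum_mono)
        fix k
        have "ennreal (2 powr (\<epsilon> * r' * real k)) * power_integral r' (ball x \<rho>) (T z (u k))
          \<le> ennreal (2 powr (\<epsilon> * r' * real k)) * (ennreal C3 * (ennreal (2 powr (- \<mu> * real k)) * E k))"
          by (intro mult_left_mono Tu) auto
        also have "\<dots> = ennreal C3 * (ennreal (2 powr (\<epsilon> * r' * real k) * 2 powr (- \<mu> * real k)) * E k)"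
          by (simp add: ennreal_mult mult_ac)
        also have "2 powr (\<epsilon> * r' * real k) * 2 powr (- \<mu> * real k) = 2 powr (- \<kappa> * real k)"
          by (simp add: \<kappa>_def algebra_simps flip: powr_add)
        finally show "ennreal (2 powr (\<epsilon> * r' * real k)) * power_integral r' (ball x \<rho>) (T z (u k))
          \<le> ennreal C3 * (ennreal (2 powr (- \<kappa> * real k)) * E k)" .
        have "ennreal (2 powr (\<epsilon> * r' * real (Suc n))) * power_integral r' (ball x \<rho>) (T z (v n))
          \<le> ennreal (2 powr (\<epsilon> * r' * real (Suc n))) * ennreal (R0 * 2 powr (- s * r' * real (Suc n)))"
          by (intro mult_left_mono Tv) auto
        also have "\<dots> = ennreal (R0 * (2 powr (\<epsilon> * r' * real (Suc n)) * 2 powr (- s * r' * real (Suc n))))"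
          using R0 by (simp add: mult_ac flip: ennreal_mult)
        also have "2 powr (\<epsilon> * r' * real (Suc n)) * 2 powr (- s * r' * real (Suc n)) = (2 powr (- (s - \<epsilon>) * r')) ^ Suc n"
        proof -
          have pw: "(2 powr e) ^ m = 2 powr (e * real m)" for e :: real and m
            by (simp add: powr_powr flip: powr_realpow)
          have "(2 powr (- (s - \<epsilon>) * r')) ^ Suc n = 2 powr ((- (s - \<epsilon>) * r') * real (Suc n))"
            by (rule pw)
          also have "(- (s - \<epsilon>) * r') * real (Suc n) = \<epsilon> * r' * real (Suc n) + - s * r' * real (Suc n)"
            by (simp add: algebra_simps)
          finally show ?thesis by (simp only: powr_add)
        qed
        finally show "ennreal (2 powr (\<epsilon> * r' * real (Suc n))) * power_integral r' (ball x \<rho>) (T z (v n))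
          \<le> ennreal (R0 * (2 powr (- (s - \<epsilon>) * r')) ^ Suc n)" .
      qed auto
      also have "(\<Sum>k\<le>n. ennreal C3 * (ennreal (2 powr (- \<kappa> * real k)) * E k)) \<le> ennreal C3 * \<Sigma>"
        unfolding \<Sigma>_def sum_distrib_left[symmetric] by (intro mult_left_mono sum_le_suminf) auto
      finally show ?thesis by (simp add: mult_left_mono add_right_mono)
    qed
    have "(\<lambda>n. (2 powr (- (s - \<epsilon>) * r')) ^ Suc n) \<longlonglongrightarrow> 0"
      by (intro LIMSEQ_Suc LIMSEQ_realpow_zero) (use \<epsilon> rr in \<open>auto intro!: powr_less_one mult_neg_pos simp: mult_less_0_iff\<close>)
    then have "(\<lambda>n. ennreal (R0 * (2 powr (- (s - \<epsilon>) * r')) ^ Suc n)) \<longlonglongrightarrow> ennreal (R0 * 0)"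
      by (intro tendsto_ennrealI tendsto_mult tendsto_const)
    then have "(\<lambda>n. ennreal W * (ennreal C3 * \<Sigma> + ennreal (R0 * (2 powr (- (s - \<epsilon>) * r')) ^ Suc n)))
      \<longlonglongrightarrow> ennreal W * (ennreal C3 * \<Sigma> + ennreal (R0 * 0))"
      by (intro ennreal_tendsto_cmult tendsto_add tendsto_const) auto
    then have "power_integral r' (ball x \<rho>) (T z f) \<le> ennreal W * (ennreal C3 * \<Sigma> + ennreal (R0 * 0))"
      by (rule tendsto_lowerbound) (use main in auto)
    also have "\<dots> = ennreal (W * C3) * \<Sigma>" using W C3 by (simp add: ennreal_mult mult.assoc)
    finally show "power_integral (enn2real r) (ball x (sqrt (cmod z))) (T z f) \<le>
        ennreal (W * C3) * (\<Sum>k. ennreal (2 powr (- \<kappa> * real k)) *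
          power_integral (enn2real r) (ball x (L * (2 ^ k * sqrt (cmod z)))) f)"
      by (simp add: \<Sigma>_def E_def \<rho>_def r'_def)
  qed
qed

text \<open>
  Integrating \<open>ball_estimate\<close> over the centres, the \<open>k\<close>-th term is multiplied by the ratio \<open>(L 2^k)^d\<close>
  of the volumes of the balls, which the factor \<open>2^(-\<kappa>k)\<close> beats.
\<close>
lemma extrapolation:
  fixes T :: "complex \<Rightarrow> ('a::euclidean_space \<Rightarrow> 'v::euclidean_space) \<Rightarrow> 'a \<Rightarrow> 'w::euclidean_space"
  assumes ext: "has_local_extensions V L K" and L: "0 < L" and K: "0 < K"
    and V_sub: "V \<subseteq> Lp_space 2"
    and V_diff: "\<And>f g. f \<in> V \<Longrightarrow> g \<in> V \<Longrightarrow> (\<lambda>y. f y - g y) \<in> V"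
    and T_meas: "\<And>z f. z \<in> \<Omega> \<Longrightarrow> f \<in> V \<Longrightarrow> T z f \<in> borel_measurable lebesgue"
    and T_diff: "\<And>z f g. z \<in> \<Omega> \<Longrightarrow> f \<in> V \<Longrightarrow> g \<in> V \<Longrightarrow> AE y in lebesgue. T z (\<lambda>y. f y - g y) y = T z f y - T z g y"
    and decay: "L2_Lp_decay \<Omega> V T \<nu> q" and bounds: "L2_Lp_bounds \<Omega> V T p"
    and \<Omega>: "0 \<notin> \<Omega>" and \<nu>: "real DIM('a) < \<nu> * (1 - t)" and q: "2 \<le> q" "q \<le> r" "r < p" and t: "0 \<le> t" "t < 1"
    and rec: "erecip r = (1 - t) * erecip q + t * erecip p"
  shows "uniformly_Lr_bounded \<Omega> V T r"
proof -
  obtain C \<kappa> where C: "0 < C" and \<kappa>: "real DIM('a) < \<kappa>"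
    and est: "\<And>z f x. \<lbrakk>z \<in> \<Omega>; f \<in> V; power_integral (enn2real r) UNIV f < \<infinity>\<rbrakk> \<Longrightarrow>
      power_integral (enn2real r) (ball x (sqrt (cmod z))) (T z f) \<le>
        ennreal C * (\<Sum>k. ennreal (2 powr (- \<kappa> * real k)) *
          power_integral (enn2real r) (ball x (L * (2 ^ k * sqrt (cmod z)))) f)"
    by (rule ball_estimate[OF assms]) (assumption | (rule that; blast))+
  define r' where "r' = enn2real r"
  have "0 < (2::ennreal)" by simp
  then have "r > 0" using q(1,2) by (meson less_le_trans)
  moreover have "r \<noteq> \<infinity>" using q(3) by auto
  ultimately have r: "r \<noteq> \<infinity>" "r > 0" by auto
  then have r': "r' > 0" unfolding r'_def by (simp add: enn2real_positive_iff less_top)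
  define d where "d = DIM('a)"
  define \<eta> where "\<eta> = 2 powr (real d - \<kappa>)"
  have \<eta>: "0 < \<eta>" "\<eta> < 1" using \<kappa> by (auto simp: \<eta>_def d_def powr_less_one)
  define C4 where "C4 = C * L ^ d * (1 / (1 - \<eta>))"
  have C4: "C4 > 0" using C L \<eta> by (simp add: C4_def)
  have key: "power_integral r' UNIV (T z f) \<le> ennreal C4 * power_integral r' UNIV f"
    if z: "z \<in> \<Omega>" and f: "f \<in> V" and fin: "power_integral r' UNIV f < \<infinity>" for z f
  proof -
    define \<rho> where "\<rho> = sqrt (cmod z)"
    have \<rho>: "\<rho> > 0" using z \<Omega> by (auto simp: \<rho>_def)
    have mf: "f \<in> borel_measurable lebesgue" using f V_sub by (auto simp: Lp_space_def)
    note [measurable] = power_integral_average(1)[OF mf]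
    define \<omega> where "\<omega> = unit_ball_vol (real DIM('a))"
    have \<omega>: "\<omega> > 0" by (simp add: \<omega>_def)
    have vol: "emeasure lborel (ball (0::'a) R) = ennreal (\<omega> * R ^ d)" if "R \<ge> 0" for R
      using that by (simp add: emeasure_ball \<omega>_def d_def)
    define m where "m = power_integral r' UNIV f"
    have "ennreal (\<omega> * \<rho> ^ d) * power_integral r' UNIV (T z f) = (\<integral>\<^sup>+x. power_integral r' (ball x \<rho>) (T z f) \<partial>lborel)"
      using \<rho> by (simp add: power_integral_average(2)[OF T_meas[OF z f]] vol)
    also have "\<dots> \<le> (\<integral>\<^sup>+x. ennreal C * (\<Sum>k. ennreal (2 powr (- \<kappa> * real k)) *
          power_integral r' (ball x (L * (2 ^ k * \<rho>))) f) \<partial>lborel)"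
      using est[OF z f] fin by (intro nn_integral_mono) (simp add: r'_def \<rho>_def)
    also have "\<dots> = ennreal C * (\<Sum>k. ennreal (2 powr (- \<kappa> * real k)) * (ennreal (\<omega> * (L * (2 ^ k * \<rho>)) ^ d) * m))"
      using L \<rho> by (simp add: nn_integral_cmult nn_integral_suminf power_integral_average(2)[OF mf] vol m_def)
    also have "(\<lambda>k. ennreal (2 powr (- \<kappa> * real k)) * (ennreal (\<omega> * (L * (2 ^ k * \<rho>)) ^ d) * m)) =
       (\<lambda>k. ennreal (\<eta> ^ k) * (ennreal (\<omega> * \<rho> ^ d * L ^ d) * m))"
    proof
      fix k
      have "\<eta> ^ k = 2 powr (- \<kappa> * real k) * (2 ^ k) ^ d"
        unfolding \<eta>_def by (simp add: powr_power powr_realpow[symmetric] powr_powr algebra_simps flip: powr_add power_mult)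
      then have "2 powr (- \<kappa> * real k) * (\<omega> * (L * (2 ^ k * \<rho>)) ^ d) = \<eta> ^ k * (\<omega> * \<rho> ^ d * L ^ d)"
        by (simp add: power_mult_distrib mult_ac)
      moreover have "ennreal (2 powr (- \<kappa> * real k)) * (ennreal (\<omega> * (L * (2 ^ k * \<rho>)) ^ d) * m) =
          ennreal (2 powr (- \<kappa> * real k) * (\<omega> * (L * (2 ^ k * \<rho>)) ^ d)) * m"
        using \<omega> L \<rho> by (subst ennreal_mult) (auto simp: mult.assoc)
      moreover have "ennreal (\<eta> ^ k) * (ennreal (\<omega> * \<rho> ^ d * L ^ d) * m) = ennreal (\<eta> ^ k * (\<omega> * \<rho> ^ d * L ^ d)) * m"
        using \<omega> L \<rho> \<eta> by (subst ennreal_mult) (auto simp: mult.assoc)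
      ultimately show "ennreal (2 powr (- \<kappa> * real k)) * (ennreal (\<omega> * (L * (2 ^ k * \<rho>)) ^ d) * m) = ennreal (\<eta> ^ k) * (ennreal (\<omega> * \<rho> ^ d * L ^ d) * m)"
        by (simp only:)
    qed
    also have "(\<Sum>k. ennreal (\<eta> ^ k) * (ennreal (\<omega> * \<rho> ^ d * L ^ d) * m)) = ennreal (1 / (1 - \<eta>)) * (ennreal (\<omega> * \<rho> ^ d * L ^ d) * m)"
    proof -
      have "(\<Sum>k. ennreal (\<eta> ^ k)) = ennreal (1 / (1 - \<eta>))"
        using \<eta> geometric_sums[of \<eta>] by (intro suminf_ennreal_eq) auto
      then show ?thesis by (simp add: ennreal_suminf_multc)
    qed
    also have "ennreal C * (ennreal (1 / (1 - \<eta>)) * (ennreal (\<omega> * \<rho> ^ d * L ^ d) * m)) = ennreal (\<omega> * \<rho> ^ d) * (ennreal C4 * m)"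
    proof -
      have "ennreal C * (ennreal (1 / (1 - \<eta>)) * ennreal (\<omega> * \<rho> ^ d * L ^ d)) = ennreal (C * (1 / (1 - \<eta>) * (\<omega> * \<rho> ^ d * L ^ d)))"
        using C L \<eta> \<omega> \<rho> by (subst ennreal_mult, simp, simp)+ simp
      also have "C * (1 / (1 - \<eta>) * (\<omega> * \<rho> ^ d * L ^ d)) = \<omega> * \<rho> ^ d * C4"
        unfolding C4_def by (simp add: mult_ac)
      also have "ennreal (\<omega> * \<rho> ^ d * C4) = ennreal (\<omega> * \<rho> ^ d) * ennreal C4"
        using C4 \<omega> \<rho> by (subst ennreal_mult) auto
      finally show ?thesis by (simp add: mult.assoc[symmetric])
    qed
    finally have le: "ennreal (\<omega> * \<rho> ^ d) * power_integral r' UNIV (T z f) \<le> ennreal (\<omega> * \<rho> ^ d) * (ennreal C4 * m)" .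
    have pos: "\<omega> * \<rho> ^ d > 0" using \<omega> \<rho> by simp
    \<comment> \<open>Both sides carry the volume of the ball of radius \<open>\<rho>\<close>,
      which is finite and positive.\<close>
    have canc: "ennreal (1 / (\<omega> * \<rho> ^ d)) * (ennreal (\<omega> * \<rho> ^ d) * X) = X" for X
      using pos \<omega> \<rho> by (simp add: mult.assoc[symmetric] flip: ennreal_mult)
    show ?thesis using mult_left_mono[OF le, of "ennreal (1 / (\<omega> * \<rho> ^ d))"] unfolding canc m_def by simp
  qed
  show ?thesis unfolding uniformly_Lr_bounded_def
  proof (intro exI[of _ "C4 powr (1 / r')"] conjI ballI)
    show "C4 powr (1 / r') > 0" using C4 by simp
    fix z f assume z: "z \<in> \<Omega>" and "f \<in> V \<inter> Lp_space r"
    then have f: "f \<in> V" and fr: "Lp_norm r UNIV f < \<infinity>" by (auto simp: Lp_space_def)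
    have Lf: "Lp_norm r UNIV f = epowr (power_integral r' UNIV f) (1 / r')"
      using r by (simp add: Lp_norm_eq_power_integral r'_def)
    then have fin: "power_integral r' UNIV f < \<infinity>" using fr by (auto simp: epowr_def less_top split: if_splits)
    then obtain A where A: "power_integral r' UNIV f = ennreal A" "A \<ge> 0" by (cases "power_integral r' UNIV f") auto
    have "power_integral r' UNIV (T z f) \<le> ennreal (C4 * A)"
      using key[OF z f fin] A C4 by (simp add: ennreal_mult)
    also have "C4 * A = (C4 powr (1 / r') * A powr (1 / r')) powr r'"
      using C4 A r' by (simp add: powr_mult powr_powr)
    finally have "Lp_norm r UNIV (T z f) \<le> ennreal (C4 powr (1 / r') * A powr (1 / r'))"
      using r C4 by (subst Lp_norm_le_iff) (auto simp: r'_def)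
    then show "Lp_norm r UNIV (T z f) \<le> ennreal (C4 powr (1 / r')) * Lp_norm r UNIV f"
      unfolding Lf A(1) using A by (simp add: epowr_def ennreal_mult)
  qed
qed

section \<open>Riesz representation in the space of square integrable functions\<close>

text \<open>
  The Riesz-Fischer argument. Along a subsequence with squared distances at most \<open>4^(-k)\<close>, the function
  \<open>\<Sum>\<^sub>k 2^k \<bar>u\<^sub>k\<^sub>+\<^sub>1 - u\<^sub>k\<bar>\<^sup>2\<close> is integrable, hence finite almost everywhere, which makes the increments
  summable there. Fatou's lemma gives convergence in norm.
\<close>
lemma L2_complete:
  fixes u :: "nat \<Rightarrow> 'a \<Rightarrow> 'b::euclidean_space"
  assumes meas [measurable]: "\<And>n. u n \<in> borel_measurable M"
    and cauchy: "\<And>e. e > 0 \<Longrightarrow> \<exists>n0. \<forall>m\<ge>n0. \<forall>n\<ge>n0. (\<integral>\<^sup>+x. ennreal ((norm (u m x - u n x))\<^sup>2) \<partial>M) \<le> ennreal e"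
  obtains h where "h \<in> borel_measurable M"
    and "\<And>e. e > 0 \<Longrightarrow> \<exists>n0. \<forall>n\<ge>n0. (\<integral>\<^sup>+x. ennreal ((norm (h x - u n x))\<^sup>2) \<partial>M) \<le> ennreal e"
proof -
  have "\<exists>n0. \<forall>m\<ge>n0. \<forall>n\<ge>n0. (\<integral>\<^sup>+x. ennreal ((norm (u m x - u n x))\<^sup>2) \<partial>M) \<le> ennreal ((1/4) ^ k)" for k :: nat
    by (intro cauchy) auto
  then obtain s where s: "\<And>k m n. s k \<le> m \<Longrightarrow> s k \<le> n \<Longrightarrow> (\<integral>\<^sup>+x. ennreal ((norm (u m x - u n x))\<^sup>2) \<partial>M) \<le> ennreal ((1/4) ^ k)"
    by metis
  \<comment> \<open>The maximum makes \<open>\<phi> k\<close> large enough for every accuracy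
    \<open>4^(-j)\<close> with \<open>j \<le> k\<close>.\<close>
  define \<phi> where "\<phi> k = Max (s ` {..k})" for k
  have \<phi>: "s j \<le> \<phi> k" if "j \<le> k" for j k unfolding \<phi>_def using that by (intro Max_ge) auto
  define D where "D k x = (norm (u (\<phi> (Suc k)) x - u (\<phi> k) x))\<^sup>2" for k x
  have [measurable]: "D k \<in> borel_measurable M" for k unfolding D_def by measurable
  have D0: "D k x \<ge> 0" for k x by (simp add: D_def)
  have D: "(\<integral>\<^sup>+x. ennreal (D k x) \<partial>M) \<le> ennreal ((1/4) ^ k)" for k
    unfolding D_def by (intro s \<phi>) auto
  have "(\<integral>\<^sup>+x. (\<Sum>k. ennreal (2 ^ k * D k x)) \<partial>M) = (\<Sum>k. ennreal (2 ^ k) * (\<integral>\<^sup>+x. ennreal (D k x) \<partial>M))"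
    using D0 by (simp add: nn_integral_suminf ennreal_mult nn_integral_cmult)
  also have "\<dots> \<le> (\<Sum>k. ennreal ((1/2) ^ k))"
  proof (intro suminf_le)
    fix k
    have "ennreal (2 ^ k) * (\<integral>\<^sup>+x. ennreal (D k x) \<partial>M) \<le> ennreal (2 ^ k) * ennreal ((1/4) ^ k)"
      by (intro mult_left_mono D) auto
    also have "\<dots> = ennreal ((1/2) ^ k)" by (simp flip: ennreal_mult power_mult_distrib)
    finally show "ennreal (2 ^ k) * (\<integral>\<^sup>+x. ennreal (D k x) \<partial>M) \<le> ennreal ((1/2) ^ k)" .
  qed auto
  also have "(\<Sum>k. ennreal ((1/2) ^ k)) = ennreal 2"
    using geometric_sums[of "1/2::real"] by (intro suminf_ennreal_eq) auto
  finally have "(\<integral>\<^sup>+x. (\<Sum>k. ennreal (2 ^ k * D k x)) \<partial>M) \<noteq> \<infinity>" by (auto simp: top_unique)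
  then have fin: "AE x in M. (\<Sum>k. ennreal (2 ^ k * D k x)) \<noteq> \<infinity>" by (intro nn_integral_PInf_AE) auto
  have conv: "AE x in M. convergent (\<lambda>k. u (\<phi> k) x)"
    using fin
  proof eventually_elim
    case (elim x)
    have sm: "summable (\<lambda>k. 2 ^ k * D k x)" using elim D0 by (intro summable_suminf_not_top) auto
    have "summable (\<lambda>k. (1/2) ^ k + 2 ^ k * D k x)" using sm by (intro summable_add summable_geometric) auto
    then have "summable (\<lambda>k. norm (u (\<phi> (Suc k)) x - u (\<phi> k) x))"
    proof (rule summable_comparison_test'[where N = 0])
      fix k
      let ?d = "norm (u (\<phi> (Suc k)) x - u (\<phi> k) x)"
      have "0 \<le> ((1/2) ^ k - ?d)\<^sup>2" by simp
      then have "2 * ((1/2) ^ k * ?d) \<le> ((1/2) ^ k)\<^sup>2 + ?d\<^sup>2" by (simp add: power2_diff)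
      then have "2 ^ k * (2 * ((1/2) ^ k * ?d)) \<le> 2 ^ k * (((1/2) ^ k)\<^sup>2 + ?d\<^sup>2)" by (intro mult_left_mono) auto
      then have "2 * ?d \<le> (1/2) ^ k + 2 ^ k * D k x"
        by (simp add: D_def algebra_simps power2_eq_square power_one_over)
      then have "?d \<le> (1/2) ^ k + 2 ^ k * D k x" using norm_ge_zero[of "u (\<phi> (Suc k)) x - u (\<phi> k) x"] by linarith
      then show "norm ?d \<le> (1/2) ^ k + 2 ^ k * D k x" by simp
    qed
    then have "summable (\<lambda>k. u (\<phi> (Suc k)) x - u (\<phi> k) x)" by (rule summable_norm_cancel)
    then have "convergent (\<lambda>n. u (\<phi> n) x - u (\<phi> 0) x)"
      using sum_lessThan_telescope[of "\<lambda>i. u (\<phi> i) x"] by (simp add: summable_iff_convergent)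
    from convergent_add[OF this convergent_const[of "u (\<phi> 0) x"]] show ?case by simp
  qed
  define h where "h x = lim (\<lambda>k. u (\<phi> k) x)" for x
  have [measurable]: "h \<in> borel_measurable M" unfolding h_def by measurable
  show thesis
  proof (rule that)
    show "h \<in> borel_measurable M" by fact
    show "\<exists>n0. \<forall>n\<ge>n0. (\<integral>\<^sup>+x. ennreal ((norm (h x - u n x))\<^sup>2) \<partial>M) \<le> ennreal e" if "e > 0" for e
  proof -
    obtain j where j: "(1/4::real) ^ j < e" using \<open>e > 0\<close> real_arch_pow_inv[of e "1/4"] by auto
    have "(\<integral>\<^sup>+x. ennreal ((norm (h x - u n x))\<^sup>2) \<partial>M) \<le> ennreal e" if n: "n \<ge> s j" for n
    proof -
      have "(\<integral>\<^sup>+x. ennreal ((norm (h x - u n x))\<^sup>2) \<partial>M) = (\<integral>\<^sup>+x. liminf (\<lambda>k. ennreal ((norm (u (\<phi> k) x - u n x))\<^sup>2)) \<partial>M)"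
      proof (intro nn_integral_cong_AE, use conv in eventually_elim)
        fix x assume "convergent (\<lambda>k. u (\<phi> k) x)"
        then have "(\<lambda>k. u (\<phi> k) x) \<longlonglongrightarrow> h x" by (simp add: h_def convergent_LIMSEQ_iff)
        then have "(\<lambda>k. ennreal ((norm (u (\<phi> k) x - u n x))\<^sup>2)) \<longlonglongrightarrow> ennreal ((norm (h x - u n x))\<^sup>2)"
          by (intro tendsto_intros)
        then show "ennreal ((norm (h x - u n x))\<^sup>2) = liminf (\<lambda>k. ennreal ((norm (u (\<phi> k) x - u n x))\<^sup>2))"
          by (rule lim_imp_Liminf[OF sequentially_bot, symmetric])
      qed
      also have "\<dots> \<le> liminf (\<lambda>k. \<integral>\<^sup>+x. ennreal ((norm (u (\<phi> k) x - u n x))\<^sup>2) \<partial>M)"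
        by (intro nn_integral_liminf) measurable
      also have "\<dots> \<le> liminf (\<lambda>k. ennreal e)"
      proof (intro Liminf_mono eventually_sequentiallyI[of j])
        fix k assume "k \<ge> j"
        then have "(\<integral>\<^sup>+x. ennreal ((norm (u (\<phi> k) x - u n x))\<^sup>2) \<partial>M) \<le> ennreal ((1/4) ^ j)"
          by (intro s n \<phi>) auto
        also have "\<dots> \<le> ennreal e" using j by (intro ennreal_leI) auto
        finally show "(\<integral>\<^sup>+x. ennreal ((norm (u (\<phi> k) x - u n x))\<^sup>2) \<partial>M) \<le> ennreal e" .
      qed
      finally show ?thesis by (simp add: Liminf_const)
    qed
    then show ?thesis by auto
  qed
  qed
qed

definition square_integrable :: "'a measure \<Rightarrow> ('a \<Rightarrow> 'b::euclidean_space) \<Rightarrow> bool" where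
  "square_integrable M u \<longleftrightarrow> u \<in> borel_measurable M \<and> integrable M (\<lambda>x. (norm (u x))\<^sup>2)"

lemma square_integrable_inner:
  assumes "square_integrable M u" "square_integrable M v"
  shows "integrable M (\<lambda>x. u x \<bullet> v x)"
proof (rule Bochner_Integration.integrable_bound)
  have [measurable]: "u \<in> borel_measurable M" "v \<in> borel_measurable M"
    using assms by (auto simp: square_integrable_def)
  show "integrable M (\<lambda>x. (norm (u x))\<^sup>2 + (norm (v x))\<^sup>2)"
    using assms by (auto simp: square_integrable_def)
  show "(\<lambda>x. u x \<bullet> v x) \<in> borel_measurable M"
    by measurable
  show "AE x in M. norm (u x \<bullet> v x) \<le> norm ((norm (u x))\<^sup>2 + (norm (v x))\<^sup>2)"
  proof (intro AE_I2)
    fix x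
    have "\<bar>u x \<bullet> v x\<bar> \<le> norm (u x) * norm (v x)" by (rule Cauchy_Schwarz_ineq2)
    also have "\<dots> \<le> (norm (u x))\<^sup>2 + (norm (v x))\<^sup>2"
      using sum_squares_bound[of "norm (u x)" "norm (v x)"] mult_nonneg_nonneg[OF norm_ge_zero norm_ge_zero, of "u x" "v x"]
      by linarith
    finally show "norm (u x \<bullet> v x) \<le> norm ((norm (u x))\<^sup>2 + (norm (v x))\<^sup>2)" by simp
  qed
qed

lemma square_integrable_add_scaleR:
  assumes "square_integrable M u" "square_integrable M v"
  shows "square_integrable M (\<lambda>x. u x + c *\<^sub>R v x)"
    and "(LINT x|M. (norm (u x + c *\<^sub>R v x))\<^sup>2) =
      (LINT x|M. (norm (u x))\<^sup>2) + 2 * c * (LINT x|M. u x \<bullet> v x) + c\<^sup>2 * (LINT x|M. (norm (v x))\<^sup>2)"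
proof -
  have eq: "(norm (u x + c *\<^sub>R v x))\<^sup>2 = (norm (u x))\<^sup>2 + 2 * c * (u x \<bullet> v x) + c\<^sup>2 * (norm (v x))\<^sup>2" for x
    unfolding power2_norm_eq_inner
    by (simp add: inner_add_left inner_add_right inner_commute algebra_simps power2_eq_square)
  have i: "integrable M (\<lambda>x. (norm (u x))\<^sup>2)" "integrable M (\<lambda>x. (norm (v x))\<^sup>2)" "integrable M (\<lambda>x. u x \<bullet> v x)"
    using assms square_integrable_inner by (auto simp: square_integrable_def)
  show "square_integrable M (\<lambda>x. u x + c *\<^sub>R v x)"
    unfolding square_integrable_def eq
  proof
    have [measurable]: "u \<in> borel_measurable M" "v \<in> borel_measurable M"
      using assms by (auto simp: square_integrable_def)
    show "(\<lambda>x. u x + c *\<^sub>R v x) \<in> borel_measurable M" by measurable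
  qed (use i in auto)
  show "(LINT x|M. (norm (u x + c *\<^sub>R v x))\<^sup>2) =
      (LINT x|M. (norm (u x))\<^sup>2) + 2 * c * (LINT x|M. u x \<bullet> v x) + c\<^sup>2 * (LINT x|M. (norm (v x))\<^sup>2)"
    unfolding eq using i by simp
qed

text \<open>
  Used twice: for the Cauchy-Schwarz inequality, and with \<open>A = 0\<close> to conclude that a first variation
  vanishes.
\<close>
lemma nonneg_quadratic_imp_discriminant:
  fixes A B C :: real
  assumes "\<And>t. 0 \<le> A + 2 * t * B + t\<^sup>2 * C"
  shows "B\<^sup>2 \<le> A * C"
proof (cases "C = 0")
  case True
  have "B = 0"
  proof (rule ccontr)
    assume "B \<noteq> 0"
    then show False using assms[of "- (A + 1) / (2 * B)"] True by (simp add: field_simps)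
  qed
  then show ?thesis using True by simp
next
  case False
  have "0 \<le> C"
  proof (rule ccontr)
    assume "\<not> 0 \<le> C"
    then have "C < 0" by simp
    define t where "t = 1 + (\<bar>A\<bar> + 2 * \<bar>B\<bar>) / (- C)"
    have t1: "t \<ge> 1" using \<open>C < 0\<close> by (auto simp: t_def intro!: divide_nonneg_pos divide_nonneg_neg)
    have "t * C = C - (\<bar>A\<bar> + 2 * \<bar>B\<bar>)" using \<open>C < 0\<close> by (simp add: t_def field_simps)
    then have "t\<^sup>2 * C = t * (C - (\<bar>A\<bar> + 2 * \<bar>B\<bar>))" by (simp add: power2_eq_square)
    moreover have "A \<le> t * \<bar>A\<bar>" using t1 mult_right_mono[of 1 t "\<bar>A\<bar>"] by linarith
    moreover have "t * B \<le> t * \<bar>B\<bar>" using t1 by (intro mult_left_mono) auto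
    moreover have "t * C < 0" using t1 \<open>C < 0\<close> by (intro mult_pos_neg) auto
    moreover have "0 \<le> A + 2 * (t * B) + t\<^sup>2 * C" using assms[of t] by (simp add: mult.assoc)
    moreover have "t * (C - (\<bar>A\<bar> + 2 * \<bar>B\<bar>)) = t * C - t * \<bar>A\<bar> - 2 * (t * \<bar>B\<bar>)" by (simp add: algebra_simps)
    ultimately show False by linarith
  qed
  then have "0 < C" using False by simp
  then show ?thesis using assms[of "- B / C"] by (simp add: field_simps power2_eq_square)
qed

lemma Cauchy_Schwarz_integral:
  assumes "square_integrable M u" "square_integrable M v"
  shows "\<bar>LINT x|M. u x \<bullet> v x\<bar> \<le> sqrt (LINT x|M. (norm (u x))\<^sup>2) * sqrt (LINT x|M. (norm (v x))\<^sup>2)"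
proof -
  have "(LINT x|M. u x \<bullet> v x)\<^sup>2 \<le> (LINT x|M. (norm (u x))\<^sup>2) * (LINT x|M. (norm (v x))\<^sup>2)"
  proof (rule nonneg_quadratic_imp_discriminant)
    fix t
    show "0 \<le> (LINT x|M. (norm (u x))\<^sup>2) + 2 * t * (LINT x|M. u x \<bullet> v x) + t\<^sup>2 * (LINT x|M. (norm (v x))\<^sup>2)"
      unfolding square_integrable_add_scaleR(2)[OF assms, symmetric] by (rule integral_nonneg_AE) simp
  qed
  from real_sqrt_le_mono[OF this] show ?thesis by (simp add: real_sqrt_mult)
qed

text \<open>
  The functional is given by its graph \<open>G\<close>, a linear space of pairs \<open>(u, a)\<close>. This suits functionals of
  a gradient restricted to a set, for which it is not evident beforehand that the value depends on \<open>u\<close>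
  alone. The representing function is the limit of a sequence minimising \<open>\<parallel>u\<parallel>\<^sup>2/2 - a\<close> over \<open>G\<close>.
\<close>
lemma Riesz_representation_L2:
  fixes G :: "(('a \<Rightarrow> 'b::euclidean_space) \<times> real) set"
  assumes sq: "\<And>u a. (u, a) \<in> G \<Longrightarrow> square_integrable M u"
    and zero: "((\<lambda>x. 0), 0) \<in> G"
    and comb: "\<And>u a v b c. (u, a) \<in> G \<Longrightarrow> (v, b) \<in> G \<Longrightarrow> ((\<lambda>x. u x + c *\<^sub>R v x), a + c * b) \<in> G"
    and bound: "\<And>u a. (u, a) \<in> G \<Longrightarrow> \<bar>a\<bar> \<le> K * sqrt (LINT x|M. (norm (u x))\<^sup>2)" and K: "0 \<le> K"
  obtains h where "square_integrable M h" "(LINT x|M. (norm (h x))\<^sup>2) \<le> K\<^sup>2"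
    and "\<And>u a. (u, a) \<in> G \<Longrightarrow> (LINT x|M. h x \<bullet> u x) = a"
proof -
  define Q where "Q u = (LINT x|M. (norm (u x))\<^sup>2)" for u :: "'a \<Rightarrow> 'b"
  define ip where "ip u v = (LINT x|M. u x \<bullet> v x)" for u v :: "'a \<Rightarrow> 'b"
  define J where "J p = Q (fst p) / 2 - snd p" for p :: "('a \<Rightarrow> 'b) \<times> real"
  have Q0: "Q u \<ge> 0" for u unfolding Q_def by (rule integral_nonneg_AE) simp
  note sqc = square_integrable_add_scaleR(1)
  have Qc: "Q (\<lambda>x. u x + c *\<^sub>R v x) = Q u + 2 * c * ip u v + c\<^sup>2 * Q v"
    if "square_integrable M u" "square_integrable M v" for u v c
    unfolding Q_def ip_def using square_integrable_add_scaleR(2)[OF that] .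
  have CS: "\<bar>ip u v\<bar> \<le> sqrt (Q u) * sqrt (Q v)"
    if "square_integrable M u" "square_integrable M v" for u v
    unfolding Q_def ip_def using Cauchy_Schwarz_integral[OF that] .
  have ip_add: "ip (\<lambda>x. u x + c *\<^sub>R v x) w = ip u w + c * ip v w"
    if "square_integrable M u" "square_integrable M v" "square_integrable M w" for u v w c
    unfolding ip_def using that by (simp add: inner_add square_integrable_inner)
  have lower: "- (K\<^sup>2 / 2) \<le> J p" if "p \<in> G" for p
  proof -
    obtain u a where p: "p = (u, a)" by (cases p)
    have "a \<le> K * sqrt (Q u)" using bound[of u a] that p unfolding Q_def by auto
    moreover have "0 \<le> (sqrt (Q u) - K)\<^sup>2" by simp
    ultimately show ?thesis using Q0[of u] by (simp add: J_def p power2_diff) (simp add: algebra_simps)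
  qed
  define j where "j = Inf (J ` G)"
  have bdd: "bdd_below (J ` G)" using lower by (intro bdd_belowI2)
  have j: "j \<le> J p" if "p \<in> G" for p unfolding j_def using that bdd by (intro cInf_lower) auto
  have "\<exists>p\<in>G. J p < j + 1 / real (Suc n)" for n
    using cInf_lessD[of "J ` G" "j + 1 / real (Suc n)"] zero unfolding j_def by force
  then obtain P where P: "\<And>n. P n \<in> G" "\<And>n. J (P n) < j + 1 / real (Suc n)" by metis
  define u a where "u n = fst (P n)" and "a n = snd (P n)" for n
  have G: "(u n, a n) \<in> G" for n using P by (simp add: u_def a_def)
  have Ju: "Q (u n) / 2 - a n < j + 1 / real (Suc n)" for n using P(2)[of n] by (simp add: J_def u_def a_def)
  have su: "square_integrable M (u n)" for n using sq[OF G] .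
  \<comment> \<open>By the parallelogram law, as the midpoint of two members of \<open>G\<close>
    has energy at least \<open>j\<close>.\<close>
  have close: "Q (\<lambda>x. u m x - u n x) \<le> 4 * (1 / real (Suc m) + 1 / real (Suc n))" for m n
  proof -
    \<comment> \<open>Scaling is the instance of \<open>comb\<close> that starts at zero.\<close>
    have half: "((\<lambda>x. (1/2) *\<^sub>R u m x), a m / 2) \<in> G" using comb[OF zero G, of "1/2" m] by simp
    have "((\<lambda>x. (1/2) *\<^sub>R u m x + (1/2) *\<^sub>R u n x), a m / 2 + a n / 2) \<in> G" using comb[OF half G, of "1/2" n] by simp
    from j[OF this] have "j \<le> Q (\<lambda>x. (1/2) *\<^sub>R u m x + (1/2) *\<^sub>R u n x) / 2 - (a m + a n) / 2"
      by (simp add: J_def add_divide_distrib)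
    also have "Q (\<lambda>x. (1/2) *\<^sub>R u m x + (1/2) *\<^sub>R u n x) = Q (\<lambda>x. u m x + 1 *\<^sub>R u n x) / 4"
    proof -
      have "Q (\<lambda>x. (1/2) *\<^sub>R (u m x + u n x)) = (1/4) * Q (\<lambda>x. u m x + u n x)"
        unfolding Q_def by (simp add: power_divide)
      then show ?thesis by (simp add: scaleR_right_distrib)
    qed
    finally have "8 * j \<le> Q (\<lambda>x. u m x + 1 *\<^sub>R u n x) - 4 * (a m + a n)" by linarith
    moreover have "Q (\<lambda>x. u m x + (-1) *\<^sub>R u n x) = 2 * Q (u m) + 2 * Q (u n) - Q (\<lambda>x. u m x + 1 *\<^sub>R u n x)"
      by (simp only: Qc[OF su su]) simp
    ultimately show ?thesis using Ju[of m] Ju[of n] by simp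
  qed
  have nn: "(\<integral>\<^sup>+x. ennreal ((norm (v x))\<^sup>2) \<partial>M) = ennreal (Q v)" if "square_integrable M v" for v
    unfolding Q_def using that by (intro nn_integral_eq_integral) (auto simp: square_integrable_def)
  have sud: "square_integrable M (\<lambda>x. u m x - u n x)" for m n using sqc[OF su su, of m "-1" n] by simp
  obtain h where hm: "h \<in> borel_measurable M"
    and hl: "\<And>e. e > 0 \<Longrightarrow> \<exists>n0. \<forall>n\<ge>n0. (\<integral>\<^sup>+x. ennreal ((norm (h x - u n x))\<^sup>2) \<partial>M) \<le> ennreal e"
  proof (rule L2_complete)
    show "u n \<in> borel_measurable M" for n using su by (auto simp: square_integrable_def)
    fix e :: real assume "e > 0"
    then obtain n0 where n0: "1 / real (Suc n0) < e / 8" using reals_Archimedean[of "e/8"] by (auto simp: inverse_eq_divide)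
    have "(\<integral>\<^sup>+x. ennreal ((norm (u m x - u n x))\<^sup>2) \<partial>M) \<le> ennreal e" if "m \<ge> n0" "n \<ge> n0" for m n
    proof -
      have "1 / real (Suc m) \<le> 1 / real (Suc n0)" "1 / real (Suc n) \<le> 1 / real (Suc n0)"
        using that by (auto intro!: divide_left_mono)
      then have "4 * (1 / real (Suc m) + 1 / real (Suc n)) \<le> 4 * (e / 8 + e / 8)"
        using n0 by (intro mult_left_mono add_mono) auto
      then have "Q (\<lambda>x. u m x - u n x) \<le> e" using close[of m n] by simp
      then show ?thesis unfolding nn[OF sud] by (rule ennreal_leI)
    qed
    then show "\<exists>n0. \<forall>m\<ge>n0. \<forall>n\<ge>n0. (\<integral>\<^sup>+x. ennreal ((norm (u m x - u n x))\<^sup>2) \<partial>M) \<le> ennreal e" by blast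
  qed blast
  have sh: "square_integrable M h"
  proof -
    note [measurable] = hm
    have meas_u [measurable]: "u n \<in> borel_measurable M" for n using su by (auto simp: square_integrable_def)
    obtain n where n: "(\<integral>\<^sup>+x. ennreal ((norm (h x - u n x))\<^sup>2) \<partial>M) \<le> ennreal 1" using hl[of 1] by auto
    have "integrable M (\<lambda>x. (norm (h x - u n x))\<^sup>2)"
    proof (rule integrableI_bounded)
      show "(\<lambda>x. (norm (h x - u n x))\<^sup>2) \<in> borel_measurable M"
        using meas_u by measurable
      show "(\<integral>\<^sup>+x. ennreal (norm ((norm (h x - u n x))\<^sup>2)) \<partial>M) < \<infinity>"
        using n by (simp add: order_le_less_trans)
    qed
    then have "square_integrable M (\<lambda>x. h x - u n x)"
      using meas_u unfolding square_integrable_def by simp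
    from sqc[OF this su, of 1 n] show ?thesis by simp
  qed
  have shu: "square_integrable M (\<lambda>x. h x - u n x)" for n using sqc[OF sh su, of "-1" n] by simp
  have lim: "(\<lambda>n. Q (\<lambda>x. h x - u n x)) \<longlonglongrightarrow> 0"
  proof (rule LIMSEQ_I)
    fix e :: real assume "e > 0"
    then obtain n0 where "\<And>n. n \<ge> n0 \<Longrightarrow> ennreal (Q (\<lambda>x. h x - u n x)) \<le> ennreal (e/2)"
      using hl[of "e/2"] unfolding nn[OF shu] by auto
    then have "Q (\<lambda>x. h x - u n x) \<le> e/2" if "n \<ge> n0" for n using that \<open>e > 0\<close> by (simp add: ennreal_le_iff)
    then show "\<exists>no. \<forall>n\<ge>no. norm (Q (\<lambda>x. h x - u n x) - 0) < e" using Q0 \<open>e > 0\<close> by (force intro!: exI[of _ n0])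
  qed
  have limip: "(\<lambda>n. ip (u n) v) \<longlonglongrightarrow> ip h v" if v: "square_integrable M v" for v
  proof -
    have "(\<lambda>n. sqrt (Q (\<lambda>x. h x - u n x)) * sqrt (Q v)) \<longlonglongrightarrow> sqrt 0 * sqrt (Q v)"
      by (intro tendsto_intros lim)
    then have "(\<lambda>n. sqrt (Q (\<lambda>x. h x - u n x)) * sqrt (Q v)) \<longlonglongrightarrow> 0" by simp
    moreover have "\<forall>\<^sub>F n in sequentially. norm (ip (\<lambda>x. h x - u n x) v) \<le> sqrt (Q (\<lambda>x. h x - u n x)) * sqrt (Q v)"
      using CS[OF shu v] by (intro always_eventually allI) simp
    ultimately have "(\<lambda>n. ip (\<lambda>x. h x - u n x) v) \<longlonglongrightarrow> 0" by (rule Lim_null_comparison[rotated])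
    moreover have "ip (\<lambda>x. h x - u n x) v = ip h v - ip (u n) v" for n
      using ip_add[OF sh su v, of "-1" n] by simp
    ultimately have "(\<lambda>n. ip h v - ip (u n) v) \<longlonglongrightarrow> 0" by simp
    from tendsto_diff[OF tendsto_const[of "ip h v"] this] show ?thesis by simp
  qed
  \<comment> \<open>The first variation: the energy cannot drop below \<open>j\<close> along the
    line through the minimising sequence in the direction \<open>(v, b)\<close>.\<close>
  have rep: "ip h v = b" if vb: "(v, b) \<in> G" for v b
  proof -
    have v: "square_integrable M v" using sq[OF vb] .
    have "0 \<le> 0 + 2 * t * (ip h v - b) + t\<^sup>2 * Q v" for t
    proof -
      have "- (2 / real (Suc n)) \<le> 2 * t * (ip (u n) v - b) + t\<^sup>2 * Q v" for n
      proof -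
        have "j \<le> Q (\<lambda>x. u n x + t *\<^sub>R v x) / 2 - (a n + t * b)" using j[OF comb[OF G vb, of n t]] by (simp add: J_def)
        then show ?thesis using Ju[of n] unfolding Qc[OF su v] by (simp add: algebra_simps)
      qed
      moreover have "(\<lambda>n. - (2 / real (Suc n))) \<longlonglongrightarrow> - 0"
        by (intro tendsto_minus LIMSEQ_Suc[OF lim_const_over_n])
      moreover have "(\<lambda>n. 2 * t * (ip (u n) v - b) + t\<^sup>2 * Q v) \<longlonglongrightarrow> 2 * t * (ip h v - b) + t\<^sup>2 * Q v"
        by (intro tendsto_intros limip v)
      ultimately have "- 0 \<le> 2 * t * (ip h v - b) + t\<^sup>2 * Q v" by (intro LIMSEQ_le) auto
      then show ?thesis by simp
    qed
    then have "(ip h v - b)\<^sup>2 \<le> 0 * Q v" by (rule nonneg_quadratic_imp_discriminant)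
    then show ?thesis by simp
  qed
  have "Q h \<le> K\<^sup>2"
  proof -
    have 1: "(\<lambda>n. ip (u n) h) \<longlonglongrightarrow> Q h" using limip[OF sh] by (simp add: Q_def ip_def power2_norm_eq_inner)
    have sym: "ip (u n) h = ip h (u n)" for n by (simp add: ip_def inner_commute)
    have "Q (\<lambda>x. h x - u n x) = Q h - 2 * ip (u n) h + Q (u n)" for n
      using Qc[OF sh su, of "-1" n] by (simp add: sym)
    then have "Q (u n) = Q (\<lambda>x. h x - u n x) + 2 * ip (u n) h - Q h" for n by simp
    moreover have "(\<lambda>n. Q (\<lambda>x. h x - u n x) + 2 * ip (u n) h - Q h) \<longlonglongrightarrow> 0 + 2 * Q h - Q h"
      by (intro tendsto_intros lim 1)
    ultimately have "(\<lambda>n. Q (u n)) \<longlonglongrightarrow> Q h" by simp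
    then have "(\<lambda>n. K * sqrt (Q (u n))) \<longlonglongrightarrow> K * sqrt (Q h)" by (intro tendsto_intros)
    moreover have "ip (u n) h \<le> K * sqrt (Q (u n))" for n
      using bound[OF G, of n] rep[OF G, of n] unfolding sym Q_def by auto
    ultimately have "Q h \<le> K * sqrt (Q h)" using 1 by (intro LIMSEQ_le[OF 1]) auto
    then have "sqrt (Q h) * sqrt (Q h) \<le> K * sqrt (Q h)" using Q0 by simp
    then have "sqrt (Q h) \<le> K"
      using K Q0[of h] mult_right_le_imp_le[of "sqrt (Q h)" "sqrt (Q h)" K] by (cases "Q h = 0") auto
    then have "(sqrt (Q h))\<^sup>2 \<le> K\<^sup>2" using Q0[of h] by (intro power_mono) auto
    then show ?thesis using Q0[of h] by simp
  qed
  then show thesis using that sh rep unfolding Q_def ip_def by blast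
qed

section \<open>Poincare inequalities\<close>

text \<open>
  The gradient enters through any derivative \<open>D\<close> and any continuous bound \<open>G\<close> of its operator norm; in
  this form the inequality is free of coordinates and transforms well under dilations. The constant
  \<open>c\<close> is not fixed to be the mean value, which makes unions easy to treat.
\<close>
definition poincare :: "'a::euclidean_space set \<Rightarrow> real \<Rightarrow> bool" where
  "poincare S K \<longleftrightarrow> (\<forall>(\<psi> :: 'a \<Rightarrow> complex) D G. (\<forall>x. (\<psi> has_derivative D x) (at x)) \<longrightarrow> continuous_on UNIV G \<longrightarrow>
     (\<forall>x v. norm (D x v) \<le> G x * norm v) \<longrightarrow>
     (\<exists>c. (\<integral>\<^sup>+x\<in>S. ennreal ((norm (\<psi> x - c))\<^sup>2) \<partial>lborel) \<le> ennreal K * (\<integral>\<^sup>+x\<in>S. ennreal ((G x)\<^sup>2) \<partial>lborel)))"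

text \<open>
  The fundamental theorem of calculus along the segment, and then Cauchy-Schwarz on \<open>[0, 1]\<close> in the
  form that the variance of \<open>u\<close> is nonnegative.
\<close>
lemma increment_le_segment_integral:
  fixes \<psi> :: "'a::euclidean_space \<Rightarrow> complex"
  assumes der: "\<And>x. (\<psi> has_derivative D x) (at x)" and G: "continuous_on UNIV G"
    and DG: "\<And>x v. norm (D x v) \<le> G x * norm v"
  shows "ennreal ((norm (\<psi> y - \<psi> x))\<^sup>2) \<le> ennreal ((norm (y - x))\<^sup>2) * (\<integral>\<^sup>+t\<in>{0..1}. ennreal ((G (x + t *\<^sub>R (y - x)))\<^sup>2) \<partial>lborel)"
proof -
  define u where "u t = G (x + t *\<^sub>R (y - x))" for t
  have cu: "continuous_on {0..1} u" unfolding u_def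
    by (intro continuous_on_compose2[OF G] continuous_intros) auto
  have "((\<lambda>t. D (x + t *\<^sub>R (y - x)) (y - x)) has_integral \<psi> (x + 1 *\<^sub>R (y - x)) - \<psi> (x + 0 *\<^sub>R (y - x))) {0..1}"
  proof (rule fundamental_theorem_of_calculus)
    fix t :: real assume "t \<in> {0..1}"
    have "((\<lambda>t. \<psi> (x + t *\<^sub>R (y - x))) has_derivative (\<lambda>s. D (x + t *\<^sub>R (y - x)) (s *\<^sub>R (y - x)))) (at t within {0..1})"
      by (rule has_derivative_compose[OF _ der]) (auto intro!: derivative_eq_intros)
    moreover have "D (x + t *\<^sub>R (y - x)) (s *\<^sub>R (y - x)) = s *\<^sub>R D (x + t *\<^sub>R (y - x)) (y - x)" for s
      using has_derivative_bounded_linear[OF der] by (simp add: linear_simps)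
    ultimately show "((\<lambda>t. \<psi> (x + t *\<^sub>R (y - x))) has_vector_derivative D (x + t *\<^sub>R (y - x)) (y - x)) (at t within {0..1})"
      by (simp add: has_vector_derivative_def)
  qed simp
  then have I: "((\<lambda>t. D (x + t *\<^sub>R (y - x)) (y - x)) has_integral \<psi> y - \<psi> x) {0..1}" by simp
  have iu: "u integrable_on {0..1}" "(\<lambda>t. (u t)\<^sup>2) integrable_on {0..1}"
    using cu by (auto intro!: integrable_continuous_real continuous_intros)
  define m where "m = integral {0..1} u"
  have "norm (integral {0..1} (\<lambda>t. D (x + t *\<^sub>R (y - x)) (y - x))) \<le> integral {0..1} (\<lambda>t. u t * norm (y - x))"
    using I integrable_on_mult_left[OF iu(1), of "norm (y - x)"]
    by (intro integral_norm_bound_integral) (auto simp: DG u_def)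
  then have n: "norm (\<psi> y - \<psi> x) \<le> m * norm (y - x)"
    using I by (simp add: m_def integral_unique)
  have "0 \<le> integral {0..1} (\<lambda>t. (u t - m)\<^sup>2)"
    by (intro integral_nonneg integrable_continuous_real continuous_intros cu) auto
  also have "((\<lambda>t. (u t)\<^sup>2 - 2 * m * u t + m\<^sup>2) has_integral (integral {0..1} (\<lambda>t. (u t)\<^sup>2) - 2 * m * m + m\<^sup>2 * (1 - 0))) {0..1}"
    using iu unfolding m_def
    by (intro has_integral_add has_integral_diff has_integral_mult_right integrable_integral) 
       (use has_integral_const_real[of "(integral {0..1} u)\<^sup>2" 0 1] in auto)
  then have "integral {0..1} (\<lambda>t. (u t - m)\<^sup>2) = integral {0..1} (\<lambda>t. (u t)\<^sup>2) - m\<^sup>2"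
    by (simp add: power2_diff integral_unique power2_eq_square algebra_simps)
  finally have m2: "m\<^sup>2 \<le> integral {0..1} (\<lambda>t. (u t)\<^sup>2)" by simp
  have "(norm (\<psi> y - \<psi> x))\<^sup>2 \<le> (m * norm (y - x))\<^sup>2" using n by (intro power_mono) auto
  also have "\<dots> \<le> (norm (y - x))\<^sup>2 * integral {0..1} (\<lambda>t. (u t)\<^sup>2)"
    using mult_left_mono[OF m2, of "(norm (y - x))\<^sup>2"] by (simp add: power_mult_distrib mult.commute)
  finally have "ennreal ((norm (\<psi> y - \<psi> x))\<^sup>2) \<le> ennreal ((norm (y - x))\<^sup>2) * ennreal (integral {0..1} (\<lambda>t. (u t)\<^sup>2))"
    using iu by (subst ennreal_mult[symmetric]) (auto intro!: ennreal_leI integral_nonneg)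
  also have "ennreal (integral {0..1} (\<lambda>t. (u t)\<^sup>2)) = (\<integral>\<^sup>+t\<in>{0..1}. ennreal ((u t)\<^sup>2) \<partial>lborel)"
    using nn_integral_has_integral_lebesgue[OF _ integrable_integral[OF iu(2)]]
    by (simp add: ennreal_mult ennreal_indicator mult.commute)
  finally show ?thesis by (simp add: u_def)
qed

lemma nn_integral_lborel_affine:
  fixes f :: "'a::euclidean_space \<Rightarrow> ennreal"
  assumes [measurable]: "f \<in> borel_measurable borel" and "c \<noteq> 0"
  shows "(\<integral>\<^sup>+x. f x \<partial>lborel) = ennreal (\<bar>c\<bar> ^ DIM('a)) * (\<integral>\<^sup>+x. f (t + c *\<^sub>R x) \<partial>lborel)"
proof -
  have "(\<integral>\<^sup>+x. f x \<partial>lborel) = (\<integral>\<^sup>+x. f x \<partial>density (distr lborel borel (\<lambda>x. t + c *\<^sub>R x)) (\<lambda>_. ennreal (\<bar>c\<bar> ^ DIM('a))))"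
    using lborel_affine[OF \<open>c \<noteq> 0\<close>, of t] by simp
  also have "\<dots> = ennreal (\<bar>c\<bar> ^ DIM('a)) * (\<integral>\<^sup>+x. f (t + c *\<^sub>R x) \<partial>lborel)"
    by (subst nn_integral_density) (auto simp: nn_integral_distr nn_integral_cmult)
  finally show ?thesis .
qed

text \<open>
  The map \<open>y \<mapsto> (1-t) x + t y\<close> sends the convex set \<open>S\<close> into itself and has Jacobian
  \<open>t^d \<ge> 2^(-d)\<close>.
\<close>
lemma contraction_integral_le:
  fixes H :: "'a::euclidean_space \<Rightarrow> ennreal"
  assumes S: "convex S" and [measurable]: "S \<in> sets borel" "H \<in> borel_measurable borel"
    and x: "x \<in> S" and t: "1/2 \<le> t" "t \<le> 1"
  shows "(\<integral>\<^sup>+y\<in>S. H ((1 - t) *\<^sub>R x + t *\<^sub>R y) \<partial>lborel) \<le> ennreal (2 ^ DIM('a)) * (\<integral>\<^sup>+y\<in>S. H y \<partial>lborel)"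
proof -
  let ?t = "(1 - t) *\<^sub>R x"
  have "(\<integral>\<^sup>+y\<in>S. H (?t + t *\<^sub>R y) \<partial>lborel) \<le> (\<integral>\<^sup>+y. H (?t + t *\<^sub>R y) * indicator S (?t + t *\<^sub>R y) \<partial>lborel)"
    using t x by (intro nn_integral_mono) (auto simp: indicator_def intro!: convexD[OF S])
  also have "\<dots> \<le> ennreal (2 ^ DIM('a)) * (ennreal (t ^ DIM('a)) * \<dots>)"
  proof -
    have "1 \<le> 2 ^ DIM('a) * t ^ DIM('a)" unfolding power_mult_distrib[symmetric] using t by (intro one_le_power) auto
    then have "1 \<le> ennreal (2 ^ DIM('a)) * ennreal (t ^ DIM('a))"
      using t by (simp flip: ennreal_mult ennreal_1 add: ennreal_leI)
    from mult_right_mono[OF this] show ?thesis by (simp add: mult.assoc)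
  qed
  also have "ennreal (t ^ DIM('a)) * (\<integral>\<^sup>+y. H (?t + t *\<^sub>R y) * indicator S (?t + t *\<^sub>R y) \<partial>lborel) = (\<integral>\<^sup>+y\<in>S. H y \<partial>lborel)"
    using nn_integral_lborel_affine[of "\<lambda>y. H y * indicator S y" t ?t] t by simp
  finally show ?thesis .
qed

text \<open>
  Integrate the increments over \<open>S \<times> S\<close>. At time \<open>t\<close> on the segment use the contraction in \<open>y\<close> if
  \<open>t \<ge> 1/2\<close> and in \<open>x\<close> otherwise, so that no Jacobian degenerates. Some \<open>y\<close> does no worse than the
  average over \<open>S\<close>, and \<open>c = \<psi> y\<close> is admissible.
\<close>
lemma poincare_convex:
  fixes S :: "'a::euclidean_space set"
  assumes S: "convex S" and [measurable]: "S \<in> sets borel" and \<Delta>: "\<And>x y. x \<in> S \<Longrightarrow> y \<in> S \<Longrightarrow> norm (y - x) \<le> \<Delta>"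
    and pos: "emeasure lborel S \<noteq> 0" and fin: "emeasure lborel S \<noteq> \<infinity>"
  shows "poincare S (\<Delta>\<^sup>2 * 2 ^ DIM('a))"
  unfolding poincare_def
proof (intro allI impI)
  fix \<psi> :: "'a \<Rightarrow> complex" and D and G :: "'a \<Rightarrow> real"
  assume der: "\<forall>x. (\<psi> has_derivative D x) (at x)" and G: "continuous_on UNIV G"
    and DG: "\<forall>x v. norm (D x v) \<le> G x * norm v"
  have [measurable]: "\<psi> \<in> borel_measurable borel"
    using der by (intro borel_measurable_continuous_onI) (auto intro!: continuous_at_imp_continuous_on has_derivative_continuous)
  have [measurable]: "G \<in> borel_measurable borel" using G by (rule borel_measurable_continuous_onI)
  define H where "H x = ennreal ((G x)\<^sup>2)" for x
  have [measurable]: "H \<in> borel_measurable borel" unfolding H_def by measurable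
  let ?I = "\<lambda>t. (\<integral>\<^sup>+x\<in>S. (\<integral>\<^sup>+y\<in>S. H (x + t *\<^sub>R (y - x)) \<partial>lborel) \<partial>lborel)"
  let ?w = "\<lambda>x y t. ennreal (\<Delta>\<^sup>2) * H (x + t *\<^sub>R (y - x)) * indicator {0..1} t * indicator S y * indicator S x"
  define I where "I = (\<integral>\<^sup>+y\<in>S. H y \<partial>lborel)"
  define s where "s = emeasure lborel S"
  have inner: "?I t \<le> ennreal (2 ^ DIM('a)) * I * s" if t: "0 \<le> t" "t \<le> 1" for t
  proof -
    have eq: "x + t *\<^sub>R (y - x) = (1 - t) *\<^sub>R x + t *\<^sub>R y" for x y :: 'a by (simp add: algebra_simps)
    show ?thesis
    proof (cases "1/2 \<le> t")
      case True
      have "?I t \<le> (\<integral>\<^sup>+x\<in>S. ennreal (2 ^ DIM('a)) * I \<partial>lborel)"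
        unfolding eq I_def using contraction_integral_le[OF S _ _ _ True t(2)]
        by (intro nn_integral_mono) (auto simp: indicator_def)
      then show ?thesis by (simp add: nn_integral_cmult s_def)
    next
      case False
      have "?I t = (\<integral>\<^sup>+x. (\<integral>\<^sup>+y. H (x + t *\<^sub>R (y - x)) * indicator S y * indicator S x \<partial>lborel) \<partial>lborel)"
        by (simp add: nn_integral_multc)
      also have "\<dots> = (\<integral>\<^sup>+y. (\<integral>\<^sup>+x. H (x + t *\<^sub>R (y - x)) * indicator S y * indicator S x \<partial>lborel) \<partial>lborel)"
        by (rule lborel_pair.Fubini') measurable
      also have "\<dots> = (\<integral>\<^sup>+y\<in>S. (\<integral>\<^sup>+x\<in>S. H ((1 - (1 - t)) *\<^sub>R y + (1 - t) *\<^sub>R x) \<partial>lborel) \<partial>lborel)"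
        unfolding eq by (intro nn_integral_cong) (auto simp: indicator_def add.commute)
      also have "\<dots> \<le> (\<integral>\<^sup>+x\<in>S. ennreal (2 ^ DIM('a)) * I \<partial>lborel)"
        unfolding I_def using contraction_integral_le[OF S, of H _ "1 - t"] False t
        by (intro nn_integral_mono) (auto simp: indicator_def)
      finally show ?thesis by (simp add: nn_integral_cmult s_def)
    qed
  qed
  define F where "F y = (\<integral>\<^sup>+x\<in>S. ennreal ((norm (\<psi> x - \<psi> y))\<^sup>2) \<partial>lborel)" for y
  have [measurable]: "F \<in> borel_measurable borel" unfolding F_def by measurable
  define B where "B = ennreal (\<Delta>\<^sup>2 * 2 ^ DIM('a)) * I"
  have "(\<integral>\<^sup>+y\<in>S. F y \<partial>lborel) \<le> (\<integral>\<^sup>+x\<in>S. (\<integral>\<^sup>+y\<in>S. (\<integral>\<^sup>+t\<in>{0..1}. ennreal (\<Delta>\<^sup>2) * H (x + t *\<^sub>R (y - x)) \<partial>lborel) \<partial>lborel) \<partial>lborel)"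
  proof -
    have "ennreal ((norm (\<psi> y - \<psi> x))\<^sup>2) \<le> (\<integral>\<^sup>+t\<in>{0..1}. ennreal (\<Delta>\<^sup>2) * H (x + t *\<^sub>R (y - x)) \<partial>lborel)" if "x \<in> S" "y \<in> S" for x y
    proof -
      have "ennreal ((norm (\<psi> y - \<psi> x))\<^sup>2) \<le> ennreal ((norm (y - x))\<^sup>2) * (\<integral>\<^sup>+t\<in>{0..1}. H (x + t *\<^sub>R (y - x)) \<partial>lborel)"
        unfolding H_def by (rule increment_le_segment_integral) (use der G DG in auto)
      also have "\<dots> \<le> ennreal (\<Delta>\<^sup>2) * (\<integral>\<^sup>+t\<in>{0..1}. H (x + t *\<^sub>R (y - x)) \<partial>lborel)"
        using \<Delta>[OF that] by (intro mult_right_mono ennreal_leI power_mono) auto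
      finally show ?thesis by (simp add: nn_integral_cmult mult.assoc)
    qed
    then show ?thesis unfolding F_def
      by (intro nn_integral_mono) (auto simp: indicator_def intro!: nn_integral_mono)
  qed
  also have "\<dots> = (\<integral>\<^sup>+x. (\<integral>\<^sup>+y. (\<integral>\<^sup>+t. ?w x y t \<partial>lborel) \<partial>lborel) \<partial>lborel)"
    by (simp add: nn_integral_multc)
  also have "\<dots> = (\<integral>\<^sup>+x. (\<integral>\<^sup>+t. (\<integral>\<^sup>+y. ?w x y t \<partial>lborel) \<partial>lborel) \<partial>lborel)"
    by (intro nn_integral_cong lborel_pair.Fubini') measurable
  also have "\<dots> = (\<integral>\<^sup>+t. (\<integral>\<^sup>+x. (\<integral>\<^sup>+y. ?w x y t \<partial>lborel) \<partial>lborel) \<partial>lborel)"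
    by (rule lborel_pair.Fubini') measurable
  also have "\<dots> = (\<integral>\<^sup>+t\<in>{0..1}. ennreal (\<Delta>\<^sup>2) * ?I t \<partial>lborel)"
  proof (intro nn_integral_cong)
    fix t :: real
    have "(\<integral>\<^sup>+y. ?w x y t \<partial>lborel) =
       (ennreal (\<Delta>\<^sup>2) * indicator {0..1} t) * ((\<integral>\<^sup>+y\<in>S. H (x + t *\<^sub>R (y - x)) \<partial>lborel) * indicator S x)" for x
    proof -
      have "(\<integral>\<^sup>+y. ?w x y t \<partial>lborel) =
        (\<integral>\<^sup>+y. (ennreal (\<Delta>\<^sup>2) * indicator {0..1} t * indicator S x) * (H (x + t *\<^sub>R (y - x)) * indicator S y) \<partial>lborel)"
        by (simp only: mult_ac)
      also have "\<dots> = (ennreal (\<Delta>\<^sup>2) * indicator {0..1} t * indicator S x) * (\<integral>\<^sup>+y\<in>S. H (x + t *\<^sub>R (y - x)) \<partial>lborel)"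
        by (rule nn_integral_cmult) measurable
      finally show ?thesis by (simp only: mult_ac)
    qed
    then have "(\<integral>\<^sup>+x. (\<integral>\<^sup>+y. ?w x y t \<partial>lborel) \<partial>lborel) =
       (ennreal (\<Delta>\<^sup>2) * indicator {0..1} t) * ?I t"
      by (simp only:) (rule nn_integral_cmult, measurable)
    then show "(\<integral>\<^sup>+x. (\<integral>\<^sup>+y. ?w x y t \<partial>lborel) \<partial>lborel) =
       ennreal (\<Delta>\<^sup>2) * ?I t * indicator {0..1} t"
      by (simp only: mult_ac)
  qed
  also have "\<dots> \<le> (\<integral>\<^sup>+t\<in>{0..1}. ennreal (\<Delta>\<^sup>2) * (ennreal (2 ^ DIM('a)) * I * s) \<partial>(lborel :: real measure))"
    using inner by (intro nn_integral_mono) (auto simp: indicator_def intro!: mult_left_mono)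
  also have "\<dots> = B * s" by (subst nn_integral_cmult_indicator) (auto simp: B_def ennreal_mult mult_ac)
  finally have FB: "(\<integral>\<^sup>+y\<in>S. F y \<partial>lborel) \<le> B * s" .
  have "\<exists>y\<in>S. F y \<le> B"
  proof (rule ccontr)
    assume "\<not> ?thesis"
    then have gt: "B < F y" if "y \<in> S" for y using that by auto
    have "S \<noteq> {}" using pos by auto
    then have "B \<noteq> \<infinity>" using gt by (metis ex_in_conv infinity_ennreal_def not_top_less)
    then have Bs: "B * s \<noteq> \<infinity>" using fin by (simp add: s_def ennreal_mult_eq_top_iff)
    have "(\<integral>\<^sup>+y\<in>S. (F y - B) \<partial>lborel) + B * s = (\<integral>\<^sup>+y. (F y - B) * indicator S y + B * indicator S y \<partial>lborel)"
      by (subst nn_integral_add) (auto simp: nn_integral_cmult s_def)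
    also have "\<dots> = (\<integral>\<^sup>+y\<in>S. F y \<partial>lborel)"
      using gt by (intro nn_integral_cong) (auto simp: indicator_def diff_add_cancel_ennreal less_imp_le)
    finally have "(\<integral>\<^sup>+y\<in>S. (F y - B) \<partial>lborel) + B * s \<le> 0 + B * s" using FB by simp
    then have "(\<integral>\<^sup>+y\<in>S. (F y - B) \<partial>lborel) \<le> 0" using Bs by (simp only: ennreal_add_left_cancel_le add.commute) auto
    then have "AE y in lborel. (F y - B) * indicator S y = 0" by (subst (asm) le_zero_eq, subst (asm) nn_integral_0_iff_AE) auto
    then have "AE y in lborel. y \<notin> S"
    proof eventually_elim
      case (elim y)
      then show ?case using gt[of y] by (auto simp: indicator_def diff_eq_0_iff_ennreal split: if_splits)
    qed
    then have "emeasure lborel S = 0" by (subst (asm) AE_iff_measurable[of S]) auto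
    then show False using pos by simp
  qed
  then show "\<exists>c. (\<integral>\<^sup>+x\<in>S. ennreal ((norm (\<psi> x - c))\<^sup>2) \<partial>lborel) \<le> ennreal (\<Delta>\<^sup>2 * 2 ^ DIM('a)) * (\<integral>\<^sup>+x\<in>S. ennreal ((G x)\<^sup>2) \<partial>lborel)"
    unfolding F_def B_def I_def H_def by blast
qed

text \<open>
  The constants that belong to \<open>S\<close> and to \<open>T\<close> are compared on the overlap, where \<open>\<psi>\<close> is close to both
  in mean square.
\<close>
lemma poincare_Un:
  fixes S T :: "'a::euclidean_space set"
  assumes S: "poincare S K1" and T: "poincare T K2" and [measurable]: "S \<in> sets borel" "T \<in> sets borel"
    and pos: "emeasure lborel (S \<inter> T) \<noteq> 0" and fin: "emeasure lborel T \<noteq> \<infinity>" and K: "0 \<le> K1" "0 \<le> K2"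
  shows "\<exists>K\<ge>0. poincare (S \<union> T) K"
proof -
  obtain \<tau> where \<tau>: "emeasure lborel T = ennreal \<tau>" "\<tau> \<ge> 0" using fin by (cases "emeasure lborel T") auto
  have "emeasure lborel (S \<inter> T) \<le> emeasure lborel T" by (intro emeasure_mono) auto
  then have "emeasure lborel (S \<inter> T) \<noteq> \<infinity>" using \<tau> by (auto simp: top_unique)
  then obtain m where m: "emeasure lborel (S \<inter> T) = ennreal m" "m > 0"
    using pos by (cases "emeasure lborel (S \<inter> T)") (auto simp: less_le)
  define K where "K = K1 + 2 * K2 + 4 * (\<tau> / m) * (K1 + K2)"
  have "poincare (S \<union> T) K"
    unfolding poincare_def
  proof (intro allI impI)
    fix \<psi> :: "'a \<Rightarrow> complex" and D and G :: "'a \<Rightarrow> real"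
    assume der: "\<forall>x. (\<psi> has_derivative D x) (at x)" and G: "continuous_on UNIV G"
      and DG: "\<forall>x v. norm (D x v) \<le> G x * norm v"
    have [measurable]: "\<psi> \<in> borel_measurable borel"
      using der by (intro borel_measurable_continuous_onI) (auto intro!: continuous_at_imp_continuous_on has_derivative_continuous)
    have [measurable]: "G \<in> borel_measurable borel" using G by (rule borel_measurable_continuous_onI)
    define I where "I = (\<integral>\<^sup>+x\<in>S \<union> T. ennreal ((G x)\<^sup>2) \<partial>lborel)"
    have sub: "(\<integral>\<^sup>+x\<in>S. ennreal ((G x)\<^sup>2) \<partial>lborel) \<le> I" "(\<integral>\<^sup>+x\<in>T. ennreal ((G x)\<^sup>2) \<partial>lborel) \<le> I"
      unfolding I_def by (intro nn_integral_mono; auto simp: indicator_def)+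
    define N where "N U c = (\<integral>\<^sup>+x\<in>U. ennreal ((norm (\<psi> x - c))\<^sup>2) \<partial>lborel)" for U c
    obtain c1 where c1: "N S c1 \<le> ennreal K1 * I"
      using S der G DG sub(1) unfolding poincare_def N_def by (meson mult_left_mono order_trans zero_le)
    obtain c2 where c2: "N T c2 \<le> ennreal K2 * I"
      using T der G DG sub(2) unfolding poincare_def N_def by (meson mult_left_mono order_trans zero_le)
    define \<delta> where "\<delta> = ennreal ((norm (c2 - c1))\<^sup>2)"
    have "\<delta> * ennreal m = (\<integral>\<^sup>+x\<in>S \<inter> T. \<delta> \<partial>lborel)" by (simp add: nn_integral_cmult m)
    also have "\<dots> \<le> (\<integral>\<^sup>+x. 2 * (ennreal ((norm (\<psi> x - c1))\<^sup>2) * indicator S x) + 2 * (ennreal ((norm (\<psi> x - c2))\<^sup>2) * indicator T x) \<partial>lborel)"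
    proof (intro nn_integral_mono)
      fix x
      have "\<delta> \<le> 2 * ennreal ((norm (\<psi> x - c1))\<^sup>2) + 2 * ennreal ((norm (\<psi> x - c2))\<^sup>2)"
        using ennreal_norm_add_square_le[of "\<psi> x - c1" "c2 - \<psi> x"] by (simp add: \<delta>_def norm_minus_commute)
      then show "\<delta> * indicator (S \<inter> T) x \<le> 2 * (ennreal ((norm (\<psi> x - c1))\<^sup>2) * indicator S x) + 2 * (ennreal ((norm (\<psi> x - c2))\<^sup>2) * indicator T x)"
        by (auto simp: indicator_def)
    qed
    also have "\<dots> = 2 * N S c1 + 2 * N T c2" unfolding N_def
      by (subst nn_integral_add) (auto simp: nn_integral_cmult)
    also have "\<dots> \<le> 2 * (ennreal K1 * I) + 2 * (ennreal K2 * I)" using c1 c2 by (intro add_mono mult_left_mono) auto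
    also have "\<dots> = ennreal (2 * (K1 + K2)) * I" using K by (simp add: ennreal_mult algebra_simps)
    finally have \<delta>m: "\<delta> * ennreal m \<le> ennreal (2 * (K1 + K2)) * I" .
    have "\<delta> * ennreal \<tau> = ennreal (\<tau> / m) * (\<delta> * ennreal m)"
    proof -
      have "ennreal \<tau> = ennreal (\<tau> / m) * ennreal m" using \<tau> m by (simp flip: ennreal_mult)
      then show ?thesis by (simp add: mult_ac)
    qed
    also have "\<dots> \<le> ennreal (\<tau> / m) * (ennreal (2 * (K1 + K2)) * I)" by (intro mult_left_mono \<delta>m) auto
    also have "\<dots> = ennreal (\<tau> / m * (2 * (K1 + K2))) * I" using \<tau> m K by (subst ennreal_mult) (auto simp: mult.assoc)
    finally have \<delta>\<tau>: "\<delta> * ennreal \<tau> \<le> ennreal (\<tau> / m * (2 * (K1 + K2))) * I" .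
    have "N (S \<union> T) c1 \<le> (\<integral>\<^sup>+x. ennreal ((norm (\<psi> x - c1))\<^sup>2) * indicator S x + (2 * (ennreal ((norm (\<psi> x - c2))\<^sup>2) * indicator T x) + 2 * (\<delta> * indicator T x)) \<partial>lborel)"
      unfolding N_def
    proof (intro nn_integral_mono)
      fix x
      have "ennreal ((norm (\<psi> x - c1))\<^sup>2) \<le> 2 * ennreal ((norm (\<psi> x - c2))\<^sup>2) + 2 * \<delta>"
        using ennreal_norm_add_square_le[of "\<psi> x - c2" "c2 - c1"] by (simp add: \<delta>_def)
      then show "ennreal ((norm (\<psi> x - c1))\<^sup>2) * indicator (S \<union> T) x \<le> ennreal ((norm (\<psi> x - c1))\<^sup>2) * indicator S x + (2 * (ennreal ((norm (\<psi> x - c2))\<^sup>2) * indicator T x) + 2 * (\<delta> * indicator T x))"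
        by (auto simp: indicator_def intro: add_increasing2)
    qed
    also have "\<dots> = N S c1 + (2 * N T c2 + 2 * (\<delta> * ennreal \<tau>))" unfolding N_def
      by (subst nn_integral_add, simp, simp, subst nn_integral_add) (auto simp: nn_integral_cmult \<tau>)
    also have "\<dots> \<le> ennreal K1 * I + (2 * (ennreal K2 * I) + 2 * (ennreal (\<tau> / m * (2 * (K1 + K2))) * I))"
      using c1 c2 \<delta>\<tau> by (intro add_mono mult_left_mono) auto
    also have "\<dots> = ennreal K * I"
    proof -
      have "ennreal K = ennreal K1 + (2 * ennreal K2 + 2 * ennreal (\<tau> / m * (2 * (K1 + K2))))"
      proof -
        have "ennreal (K1 + (2 * K2 + 2 * X)) = ennreal K1 + (2 * ennreal K2 + 2 * ennreal X)" if "X \<ge> 0" for X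
          using that K by (simp add: ennreal_plus ennreal_mult)
        moreover have "K = K1 + (2 * K2 + 2 * (\<tau> / m * (2 * (K1 + K2))))" by (simp add: K_def)
        moreover have "0 \<le> \<tau> / m * (2 * (K1 + K2))" using K \<tau> m by simp
        ultimately show ?thesis by (simp only:)
      qed
      then show ?thesis by (simp add: distrib_right mult.assoc)
    qed
    finally show "\<exists>c. (\<integral>\<^sup>+x\<in>S \<union> T. ennreal ((norm (\<psi> x - c))\<^sup>2) \<partial>lborel) \<le> ennreal K * (\<integral>\<^sup>+x\<in>S \<union> T. ennreal ((G x)\<^sup>2) \<partial>lborel)"
      unfolding N_def I_def by blast
  qed
  moreover have "K \<ge> 0" using K \<tau> m by (simp add: K_def)
  ultimately show ?thesis by blast
qed

text \<open>
  Substitution: the norm of the gradient scales by \<open>R\<close>, hence its square by \<open>R\<^sup>2\<close>.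
\<close>
lemma poincare_scale:
  fixes S :: "'a::euclidean_space set"
  assumes S: "poincare S K" and [measurable]: "S \<in> sets borel" and R: "R > 0"
  shows "poincare {y. (1 / R) *\<^sub>R (y - a) \<in> S} (R\<^sup>2 * K)"
  unfolding poincare_def
proof (intro allI impI)
  fix \<psi> :: "'a \<Rightarrow> complex" and D and G :: "'a \<Rightarrow> real"
  assume der: "\<forall>x. (\<psi> has_derivative D x) (at x)" and G: "continuous_on UNIV G"
    and DG: "\<forall>x v. norm (D x v) \<le> G x * norm v"
  have [measurable]: "\<psi> \<in> borel_measurable borel"
    using der by (intro borel_measurable_continuous_onI) (auto intro!: continuous_at_imp_continuous_on has_derivative_continuous)
  have [measurable]: "G \<in> borel_measurable borel" using G by (rule borel_measurable_continuous_onI)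
  let ?S = "{y. (1 / R) *\<^sub>R (y - a) \<in> S}"
  have "?S = (\<lambda>y. (1 / R) *\<^sub>R (y - a)) -` S \<inter> space borel" by auto
  also have "\<dots> \<in> sets borel" by measurable
  finally have [measurable]: "?S \<in> sets borel" .
  have ind: "indicator ?S (a + R *\<^sub>R y) = (indicator S y :: ennreal)" for y
    using R by (simp add: indicator_def)
  define j where "j = ennreal (\<bar>R\<bar> ^ DIM('a))"
  have tr: "(\<integral>\<^sup>+y\<in>?S. f y \<partial>lborel) = j * (\<integral>\<^sup>+y\<in>S. f (a + R *\<^sub>R y) \<partial>lborel)" if [measurable]: "f \<in> borel_measurable borel" for f :: "'a \<Rightarrow> ennreal"
    using nn_integral_lborel_affine[of "\<lambda>y. f y * indicator ?S y" R a] R by (simp add: ind j_def)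
  have "\<exists>c. (\<integral>\<^sup>+y\<in>S. ennreal ((norm (\<psi> (a + R *\<^sub>R y) - c))\<^sup>2) \<partial>lborel) \<le> ennreal K * (\<integral>\<^sup>+y\<in>S. ennreal ((R * G (a + R *\<^sub>R y))\<^sup>2) \<partial>lborel)"
  proof (rule S[unfolded poincare_def, rule_format])
    show "((\<lambda>y. \<psi> (a + R *\<^sub>R y)) has_derivative (\<lambda>v. D (a + R *\<^sub>R x) (R *\<^sub>R v))) (at x)" for x
      by (rule has_derivative_compose[OF _ der[rule_format]]) (auto intro!: derivative_eq_intros)
    show "continuous_on UNIV (\<lambda>y. R * G (a + R *\<^sub>R y))"
      by (intro continuous_intros continuous_on_compose2[OF G]) auto
    show "norm (D (a + R *\<^sub>R x) (R *\<^sub>R v)) \<le> R * G (a + R *\<^sub>R x) * norm v" for x v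
      using DG[rule_format, of "a + R *\<^sub>R x" "R *\<^sub>R v"] R by (simp add: mult_ac)
  qed
  then obtain c where c: "(\<integral>\<^sup>+y\<in>S. ennreal ((norm (\<psi> (a + R *\<^sub>R y) - c))\<^sup>2) \<partial>lborel) \<le> ennreal K * (\<integral>\<^sup>+y\<in>S. ennreal ((R * G (a + R *\<^sub>R y))\<^sup>2) \<partial>lborel)" by blast
  also have "(\<integral>\<^sup>+y\<in>S. ennreal ((R * G (a + R *\<^sub>R y))\<^sup>2) \<partial>lborel) = ennreal (R\<^sup>2) * (\<integral>\<^sup>+y\<in>S. ennreal ((G (a + R *\<^sub>R y))\<^sup>2) \<partial>lborel)"
    by (simp add: power_mult_distrib ennreal_mult mult.assoc nn_integral_cmult)
  finally have "j * (\<integral>\<^sup>+y\<in>S. ennreal ((norm (\<psi> (a + R *\<^sub>R y) - c))\<^sup>2) \<partial>lborel) \<le> j * (ennreal K * (ennreal (R\<^sup>2) * (\<integral>\<^sup>+y\<in>S. ennreal ((G (a + R *\<^sub>R y))\<^sup>2) \<partial>lborel)))"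
    by (rule mult_left_mono) simp
  moreover have e: "ennreal (R\<^sup>2 * K) = ennreal K * ennreal (R\<^sup>2)"
    by (subst ennreal_mult') (auto simp: mult.commute)
  ultimately have "(\<integral>\<^sup>+x\<in>?S. ennreal ((norm (\<psi> x - c))\<^sup>2) \<partial>lborel) \<le> ennreal (R\<^sup>2 * K) * (\<integral>\<^sup>+x\<in>?S. ennreal ((G x)\<^sup>2) \<partial>lborel)"
    unfolding e by (simp add: tr mult_ac)
  then show "\<exists>c. (\<integral>\<^sup>+x\<in>?S. ennreal ((norm (\<psi> x - c))\<^sup>2) \<partial>lborel) \<le> ennreal (R\<^sup>2 * K) * (\<integral>\<^sup>+x\<in>?S. ennreal ((G x)\<^sup>2) \<partial>lborel)"
    by blast
qed

definition cube :: "real \<Rightarrow> (real^'d::finite) set" where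
  "cube r = {y. \<forall>i. \<bar>y $ i\<bar> < r}"

lemma cube_eq_box: "cube r = box (\<chi> i. - r) (\<chi> i. r)"
proof -
  have *: "\<bar>a\<bar> < r \<longleftrightarrow> - r < a \<and> a < r" for a :: real by auto
  show ?thesis by (simp add: cube_def mem_box_cart set_eq_iff *)
qed

lemma norm_cube_le:
  fixes y :: "real^'d::finite"
  assumes "y \<in> cube r"
  shows "norm y \<le> real CARD('d) * r"
proof -
  have "norm y \<le> (\<Sum>i\<in>UNIV. \<bar>y $ i\<bar>)" by (rule norm_le_l1_cart)
  also have "\<dots> \<le> (\<Sum>i\<in>(UNIV::'d set). r)" using assms by (intro sum_mono) (auto simp: cube_def less_imp_le)
  finally show ?thesis by simp
qed

definition slab :: "'d::finite \<Rightarrow> real \<Rightarrow> (real^'d) set" where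
  "slab i s = {y \<in> cube 2. 1 \<le> s * y $ i}"

lemma slab_convex: "convex (slab i s)"
proof -
  have "slab i s = cube 2 \<inter> {y. inner (s *\<^sub>R axis i 1) y \<ge> 1}" by (auto simp: slab_def inner_axis')
  then show ?thesis by (simp only: cube_eq_box) (intro convex_Int convex_box convex_halfspace_ge)
qed

lemma slab_borel [measurable]: "slab i s \<in> sets borel"
proof -
  have "slab i s = cube 2 \<inter> {y. inner (s *\<^sub>R axis i 1) y \<ge> 1}" by (auto simp: slab_def inner_axis')
  then show ?thesis
    by (simp only: cube_eq_box) (intro sets.Int borel_closed borel_open open_box closed_halfspace_ge)
qed

lemma slab_finite: "emeasure lborel (slab (i :: 'd::finite) s) \<noteq> \<infinity>"
proof -
  have "emeasure lborel (slab i s) \<le> emeasure lborel (cube 2 :: (real^'d) set)"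
    by (intro emeasure_mono) (auto simp: slab_def cube_eq_box)
  also have "\<dots> < \<infinity>" unfolding cube_eq_box by (rule emeasure_bounded_finite) (rule bounded_box)
  finally show ?thesis by simp
qed

lemma slab_Int_pos:
  assumes "i \<noteq> j" "s \<in> {1, -1}" "t \<in> {1, -1}"
  shows "emeasure lborel (slab i s \<inter> slab j t) \<noteq> 0"
proof -
  define U where "U = cube 2 \<inter> {y. inner (s *\<^sub>R axis i 1) y > 1} \<inter> {y. inner (t *\<^sub>R axis j 1) y > 1}"
  define p where "p = (\<chi> k. if k = i then s * (3/2) else if k = j then t * (3/2) else 0)"
  have "p \<in> U" using assms by (auto simp: U_def p_def cube_def inner_axis')
  moreover have U: "open U" unfolding U_def cube_eq_box by (intro open_Int open_box open_halfspace_gt)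
  ultimately have "\<not> negligible U" using open_not_negligible by auto
  then have "emeasure lborel U \<noteq> 0" using U by (auto simp: negligible_iff_null_sets null_sets_def)
  moreover have "emeasure lborel U \<le> emeasure lborel (slab i s \<inter> slab j t)"
  proof (rule emeasure_mono)
    show "slab i s \<inter> slab j t \<in> sets lborel" by measurable
  qed (auto simp: U_def slab_def inner_axis')
  ultimately show ?thesis by auto
qed

lemma ex_other_index:
  assumes "CARD('d::finite) \<ge> 2"
  shows "\<exists>j :: 'd. j \<noteq> i"
proof (rule ccontr)
  assume "\<not> ?thesis"
  then have "(UNIV :: 'd set) = {i}" by auto
  then have "CARD('d) = card {i}" by (rule arg_cong)
  then show False using assms by simp
qed

lemma poincare_slab:
  fixes i :: "'d::finite"
  assumes d: "CARD('d) \<ge> 2" and s: "s \<in> {1, -1}"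
  shows "\<exists>K\<ge>0. poincare (slab i s) K"
proof -
  obtain j where j: "j \<noteq> i"
    using ex_other_index[OF d] by metis
  have "emeasure lborel (slab i s \<inter> slab j 1) \<le> emeasure lborel (slab i s)" by (intro emeasure_mono) auto
  then have pos: "emeasure lborel (slab i s) \<noteq> 0" using slab_Int_pos[of i j s 1] j s by auto
  have "norm (y - x) \<le> real CARD('d) * 4" if "x \<in> slab i s" "y \<in> slab i s" for x y
  proof -
    have "y - x \<in> cube 4"
      unfolding cube_def
    proof (intro CollectI allI)
      fix k
      have "\<bar>y $ k\<bar> < 2" "\<bar>x $ k\<bar> < 2" using that by (auto simp: slab_def cube_def)
      then show "\<bar>(y - x) $ k\<bar> < 4" by simp
    qed
    then show ?thesis by (rule norm_cube_le)
  qed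
  then have "poincare (slab i s) ((real CARD('d) * 4)\<^sup>2 * 2 ^ DIM(real^'d))"
    by (intro poincare_convex slab_convex slab_borel pos slab_finite)
  moreover have "0 \<le> (real CARD('d) * 4)\<^sup>2 * 2 ^ DIM(real^'d)" by simp
  ultimately show ?thesis by blast
qed

lemma poincare_star:
  fixes S :: "'a::euclidean_space set"
  assumes F: "finite F" and S: "\<exists>K\<ge>0. poincare S K" "S \<in> sets borel"
    and T: "\<And>T. T \<in> F \<Longrightarrow> (\<exists>K\<ge>0. poincare T K) \<and> T \<in> sets borel \<and> emeasure lborel T \<noteq> \<infinity> \<and> emeasure lborel (S \<inter> T) \<noteq> 0"
  shows "\<exists>K\<ge>0. poincare (S \<union> \<Union>F) K"
  using F T
proof (induction F)
  case (insert T F)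
  obtain K1 where K1: "K1 \<ge> 0" "poincare (S \<union> \<Union>F) K1" using insert by auto
  obtain K2 where K2: "K2 \<ge> 0" "poincare T K2" using insert.prems by auto
  have m: "S \<union> \<Union>F \<in> sets borel" "T \<in> sets borel" using insert S by auto
  have "emeasure lborel (S \<inter> T) \<le> emeasure lborel ((S \<union> \<Union>F) \<inter> T)" using m by (intro emeasure_mono) auto
  then have "emeasure lborel ((S \<union> \<Union>F) \<inter> T) \<noteq> 0" using insert.prems[of T] by auto
  from poincare_Un[OF K1(2) K2(2) m this _ K1(1) K2(1)] insert.prems[of T]
  show ?case by (simp add: Un_ac)
qed (use S in simp)

text \<open>
  The slabs in the directions other than \<open>i\<close> all meet the slab \<open>y\<^sub>i \<ge> 1\<close>, and the opposite slab
  \<open>y\<^sub>i \<le> -1\<close> is attached last, through a direction \<open>j \<noteq> i\<close>. In dimension 1 the annulus is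
  disconnected and the inequality fails.
\<close>
lemma poincare_cube_annulus:
  assumes d: "CARD('d::finite) \<ge> 2"
  shows "\<exists>K\<ge>0. poincare (cube 2 - cube 1 :: (real^'d) set) K"
proof -
  obtain i j :: 'd where ij: "i \<noteq> j"
    using ex_other_index[OF d] by metis
  define F where "F = (\<lambda>(k, s). slab k s) ` ((UNIV - {i}) \<times> {1, -1 :: real})"
  define S where "S = slab i 1 \<union> \<Union>F"
  have "\<exists>K\<ge>0. poincare S K" unfolding S_def
    by (rule poincare_star) (auto simp: F_def slab_finite[unfolded infinity_ennreal_def] slab_Int_pos poincare_slab[OF d])
  moreover have Sb: "S \<in> sets borel" unfolding S_def F_def by (intro sets.Un sets.finite_Union) auto
  moreover have "emeasure lborel (S \<inter> slab i (-1)) \<noteq> 0"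
  proof -
    have "slab j 1 \<in> F" using ij by (force simp: F_def)
    then have "emeasure lborel (slab j 1 \<inter> slab i (-1)) \<le> emeasure lborel (S \<inter> slab i (-1))"
      using Sb by (intro emeasure_mono) (auto simp: S_def)
    then show ?thesis using slab_Int_pos[of j i 1 "-1"] ij by auto
  qed
  ultimately have "\<exists>K\<ge>0. poincare (S \<union> slab i (-1)) K"
    using poincare_slab[OF d, of "-1" i] poincare_Un[OF _ _ Sb slab_borel _ slab_finite] by blast
  moreover have "S \<union> slab i (-1) = cube 2 - cube 1"
  proof (intro equalityI subsetI)
    fix y assume "y \<in> S \<union> slab i (-1)"
    then obtain k s where ks: "y \<in> slab k s" "s \<in> {1, -1}" by (auto simp: S_def F_def)
    then have "1 \<le> \<bar>y $ k\<bar>" by (auto simp: slab_def)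
    then show "y \<in> cube 2 - cube 1" using ks by (auto simp: slab_def cube_def not_less)
  next
    fix y :: "real^'d" assume y: "y \<in> cube 2 - cube 1"
    then obtain k where k: "1 \<le> \<bar>y $ k\<bar>" by (auto simp: cube_def not_less)
    define s :: real where "s = (if y $ k \<ge> 0 then 1 else -1)"
    have "y \<in> slab k s" "s \<in> {1, -1}" using k y by (auto simp: slab_def s_def)
    then show "y \<in> S \<union> slab i (-1)" by (cases "k = i") (auto simp: S_def F_def)
  qed
  ultimately show ?thesis by simp
qed

section \<open>Smooth cutoff functions\<close>

lemma partial_deriv_eqI:
  assumes "(f has_derivative F) (at x)"
  shows "partial_deriv i f x = F (axis i 1)"
  using frechet_derivative_at[OF assms] by (simp add: partial_deriv_def)

lemma has_derivative_partial_deriv: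
  fixes f :: "real^'d::finite \<Rightarrow> 'b::real_normed_vector"
  assumes "f differentiable at x"
  shows "(f has_derivative (\<lambda>v. \<Sum>i\<in>UNIV. v $ i *\<^sub>R partial_deriv i f x)) (at x)"
proof -
  let ?F = "frechet_derivative f (at x)"
  have d: "(f has_derivative ?F) (at x)" using assms by (simp add: frechet_derivative_works)
  interpret bounded_linear ?F by (rule has_derivative_bounded_linear[OF d])
  have "?F v = (\<Sum>i\<in>UNIV. v $ i *\<^sub>R partial_deriv i f x)" for v
  proof -
    have "v = (\<Sum>i\<in>UNIV. v $ i *\<^sub>R axis i 1)" using basis_expansion[of v] by (simp add: scalar_mult_eq_scaleR)
    then have "?F v = ?F (\<Sum>i\<in>UNIV. v $ i *\<^sub>R axis i 1)" by simp
    then show ?thesis by (simp add: sum scale partial_deriv_def)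
  qed
  then have "?F = (\<lambda>v. \<Sum>i\<in>UNIV. v $ i *\<^sub>R partial_deriv i f x)" by (rule ext)
  then show ?thesis using d by simp
qed

lemma C_times_imp_continuous: "C_times k f \<Longrightarrow> continuous_on UNIV f"
  by (cases k) (auto intro!: continuous_at_imp_continuous_on differentiable_imp_continuous_within)

lemma C_times_Suc_D: "C_times (Suc k) f \<Longrightarrow> C_times k f"
proof (induction k arbitrary: f)
  case 0
  then show ?case using C_times_imp_continuous[of "Suc 0" f] by simp
next
  case (Suc k)
  have "C_times (Suc k) (partial_deriv i f)" for i using Suc.prems by (subst (asm) C_times.simps) blast
  then have "C_times k (partial_deriv i f)" for i by (rule Suc.IH)
  then show ?case using Suc.prems by simp
qed

lemma C_times_const: "C_times k (\<lambda>_::real^'d::finite. c)"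
proof (induction k arbitrary: c)
  case (Suc k)
  have "partial_deriv i (\<lambda>_::real^'d. c) = (\<lambda>_. 0)" for i
    by (intro ext) (simp add: partial_deriv_eqI[OF has_derivative_const])
  then show ?case using Suc by simp
qed simp

lemma C_times_add: "C_times k f \<Longrightarrow> C_times k g \<Longrightarrow> C_times k (\<lambda>x. f x + g x)"
proof (induction k arbitrary: f g)
  case (Suc k)
  have "partial_deriv i (\<lambda>x. f x + g x) = (\<lambda>x. partial_deriv i f x + partial_deriv i g x)" for i
  proof
    fix x
    have "(f has_derivative frechet_derivative f (at x)) (at x)" "(g has_derivative frechet_derivative g (at x)) (at x)"
      using Suc.prems by (auto simp: frechet_derivative_works)
    from partial_deriv_eqI[OF has_derivative_add[OF this]]
    show "partial_deriv i (\<lambda>x. f x + g x) x = partial_deriv i f x + partial_deriv i g x"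
      by (simp add: partial_deriv_def)
  qed
  then show ?case using Suc by simp
qed (auto intro: continuous_intros)

lemma partial_deriv_mult:
  fixes f g :: "real^'d::finite \<Rightarrow> complex"
  assumes "f differentiable at x" "g differentiable at x"
  shows "partial_deriv i (\<lambda>x. f x * g x) x = f x * partial_deriv i g x + partial_deriv i f x * g x"
proof -
  have "(f has_derivative frechet_derivative f (at x)) (at x)" "(g has_derivative frechet_derivative g (at x)) (at x)"
    using assms by (auto simp: frechet_derivative_works)
  from partial_deriv_eqI[OF has_derivative_mult[OF this]]
  show ?thesis by (simp add: partial_deriv_def)
qed

lemma C_times_mult:
  fixes f g :: "real^'d::finite \<Rightarrow> complex"
  shows "C_times k f \<Longrightarrow> C_times k g \<Longrightarrow> C_times k (\<lambda>x. f x * g x)"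
proof (induction k arbitrary: f g)
  case (Suc k)
  have "partial_deriv i (\<lambda>x. f x * g x) = (\<lambda>x. f x * partial_deriv i g x + partial_deriv i f x * g x)" for i
    by (intro ext partial_deriv_mult) (use Suc.prems in auto)
  moreover have "C_times k f" "C_times k g" using Suc.prems by (auto intro: C_times_Suc_D)
  ultimately show ?case using Suc by (auto intro!: C_times_add)
qed (auto intro: continuous_intros)

lemma partial_deriv_affine:
  fixes f :: "real^'d::finite \<Rightarrow> complex"
  assumes "f differentiable at (c *\<^sub>R (x - a))"
  shows "partial_deriv i (\<lambda>y. f (c *\<^sub>R (y - a))) x = of_real c * partial_deriv i f (c *\<^sub>R (x - a))"
    and "(\<lambda>y. f (c *\<^sub>R (y - a))) differentiable at x"
proof -
  let ?F = "frechet_derivative f (at (c *\<^sub>R (x - a)))"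
  have d: "(f has_derivative ?F) (at (c *\<^sub>R (x - a)))" using assms by (simp add: frechet_derivative_works)
  have "((\<lambda>y. f (c *\<^sub>R (y - a))) has_derivative (\<lambda>v. ?F (c *\<^sub>R v))) (at x)"
    by (rule has_derivative_compose[where f = "\<lambda>y. c *\<^sub>R (y - a)" and g = f, OF _ d]) (auto intro!: derivative_eq_intros)
  note D = this
  then show "(\<lambda>y. f (c *\<^sub>R (y - a))) differentiable at x" by (rule differentiableI)
  have "?F (c *\<^sub>R axis i 1) = c *\<^sub>R ?F (axis i 1)"
    using has_derivative_bounded_linear[OF d] by (intro linear_scale bounded_linear.linear)
  then show "partial_deriv i (\<lambda>y. f (c *\<^sub>R (y - a))) x = of_real c * partial_deriv i f (c *\<^sub>R (x - a))"
    unfolding partial_deriv_eqI[OF D] partial_deriv_def[of i f] scaleR_conv_of_real[of c "?F (axis i 1)"] .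
qed

lemma C_times_affine:
  fixes f :: "real^'d::finite \<Rightarrow> complex"
  shows "C_times k f \<Longrightarrow> C_times k (\<lambda>y. f (c *\<^sub>R (y - a)))"
proof (induction k arbitrary: f)
  case 0
  then show ?case by (auto intro!: continuous_intros continuous_on_compose2[of UNIV f])
next
  case (Suc k)
  have "partial_deriv i (\<lambda>y. f (c *\<^sub>R (y - a))) = (\<lambda>x. of_real c * partial_deriv i f (c *\<^sub>R (x - a)))" for i
    by (intro ext partial_deriv_affine) (use Suc.prems in auto)
  then show ?case using Suc by (auto intro!: C_times_mult C_times_const partial_deriv_affine(2))
qed

text \<open>
  All derivatives are given at once as one sequence, so that passing to the derivative is a shift.
\<close>
definition smooth_real :: "(real \<Rightarrow> real) \<Rightarrow> bool" where
  "smooth_real h \<longleftrightarrow> (\<exists>D. D 0 = h \<and> (\<forall>n t. (D n has_real_derivative D (Suc n) t) (at t)))"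

lemma smooth_real_deriv:
  assumes "smooth_real h"
  obtains h' where "smooth_real h'" "\<And>t. (h has_real_derivative h' t) (at t)"
proof -
  obtain D where D: "D 0 = h" "\<And>n t. (D n has_real_derivative D (Suc n) t) (at t)"
    using assms unfolding smooth_real_def by blast
  have "smooth_real (D 1)" unfolding smooth_real_def using D by (intro exI[of _ "\<lambda>n. D (Suc n)"]) auto
  then show thesis using that[of "D 1"] D(2)[of 0] D(1) by simp
qed

text \<open>
  The chain rule reproduces the shape of the function, with \<open>h\<close> replaced by its derivative, times a
  partial derivative of \<open>u\<close>; hence the induction over \<open>k\<close> for all \<open>h\<close> simultaneously.
\<close>
lemma C_times_compose_smooth_real:
  fixes u :: "real^'d::finite \<Rightarrow> real"
  assumes "smooth_real h"
  shows "C_times k (\<lambda>y. complex_of_real (u y)) \<Longrightarrow> C_times k (\<lambda>y. complex_of_real (h (u y)))"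
  using assms
proof (induction k arbitrary: h)
  case 0
  obtain h' where h': "\<And>t. (h has_real_derivative h' t) (at t)" using smooth_real_deriv[OF 0(2)] by blast
  then have "continuous_on UNIV h" by (intro DERIV_continuous_on) (auto intro: has_field_derivative_at_within)
  moreover have "continuous_on UNIV u"
    using continuous_on_Re[OF 0(1)[unfolded C_times.simps]] by simp
  ultimately have "continuous_on UNIV (\<lambda>y. h (u y))" by (rule continuous_on_compose2) auto
  then show ?case by (auto intro: continuous_intros)
next
  case (Suc k)
  obtain h' where h': "smooth_real h'" "\<And>t. (h has_real_derivative h' t) (at t)" using smooth_real_deriv[OF Suc.prems(2)] by blast
  let ?f = "\<lambda>y. complex_of_real (u y)"
  have d: "((\<lambda>y. complex_of_real (h (u y))) has_derivative (\<lambda>v. of_real (h' (u x)) * frechet_derivative ?f (at x) v)) (at x)" for x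
  proof -
    let ?F = "frechet_derivative ?f (at x)"
    have f: "(?f has_derivative ?F) (at x)" using Suc.prems by (simp add: frechet_derivative_works)
    have u: "(u has_derivative (\<lambda>v. Re (?F v))) (at x)"
      using bounded_linear.has_derivative[OF bounded_linear_Re f] by simp
    then have "(?f has_derivative (\<lambda>v. complex_of_real (Re (?F v)))) (at x)"
      by (rule bounded_linear.has_derivative[OF bounded_linear_of_real])
    then have F: "?F v = complex_of_real (Re (?F v))" for v using has_derivative_unique[OF f] by metis
    have "(h has_derivative (\<lambda>s. h' (u x) * s)) (at (u x))"
      using h'(2)[of "u x"] by (simp add: has_field_derivative_def)
    from has_derivative_compose[OF u this]
    have "((\<lambda>y. h (u y)) has_derivative (\<lambda>v. h' (u x) * Re (?F v))) (at x)" .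
    from bounded_linear.has_derivative[OF bounded_linear_of_real this]
    have "((\<lambda>y. complex_of_real (h (u y))) has_derivative (\<lambda>v. of_real (h' (u x)) * complex_of_real (Re (?F v)))) (at x)"
      by simp
    then show ?thesis unfolding F[symmetric] .
  qed
  have "partial_deriv i (\<lambda>y. complex_of_real (h (u y))) = (\<lambda>x. complex_of_real (h' (u x)) * partial_deriv i ?f x)" for i
    using partial_deriv_eqI[OF d] by (intro ext) (simp add: partial_deriv_def)
  moreover have "C_times k (\<lambda>y. complex_of_real (h' (u y)))" using Suc h'(1) C_times_Suc_D by blast
  ultimately show ?case using d Suc.prems by (auto simp: differentiable_def intro!: C_times_mult)
qed

lemma C_times_coordinate: "C_times k (\<lambda>y::real^'d::finite. complex_of_real (a * y $ i + b))"
proof (cases k)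
  case (Suc m)
  have d: "((\<lambda>y::real^'d. complex_of_real (a * y $ i + b)) has_derivative (\<lambda>v. complex_of_real (a * v $ i))) (at x)" for x
    by (intro bounded_linear.has_derivative[OF bounded_linear_of_real]) (auto intro!: derivative_eq_intros bounded_linear_imp_has_derivative bounded_linear_vec_nth)
  have "partial_deriv j (\<lambda>y::real^'d. complex_of_real (a * y $ i + b)) = (\<lambda>_. complex_of_real (a * axis j 1 $ i))" for j
    using partial_deriv_eqI[OF d] by auto
  then show ?thesis using Suc d by (auto simp: differentiable_def intro!: C_times_const)
qed (auto intro!: continuous_intros)

text \<open>
  The functions \<open>p(1/t) e^(-1/t)\<close>, extended by 0 to the left, form a family that is closed under
  differentiation; for \<open>p = 1\<close> it contains the standard smooth function that is flat at 0.
\<close>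
definition exp_recip_poly :: "real poly \<Rightarrow> real \<Rightarrow> real" where
  "exp_recip_poly p t = (if t > 0 then poly p (1 / t) * exp (- (1 / t)) else 0)"

lemma poly_div_exp_tendsto_0: "((\<lambda>x. poly p x * exp (- x)) \<longlongrightarrow> 0) (at_top :: real filter)"
proof -
  have "((\<lambda>x. \<Sum>i\<le>degree p. coeff p i * (x ^ i / exp x)) \<longlongrightarrow> (\<Sum>i\<le>degree p. coeff p i * 0)) (at_top :: real filter)"
    by (intro tendsto_intros tendsto_power_div_exp_0)
  moreover have "poly p x * exp (- x) = (\<Sum>i\<le>degree p. coeff p i * (x ^ i / exp x))" for x :: real
    by (simp add: poly_altdef exp_minus divide_inverse sum_distrib_right mult.assoc)
  ultimately show ?thesis by simp
qed

lemma exp_recip_poly_deriv: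
  "(exp_recip_poly p has_real_derivative exp_recip_poly ([:0, 0, 1:] * (p - pderiv p)) t) (at t)"
proof -
  consider "t > 0" | "t < 0" | "t = 0" by linarith
  then show ?thesis
  proof cases
    case 1
    have "((\<lambda>t. poly p (1 / t) * exp (- (1 / t))) has_real_derivative exp_recip_poly ([:0, 0, 1:] * (p - pderiv p)) t) (at t)"
      using 1 unfolding exp_recip_poly_def
      by (auto intro!: derivative_eq_intros simp: field_simps power2_eq_square)
    then show ?thesis
      by (rule has_field_derivative_transform_within_open[where S = "{0<..}"]) (use 1 in \<open>auto simp: exp_recip_poly_def\<close>)
  next
    case 2
    have "((\<lambda>t. 0) has_real_derivative 0) (at t)" by simp
    then have "(exp_recip_poly p has_real_derivative 0) (at t)"
      by (rule has_field_derivative_transform_within_open[where S = "{..<0}"]) (use 2 in \<open>auto simp: exp_recip_poly_def\<close>)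
    then show ?thesis using 2 by (simp add: exp_recip_poly_def)
  next
    case 3
    have "((\<lambda>h. exp_recip_poly p h / h) \<longlongrightarrow> 0) (at 0)"
    proof (rule filterlim_split_at)
      have "((\<lambda>h::real. 0) \<longlongrightarrow> (0::real)) (at_left 0)" by simp
      moreover have "\<forall>\<^sub>F h in at_left 0. 0 = exp_recip_poly p h / h"
        by (auto simp: eventually_at_filter exp_recip_poly_def)
      ultimately show "((\<lambda>h. exp_recip_poly p h / h) \<longlongrightarrow> 0) (at_left 0)" by (rule Lim_transform_eventually)
      have "((\<lambda>h. poly (pCons 0 p) (inverse h) * exp (- inverse h)) \<longlongrightarrow> 0) (at_right (0::real))"
        by (rule filterlim_compose[OF poly_div_exp_tendsto_0 filterlim_inverse_at_top_right])
      moreover have "\<forall>\<^sub>F h in at_right 0. poly (pCons 0 p) (inverse h) * exp (- inverse h) = exp_recip_poly p h / h"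
        by (auto simp: eventually_at_filter exp_recip_poly_def field_simps)
      ultimately show "((\<lambda>h. exp_recip_poly p h / h) \<longlongrightarrow> 0) (at_right 0)" by (rule Lim_transform_eventually)
    qed
    then show ?thesis using 3 by (simp add: DERIV_def exp_recip_poly_def[of _ 0])
  qed
qed

lemma smooth_real_exp_recip: "smooth_real (exp_recip_poly 1)"
  unfolding smooth_real_def
proof (intro exI[of _ "\<lambda>n. exp_recip_poly (((\<lambda>p. [:0, 0, 1:] * (p - pderiv p)) ^^ n) 1)"] conjI allI)
  show "(exp_recip_poly (((\<lambda>p. [:0, 0, 1:] * (p - pderiv p)) ^^ n) 1) has_real_derivative
      exp_recip_poly (((\<lambda>p. [:0, 0, 1:] * (p - pderiv p)) ^^ Suc n) 1) t) (at t)" for n t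
    using exp_recip_poly_deriv by simp
qed simp

lemma exp_recip_mono: "s \<le> t \<Longrightarrow> exp_recip_poly 1 s \<le> exp_recip_poly 1 t"
  by (auto simp: exp_recip_poly_def intro!: divide_left_mono)

lemma exp_recip_nonneg: "0 \<le> exp_recip_poly 1 t"
  by (simp add: exp_recip_poly_def)

text \<open>
  With \<open>e(t) = exp(-1/t)\<close> for \<open>t > 0\<close> and 0 otherwise, the function \<open>u\<close> that sums
  \<open>e(\<bar>y\<^sub>i\<bar> - 1)\<close> over the coordinates vanishes where all \<open>\<bar>y\<^sub>i\<bar> \<le> 1\<close> and is at least \<open>s = e(1/2)\<close> where
  some \<open>\<bar>y\<^sub>i\<bar> \<ge> 3/2\<close>. Hence \<open>e(s - u) / e(s)\<close> has the required plateau and support, by composition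
  alone.
\<close>
lemma ex_smooth_cutoff:
  obtains \<eta> :: "real^'d::finite \<Rightarrow> complex" where "\<And>k. C_times k \<eta>"
    and "\<And>y. (\<And>i. \<bar>y $ i\<bar> \<le> 1) \<Longrightarrow> \<eta> y = 1"
    and "\<And>y i. 3/2 \<le> \<bar>y $ i\<bar> \<Longrightarrow> \<eta> y = 0"
    and "\<And>y. norm (\<eta> y) \<le> 1"
proof -
  let ?e = "exp_recip_poly 1"
  define s where "s = ?e (1/2)"
  have s: "?e s > 0" by (simp add: s_def exp_recip_poly_def)
  define u where "u y = (\<Sum>i\<in>UNIV. ?e (1 * y $ i + (- 1)) + ?e ((- 1) * y $ i + (- 1)))" for y :: "real^'d"
  have u0: "u y \<ge> 0" for y unfolding u_def by (intro sum_nonneg add_nonneg_nonneg exp_recip_nonneg)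
  have sumC: "C_times k (\<lambda>y. complex_of_real (\<Sum>i\<in>I. f i y))" if "\<And>i. C_times k (\<lambda>y. complex_of_real (f i y))" "finite I"
    for k I and f :: "'d \<Rightarrow> real^'d \<Rightarrow> real"
    using that(2) by induction (auto intro: that(1) C_times_const C_times_add)
  have "C_times k (\<lambda>y. complex_of_real (u y))" for k
    unfolding u_def
  proof (rule sumC)
    fix i
    have "C_times k (\<lambda>y::real^'d. complex_of_real (?e (1 * y $ i + (- 1))) + complex_of_real (?e ((- 1) * y $ i + (- 1))))"
      by (intro C_times_add C_times_compose_smooth_real[OF smooth_real_exp_recip] C_times_coordinate)
    then show "C_times k (\<lambda>y::real^'d. complex_of_real (?e (1 * y $ i + (- 1)) + ?e ((- 1) * y $ i + (- 1))))" by simp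
  qed simp
  then have "C_times k (\<lambda>y. complex_of_real s + (- 1) * complex_of_real (u y))" for k
    by (intro C_times_add C_times_mult C_times_const)
  then have su: "C_times k (\<lambda>y. complex_of_real (s - u y))" for k by simp
  define \<eta> where "\<eta> y = complex_of_real (1 / ?e s) * complex_of_real (?e (s - u y))" for y
  show thesis
  proof (rule that[of \<eta>])
    show "C_times k \<eta>" for k
      unfolding \<eta>_def by (intro C_times_mult C_times_const C_times_compose_smooth_real[OF smooth_real_exp_recip] su)
    show "\<eta> y = 1" if "\<And>i. \<bar>y $ i\<bar> \<le> 1" for y
    proof -
      have "u y = 0" unfolding u_def
      proof (intro sum.neutral ballI)
        fix i
        have "1 * y $ i + (- 1) \<le> 0" "(- 1) * y $ i + (- 1) \<le> 0" using that[of i] by auto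
        then show "?e (1 * y $ i + (- 1)) + ?e ((- 1) * y $ i + (- 1)) = 0" by (simp add: exp_recip_poly_def)
      qed
      then show ?thesis using s by (simp add: \<eta>_def flip: of_real_mult)
    qed
    show "\<eta> y = 0" if "3/2 \<le> \<bar>y $ i\<bar>" for y i
    proof -
      have "s \<le> ?e (1 * y $ i + (- 1)) + ?e ((- 1) * y $ i + (- 1))"
      proof (cases "y $ i \<ge> 0")
        case True
        then show ?thesis using that exp_recip_mono[of "1/2" "1 * y $ i + (- 1)"] exp_recip_nonneg[of "(- 1) * y $ i + (- 1)"]
          by (simp add: s_def)
      next
        case False
        then show ?thesis using that exp_recip_mono[of "1/2" "(- 1) * y $ i + (- 1)"] exp_recip_nonneg[of "1 * y $ i + (- 1)"]
          by (simp add: s_def)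
      qed
      also have "\<dots> \<le> u y" unfolding u_def
        by (rule member_le_sum) (auto intro!: add_nonneg_nonneg exp_recip_nonneg)
      finally have "?e (s - u y) = 0" by (simp add: exp_recip_poly_def)
      then show ?thesis by (simp add: \<eta>_def)
    qed
    show "norm (\<eta> y) \<le> 1" for y
      using s u0[of y] exp_recip_mono[of "s - u y" s] exp_recip_nonneg[of "s - u y"] 
      by (simp add: \<eta>_def norm_mult norm_divide)
  qed
qed

section \<open>Test functions and their gradients\<close>

definition grad :: "(real^'d::finite \<Rightarrow> complex) \<Rightarrow> real^'d \<Rightarrow> complex^'d" where
  "grad \<psi> y = (\<chi> i. partial_deriv i \<psi> y)"

text \<open>
  The bilinear pairing of the divergence condition, without complex conjugation.
\<close>
definition cdot :: "complex^'d::finite \<Rightarrow> complex^'d \<Rightarrow> complex" where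
  "cdot a b = (\<Sum>i\<in>UNIV. a $ i * b $ i)"

lemma norm_cdot_le: "norm (cdot a b) \<le> norm a * norm b"
proof -
  have "norm (cdot a b) \<le> (\<Sum>i\<in>UNIV. \<bar>norm (a $ i)\<bar> * \<bar>norm (b $ i)\<bar>)"
    unfolding cdot_def by (rule order_trans[OF norm_sum]) (simp add: norm_mult)
  also have "\<dots> \<le> norm a * norm b" unfolding norm_vec_def by (rule L2_set_mult_ineq)
  finally show ?thesis .
qed

lemma cdot_simps:
  "cdot (a + b) c = cdot a c + cdot b c" "cdot a (b + c) = cdot a b + cdot a c"
  "cdot (r *\<^sub>R a) b = r *\<^sub>R cdot a b" "cdot a (r *\<^sub>R b) = r *\<^sub>R cdot a b" "cdot a (z *s b) = z * cdot a b"
  by (simp_all add: cdot_def sum.distrib scaleR_sum_right sum_distrib_left algebra_simps)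

lemma cdot_measurable [measurable]:
  assumes "f \<in> borel_measurable M" "g \<in> borel_measurable M"
  shows "(\<lambda>x. cdot (f x) (g x)) \<in> borel_measurable M"
proof -
  have "continuous_on UNIV (\<lambda>p :: (complex^'d) \<times> (complex^'d). cdot (fst p) (snd p))"
    unfolding cdot_def by (intro continuous_intros)
  from borel_measurable_continuous_Pair[OF assms this] show ?thesis by simp
qed

lemma has_derivative_grad:
  fixes \<psi> :: "real^'d::finite \<Rightarrow> complex"
  assumes "\<psi> differentiable at x"
  shows "(\<psi> has_derivative (\<lambda>v. cdot (\<chi> i. complex_of_real (v $ i)) (grad \<psi> x))) (at x)"
  using has_derivative_partial_deriv[OF assms] by (simp add: cdot_def grad_def scaleR_conv_of_real)

lemma norm_of_real_vec: "norm (\<chi> i. complex_of_real (v $ i)) = norm (v :: real^'d::finite)"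
  by (simp add: norm_vec_def)

lemma partial_deriv_locally_const:
  assumes "open S" "x \<in> S" "\<And>y. y \<in> S \<Longrightarrow> f y = c"
  shows "partial_deriv i f x = 0"
proof -
  have "(f has_derivative (\<lambda>_. 0)) (at x)"
    by (rule has_derivative_transform_within_open[OF has_derivative_const[of c] assms(1,2)]) (use assms in auto)
  from partial_deriv_eqI[OF this] show ?thesis .
qed

lemma test_functionsI:
  assumes "\<And>k. C_times k \<phi>" "bounded {x. \<phi> x \<noteq> 0}"
  shows "\<phi> \<in> test_functions"
  using assms by (simp add: test_functions_def compact_closure)

lemma test_functionsD:
  assumes "\<phi> \<in> test_functions"
  shows "C_times k \<phi>" "bounded {x. \<phi> x \<noteq> 0}" "\<phi> differentiable at x" "continuous_on UNIV \<phi>" "continuous_on UNIV (grad \<phi>)"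
proof -
  show C: "C_times k \<phi>" for k using assms by (simp add: test_functions_def)
  show "bounded {x. \<phi> x \<noteq> 0}" using assms by (simp add: test_functions_def compact_closure)
  show "\<phi> differentiable at x" using C[of "Suc 0"] by simp
  show "continuous_on UNIV \<phi>" using C[of 0] by simp
  have "continuous_on UNIV (partial_deriv i \<phi>)" for i using C[of "Suc 0"] by simp
  then show "continuous_on UNIV (grad \<phi>)" unfolding grad_def by (intro continuous_intros)
qed

lemma grad_outside_support:
  assumes "x \<notin> closure {x. \<phi> x \<noteq> 0}"
  shows "grad \<phi> x = 0"
proof -
  have "partial_deriv i \<phi> x = 0" for i
    by (rule partial_deriv_locally_const[of "- closure {x. \<phi> x \<noteq> 0}" _ _ 0])
      (use assms closure_subset[of "{x. \<phi> x \<noteq> 0}"] in auto)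
  then show ?thesis by (simp add: grad_def vec_eq_iff)
qed

lemma grad_bounded:
  assumes "\<phi> \<in> test_functions"
  obtains B where "0 \<le> B" "\<And>y. norm (grad \<phi> y) \<le> B"
proof -
  let ?S = "closure {x. \<phi> x \<noteq> 0}"
  have "compact (grad \<phi> ` ?S)"
    using test_functionsD(2,5)[OF assms] by (intro compact_continuous_image) (auto simp: compact_closure intro: continuous_on_subset)
  then obtain B where B: "\<And>y. y \<in> ?S \<Longrightarrow> norm (grad \<phi> y) \<le> B" using compact_imp_bounded bounded_iff by (metis imageI)
  have "norm (grad \<phi> y) \<le> max B 0" for y using B[of y] grad_outside_support[of y \<phi>] by (cases "y \<in> ?S") auto
  then show thesis using that[of "max B 0"] by simp
qed

lemma grad_square_integrable:
  assumes "\<phi> \<in> test_functions"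
  shows "square_integrable lebesgue (grad \<phi>)"
  unfolding square_integrable_def
proof
  let ?S = "closure {x. \<phi> x \<noteq> 0}"
  show m: "grad \<phi> \<in> borel_measurable lebesgue"
    using test_functionsD(5)[OF assms] by (simp add: borel_measurable_continuous_onI measurable_completion)
  obtain B where B: "0 \<le> B" "\<And>y. norm (grad \<phi> y) \<le> B" using grad_bounded[OF assms] by blast
  have S: "compact ?S" using test_functionsD(2)[OF assms] by (simp add: compact_closure)
  show "integrable lebesgue (\<lambda>x. (norm (grad \<phi> x))\<^sup>2)"
  proof (rule Bochner_Integration.integrable_bound)
    show "integrable lebesgue (\<lambda>x. B\<^sup>2 * indicator ?S x :: real)"
    proof (intro integrable_mult_right integrable_real_indicator)
      have "emeasure lborel ?S < \<infinity>" using S by (intro emeasure_bounded_finite compact_imp_bounded)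
      then show "emeasure lebesgue ?S < \<infinity>" by simp
    qed simp
    show "(\<lambda>x. (norm (grad \<phi> x))\<^sup>2) \<in> borel_measurable lebesgue" using m by measurable
    show "AE x in lebesgue. norm ((norm (grad \<phi> x))\<^sup>2) \<le> norm (B\<^sup>2 * indicator ?S x :: real)"
      using B grad_outside_support[of _ \<phi>] by (intro AE_I2) (auto simp: indicator_def intro: power_mono)
  qed
qed

lemma test_functions_zero: "(\<lambda>_. 0) \<in> test_functions"
  by (rule test_functionsI) (auto intro: C_times_const)

lemma grad_mult:
  assumes "f differentiable at x" "g differentiable at x"
  shows "grad (\<lambda>y. f y * g y) x = f x *s grad g x + g x *s grad f x"
  using assms by (simp add: grad_def vec_eq_iff partial_deriv_mult mult.commute)

lemma test_functions_cmult:
  assumes "\<phi> \<in> test_functions"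
  shows "(\<lambda>y. c * \<phi> y) \<in> test_functions" "grad (\<lambda>y. c * \<phi> y) x = c *s grad \<phi> x"
proof -
  show "(\<lambda>y. c * \<phi> y) \<in> test_functions"
    by (rule test_functionsI) (auto intro!: C_times_mult C_times_const test_functionsD[OF assms] intro: bounded_subset[OF test_functionsD(2)[OF assms]])
  have "grad (\<lambda>_. c) x = 0" by (simp add: grad_def vec_eq_iff partial_deriv_locally_const[of UNIV])
  then show "grad (\<lambda>y. c * \<phi> y) x = c *s grad \<phi> x"
    using grad_mult[of "\<lambda>_. c" x \<phi>] test_functionsD(3)[OF assms] by (simp add: vec_eq_iff)
qed

lemma grad_add:
  assumes "f differentiable at x" "g differentiable at x"
  shows "grad (\<lambda>y. f y + g y) x = grad f x + grad g x"
proof -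
  have "(f has_derivative frechet_derivative f (at x)) (at x)" "(g has_derivative frechet_derivative g (at x)) (at x)"
    using assms by (auto simp: frechet_derivative_works)
  from partial_deriv_eqI[OF has_derivative_add[OF this]]
  show ?thesis by (simp add: grad_def vec_eq_iff partial_deriv_def)
qed

lemma test_functions_add:
  assumes "\<phi> \<in> test_functions" "\<psi> \<in> test_functions"
  shows "(\<lambda>y. \<phi> y + \<psi> y) \<in> test_functions"
proof (rule test_functionsI)
  show "C_times k (\<lambda>y. \<phi> y + \<psi> y)" for k using assms by (intro C_times_add test_functionsD)
  have "bounded ({x. \<phi> x \<noteq> 0} \<union> {x. \<psi> x \<noteq> 0})" using assms by (simp add: test_functionsD)
  then show "bounded {x. \<phi> x + \<psi> x \<noteq> 0}" by (rule bounded_subset) auto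
qed

lemma square_integrable_indicator:
  assumes "square_integrable lebesgue f" and [measurable]: "S \<in> sets lebesgue"
  shows "square_integrable lebesgue (\<lambda>y. indicator S y *\<^sub>R f y)"
proof -
  have [measurable]: "f \<in> borel_measurable lebesgue" and i: "integrable lebesgue (\<lambda>x. (norm (f x))\<^sup>2)"
    using assms by (auto simp: square_integrable_def)
  have "integrable lebesgue (\<lambda>x. (norm (indicator S x *\<^sub>R f x))\<^sup>2)"
    by (rule Bochner_Integration.integrable_bound[OF i]) (auto simp: indicator_def)
  then show ?thesis unfolding square_integrable_def by simp
qed

lemma square_integrable_norm:
  "square_integrable M f \<Longrightarrow> square_integrable M (\<lambda>x. norm (f x))"
  by (auto simp: square_integrable_def)

lemma square_integrable_cdot:
  assumes "square_integrable M f" "square_integrable M g"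
  shows "integrable M (\<lambda>x. cdot (f x) (g x))"
    and "norm (LINT x|M. cdot (f x) (g x)) \<le> sqrt (LINT x|M. (norm (f x))\<^sup>2) * sqrt (LINT x|M. (norm (g x))\<^sup>2)"
proof -
  have [measurable]: "f \<in> borel_measurable M" "g \<in> borel_measurable M" using assms by (auto simp: square_integrable_def)
  have i: "integrable M (\<lambda>x. norm (f x) * norm (g x))"
    using square_integrable_inner[OF square_integrable_norm square_integrable_norm, OF assms] by simp
  show int: "integrable M (\<lambda>x. cdot (f x) (g x))"
    by (rule Bochner_Integration.integrable_bound[OF i]) (auto simp: norm_cdot_le)
  have "norm (LINT x|M. cdot (f x) (g x)) \<le> (LINT x|M. norm (f x) * norm (g x))"
    by (rule order_trans[OF integral_norm_bound integral_mono]) (auto intro: int i norm_cdot_le)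
  also have "\<dots> \<le> sqrt (LINT x|M. (norm (f x))\<^sup>2) * sqrt (LINT x|M. (norm (g x))\<^sup>2)"
    using Cauchy_Schwarz_integral[OF square_integrable_norm square_integrable_norm, OF assms] by simp
  finally show "norm (LINT x|M. cdot (f x) (g x)) \<le> sqrt (LINT x|M. (norm (f x))\<^sup>2) * sqrt (LINT x|M. (norm (g x))\<^sup>2)" .
qed

lemma power_integral_2_eq:
  assumes "square_integrable lebesgue f" and [measurable]: "S \<in> sets lebesgue"
  shows "power_integral 2 S f = ennreal (LINT y|lebesgue. (norm (indicator S y *\<^sub>R f y))\<^sup>2)"
proof -
  have "power_integral 2 S f = (\<integral>\<^sup>+y. ennreal ((norm (indicator S y *\<^sub>R f y))\<^sup>2) \<partial>lebesgue)"
    unfolding power_integral_def by (intro nn_integral_cong) (auto simp: indicator_def)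
  also have "\<dots> = ennreal (LINT y|lebesgue. (norm (indicator S y *\<^sub>R f y))\<^sup>2)"
    using square_integrable_indicator[OF assms] by (intro nn_integral_eq_integral) (auto simp: square_integrable_def)
  finally show ?thesis .
qed

lemma Lp_space_2_iff: "f \<in> Lp_space 2 \<longleftrightarrow> square_integrable lebesgue f"
proof (cases "f \<in> borel_measurable lebesgue")
  case True
  have "Lp_norm 2 UNIV f < \<infinity> \<longleftrightarrow> power_integral 2 UNIV f < \<infinity>"
    by (auto simp: Lp_norm_eq_power_integral epowr_def less_top)
  also have "\<dots> \<longleftrightarrow> integrable lebesgue (\<lambda>x. (norm (f x))\<^sup>2)"
    using True by (simp add: integrable_iff_bounded power_integral_def)
  finally show ?thesis using True by (auto simp: Lp_space_def square_integrable_def)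
qed (auto simp: Lp_space_def square_integrable_def)

section \<open>Local extension of solenoidal fields\<close>

lemma borel_in_lebesgue: "S \<in> sets borel \<Longrightarrow> S \<in> sets lebesgue"
  by auto

text \<open>
  Take \<open>\<phi>(y) = \<eta>((y - x0)/R) (\<psi>(y) - c)\<close> with the constant \<open>c\<close> of the Poincare inequality on the annulus.
  The gradient of the cutoff costs \<open>1/R\<close>, and the Poincare inequality gains \<open>R\<close>, so \<open>C\<close> is independent
  of \<open>R\<close>.
\<close>
lemma cutoff_gradient_bound:
  assumes d: "CARD('d::finite) \<ge> 2"
  obtains C where "0 < C"
    and "\<And>(x0 :: real^'d) R \<psi>. \<lbrakk>0 < R; \<psi> \<in> test_functions\<rbrakk> \<Longrightarrow> \<exists>\<phi>\<in>test_functions.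
      (\<forall>y. (1 / R) *\<^sub>R (y - x0) \<in> cube 1 \<longrightarrow> grad \<phi> y = grad \<psi> y) \<and>
      (\<forall>y. (1 / R) *\<^sub>R (y - x0) \<notin> cube 2 \<longrightarrow> grad \<phi> y = 0) \<and>
      power_integral 2 {y. (1 / R) *\<^sub>R (y - x0) \<in> cube 2 - cube 1} (grad \<phi>) \<le>
        ennreal C * power_integral 2 {y. (1 / R) *\<^sub>R (y - x0) \<in> cube 2 - cube 1} (grad \<psi>)"
proof -
  obtain Kp where Kp: "Kp \<ge> 0" "poincare (cube 2 - cube 1 :: (real^'d) set) Kp"
    using poincare_cube_annulus[OF d] by blast
  obtain \<eta> :: "real^'d \<Rightarrow> complex" where \<eta>C: "\<And>k. C_times k \<eta>"
    and \<eta>1: "\<And>y. (\<And>i. \<bar>y $ i\<bar> \<le> 1) \<Longrightarrow> \<eta> y = 1"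
    and \<eta>0: "\<And>y i. 3/2 \<le> \<bar>y $ i\<bar> \<Longrightarrow> \<eta> y = 0"
    and \<eta>n: "\<And>y. norm (\<eta> y) \<le> 1"
    using ex_smooth_cutoff by blast
  have \<eta>supp: "{y. \<eta> y \<noteq> 0} \<subseteq> cube 2"
  proof
    fix y assume "y \<in> {y. \<eta> y \<noteq> 0}"
    then have "\<bar>y $ i\<bar> < 3/2" for i using \<eta>0[of y i] by force
    then have "\<bar>y $ i\<bar> < 2" for i by (rule less_trans) simp
    then show "y \<in> cube 2" by (simp add: cube_def)
  qed
  have "\<eta> \<in> test_functions"
    by (rule test_functionsI) (auto intro: \<eta>C bounded_subset[OF _ \<eta>supp] simp: cube_eq_box bounded_box)
  then obtain B where B: "B \<ge> 0" "\<And>y. norm (grad \<eta> y) \<le> B" using grad_bounded by blast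
  have \<eta>d: "\<eta> differentiable at y" for y using \<eta>C[of "Suc 0"] by simp
  have grad1: "grad \<eta> y = 0" if "y \<in> cube 1" for y
  proof -
    have "partial_deriv i \<eta> y = 0" for i
      by (rule partial_deriv_locally_const[of "cube 1" _ _ 1])
        (use that in \<open>auto simp: cube_eq_box open_box, auto simp: cube_def intro!: \<eta>1 less_imp_le simp flip: cube_eq_box\<close>)
    then show ?thesis by (simp add: grad_def vec_eq_iff)
  qed
  have grad0: "grad \<eta> y = 0" "\<eta> y = 0" if y: "y \<notin> cube 2" for y
  proof -
    obtain j where j: "2 \<le> \<bar>y $ j\<bar>" using y by (auto simp: cube_def not_less)
    have "open {y :: real^'d. 3/2 < \<bar>y $ j\<bar>}" by (intro open_Collect_less continuous_intros)
    then have "partial_deriv i \<eta> y = 0" for i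
      by (rule partial_deriv_locally_const[of _ _ _ 0]) (use j in \<open>auto intro!: \<eta>0[of _ j]\<close>)
    then show "grad \<eta> y = 0" by (simp add: grad_def vec_eq_iff)
    show "\<eta> y = 0" using \<eta>0[of y j] j by simp
  qed
  show thesis
  proof
    show "0 < 2 + 2 * B\<^sup>2 * Kp" using Kp by (simp add: add_pos_nonneg)
    fix x0 :: "real^'d" and R :: real and \<psi> :: "real^'d \<Rightarrow> complex"
    assume R: "0 < R" and \<psi>: "\<psi> \<in> test_functions"
    define \<sigma> where "\<sigma> y = (1 / R) *\<^sub>R (y - x0)" for y
    define A where "A = {y. \<sigma> y \<in> cube 2 - cube 1}"
    have "poincare A (R\<^sup>2 * Kp)" unfolding A_def \<sigma>_def
      by (rule poincare_scale[OF Kp(2) _ R]) (auto simp: cube_eq_box)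
    have A: "A \<in> sets borel"
    proof -
      have "A = \<sigma> -` (cube 2 - cube 1) \<inter> space borel" by (auto simp: A_def)
      also have "\<dots> \<in> sets borel" unfolding \<sigma>_def by (rule measurable_sets[of _ borel borel]) (auto simp: cube_eq_box)
      finally show ?thesis .
    qed
    note [measurable] = A borel_in_lebesgue[OF A]
    have "\<exists>c. (\<integral>\<^sup>+x\<in>A. ennreal ((norm (\<psi> x - c))\<^sup>2) \<partial>lborel) \<le> ennreal (R\<^sup>2 * Kp) * (\<integral>\<^sup>+x\<in>A. ennreal ((norm (grad \<psi> x))\<^sup>2) \<partial>lborel)"
    proof (rule \<open>poincare A (R\<^sup>2 * Kp)\<close>[unfolded poincare_def, rule_format])
      show "(\<psi> has_derivative (\<lambda>v. cdot (\<chi> i. complex_of_real (v $ i)) (grad \<psi> x))) (at x)" for x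
        by (rule has_derivative_grad[OF test_functionsD(3)[OF \<psi>]])
      show "continuous_on UNIV (\<lambda>x. norm (grad \<psi> x))" using test_functionsD(5)[OF \<psi>] by (intro continuous_intros)
      show "norm (cdot (\<chi> i. complex_of_real (v $ i)) (grad \<psi> x)) \<le> norm (grad \<psi> x) * norm v" for x v
        using norm_cdot_le[of "\<chi> i. complex_of_real (v $ i)" "grad \<psi> x"] by (simp add: norm_of_real_vec mult.commute)
    qed
    then obtain c where c: "(\<integral>\<^sup>+x\<in>A. ennreal ((norm (\<psi> x - c))\<^sup>2) \<partial>lborel) \<le> ennreal (R\<^sup>2 * Kp) * (\<integral>\<^sup>+x\<in>A. ennreal ((norm (grad \<psi> x))\<^sup>2) \<partial>lborel)" ..
    define \<phi> where "\<phi> y = \<eta> (\<sigma> y) * (\<psi> y + (- c))" for y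
    have smooth: "C_times k (\<lambda>y. \<eta> (\<sigma> y))" "C_times k (\<lambda>y. \<psi> y + (- c))" for k
      unfolding \<sigma>_def by (rule C_times_affine[OF \<eta>C]) (rule C_times_add[OF test_functionsD(1)[OF \<psi>] C_times_const])
    have "{y. \<phi> y \<noteq> 0} \<subseteq> (\<lambda>y. x0 + R *\<^sub>R y) ` cube 2"
    proof
      fix y assume "y \<in> {y. \<phi> y \<noteq> 0}"
      then have "\<sigma> y \<in> cube 2" using \<eta>supp by (auto simp: \<phi>_def)
      moreover have "y = x0 + R *\<^sub>R \<sigma> y" using R by (simp add: \<sigma>_def)
      ultimately show "y \<in> (\<lambda>y. x0 + R *\<^sub>R y) ` cube 2" by blast
    qed
    moreover have "bounded ((\<lambda>y. x0 + R *\<^sub>R y) ` cube 2)"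
      using bounded_translation[OF bounded_scaling[OF bounded_box], of x0 R] by (simp add: cube_eq_box image_image)
    ultimately have \<phi>t: "\<phi> \<in> test_functions"
      unfolding \<phi>_def by (intro test_functionsI C_times_mult smooth) (auto intro: bounded_subset)
    have g\<phi>: "grad \<phi> y = \<eta> (\<sigma> y) *s grad \<psi> y + (\<psi> y - c) *s ((1 / R) *\<^sub>R grad \<eta> (\<sigma> y))" for y
    proof -
      have dd: "(\<lambda>y. \<eta> (\<sigma> y)) differentiable at y" "(\<lambda>y. \<psi> y + (- c)) differentiable at y"
        using smooth[of "Suc 0"] by simp_all
      have "grad (\<lambda>y. \<psi> y + (- c)) y = grad \<psi> y"
        using grad_add[OF test_functionsD(3)[OF \<psi>], of "\<lambda>_. - c" y]
        by (simp add: grad_def vec_eq_iff partial_deriv_locally_const[of UNIV])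
      moreover have "grad (\<lambda>y. \<eta> (\<sigma> y)) y = (1 / R) *\<^sub>R grad \<eta> (\<sigma> y)"
      proof -
        have pd: "partial_deriv i (\<lambda>y. \<eta> (\<sigma> y)) y = of_real (1 / R) * partial_deriv i \<eta> (\<sigma> y)" for i
          unfolding \<sigma>_def by (rule partial_deriv_affine(1)[OF \<eta>d])
        have "(1 / R) *\<^sub>R w = of_real (1 / R) * w" for w :: complex by (rule scaleR_conv_of_real)
        then show ?thesis by (simp only: grad_def vec_eq_iff pd vec_lambda_beta vector_scaleR_component) simp
      qed
      ultimately show ?thesis using grad_mult[OF dd] unfolding \<phi>_def by simp
    qed
    have in1: "grad \<phi> y = grad \<psi> y" if "\<sigma> y \<in> cube 1" for y
    proof -
      have "\<eta> (\<sigma> y) = 1" using that by (intro \<eta>1) (auto simp: cube_def less_imp_le)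
      then show ?thesis using grad1[OF that] by (simp add: g\<phi> vec_eq_iff)
    qed
    have out: "grad \<phi> y = 0" if "\<sigma> y \<notin> cube 2" for y
      using grad0[OF that] by (simp add: g\<phi> vec_eq_iff)
    have ns: "norm (z *s v) = norm z * norm v" for z :: complex and v :: "complex^'d"
      by (simp add: norm_vec_def L2_set_right_distrib norm_mult)
    have pw: "ennreal (norm (grad \<phi> y) powr 2) \<le> 2 * ennreal ((norm (grad \<psi> y))\<^sup>2) + ennreal (2 * B\<^sup>2 / R\<^sup>2) * ennreal ((norm (\<psi> y - c))\<^sup>2)" for y
    proof -
      have "ennreal (norm (grad \<phi> y) powr 2) \<le> 2 * ennreal ((norm (\<eta> (\<sigma> y) *s grad \<psi> y))\<^sup>2) + 2 * ennreal ((norm ((\<psi> y - c) *s ((1 / R) *\<^sub>R grad \<eta> (\<sigma> y))))\<^sup>2)"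
        using ennreal_norm_add_square_le unfolding g\<phi> by simp
      also have "\<dots> \<le> 2 * ennreal ((norm (grad \<psi> y))\<^sup>2) + 2 * ennreal ((norm (\<psi> y - c) * (B / R))\<^sup>2)"
      proof (intro add_mono mult_left_mono ennreal_leI power_mono)
        show "norm (\<eta> (\<sigma> y) *s grad \<psi> y) \<le> norm (grad \<psi> y)" unfolding ns using \<eta>n by (intro mult_left_le_one_le) auto
        have "norm ((1 / R) *\<^sub>R grad \<eta> (\<sigma> y)) \<le> B / R" using B(2)[of "\<sigma> y"] R by (simp add: divide_right_mono)
        then show "norm ((\<psi> y - c) *s ((1 / R) *\<^sub>R grad \<eta> (\<sigma> y))) \<le> norm (\<psi> y - c) * (B / R)" unfolding ns by (intro mult_left_mono) auto
      qed auto
      also have "2 * ennreal ((norm (\<psi> y - c) * (B / R))\<^sup>2) = ennreal (2 * B\<^sup>2 / R\<^sup>2) * ennreal ((norm (\<psi> y - c))\<^sup>2)"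
      proof -
        have "2 * ennreal ((norm (\<psi> y - c) * (B / R))\<^sup>2) = ennreal (2 * (norm (\<psi> y - c) * (B / R))\<^sup>2)" by (simp add: ennreal_mult)
        also have "2 * (norm (\<psi> y - c) * (B / R))\<^sup>2 = (2 * B\<^sup>2 / R\<^sup>2) * (norm (\<psi> y - c))\<^sup>2" by (simp add: power_mult_distrib power_divide)
        finally show ?thesis by (subst (asm) ennreal_mult) auto
      qed
      finally show ?thesis .
    qed
    have [measurable]: "\<psi> \<in> borel_measurable borel" "grad \<psi> \<in> borel_measurable borel"
      using test_functionsD(4,5)[OF \<psi>] by (auto intro: borel_measurable_continuous_onI)
    define P where "P = (\<integral>\<^sup>+x\<in>A. ennreal ((norm (grad \<psi> x))\<^sup>2) \<partial>lborel)"
    have "power_integral 2 A (grad \<phi>) \<le> (\<integral>\<^sup>+y. 2 * (ennreal ((norm (grad \<psi> y))\<^sup>2) * indicator A y) + ennreal (2 * B\<^sup>2 / R\<^sup>2) * (ennreal ((norm (\<psi> y - c))\<^sup>2) * indicator A y) \<partial>lborel)"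
      unfolding power_integral_def nn_integral_completion using pw
      by (intro nn_integral_mono) (auto simp: indicator_def)
    also have "\<dots> = 2 * P + ennreal (2 * B\<^sup>2 / R\<^sup>2) * (\<integral>\<^sup>+y\<in>A. ennreal ((norm (\<psi> y - c))\<^sup>2) \<partial>lborel)"
      unfolding P_def by (subst nn_integral_add) (auto simp: nn_integral_cmult)
    also have "\<dots> \<le> 2 * P + ennreal (2 * B\<^sup>2 / R\<^sup>2) * (ennreal (R\<^sup>2 * Kp) * P)"
      unfolding P_def by (intro add_mono mult_left_mono c) auto
    also have "\<dots> = ennreal (2 + 2 * B\<^sup>2 * Kp) * P"
    proof -
      have "ennreal (2 * B\<^sup>2 / R\<^sup>2) * ennreal (R\<^sup>2 * Kp) = ennreal (2 * B\<^sup>2 * Kp)"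
        using R Kp by (subst ennreal_mult[symmetric]) auto
      then have "ennreal (2 * B\<^sup>2 / R\<^sup>2) * (ennreal (R\<^sup>2 * Kp) * P) = ennreal (2 * B\<^sup>2 * Kp) * P" by (simp add: mult.assoc[symmetric])
      moreover have "ennreal (2 + 2 * B\<^sup>2 * Kp) = 2 + ennreal (2 * B\<^sup>2 * Kp)" using Kp by (simp add: ennreal_plus)
      ultimately show ?thesis by (simp add: distrib_right)
    qed
    also have "P = power_integral 2 A (grad \<psi>)"
      unfolding power_integral_def nn_integral_completion P_def by simp
    finally show "\<exists>\<phi>\<in>test_functions.
      (\<forall>y. (1 / R) *\<^sub>R (y - x0) \<in> cube 1 \<longrightarrow> grad \<phi> y = grad \<psi> y) \<and>
      (\<forall>y. (1 / R) *\<^sub>R (y - x0) \<notin> cube 2 \<longrightarrow> grad \<phi> y = 0) \<and>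
      power_integral 2 {y. (1 / R) *\<^sub>R (y - x0) \<in> cube 2 - cube 1} (grad \<phi>) \<le>
        ennreal (2 + 2 * B\<^sup>2 * Kp) * power_integral 2 {y. (1 / R) *\<^sub>R (y - x0) \<in> cube 2 - cube 1} (grad \<psi>)"
      using \<phi>t in1 out unfolding A_def \<sigma>_def by (intro bexI[of _ \<phi>]) auto
  qed
qed

lemma L2_sigma_iff:
  "f \<in> L2_sigma \<longleftrightarrow> square_integrable lebesgue f \<and> (\<forall>\<psi>\<in>test_functions. (LINT x|lebesgue. cdot (f x) (grad \<psi> x)) = 0)"
  by (simp add: L2_sigma_def div_free_def Lp_space_2_iff cdot_def grad_def)

lemma L2_sigma_diff:
  assumes "f \<in> L2_sigma" "g \<in> L2_sigma"
  shows "(\<lambda>y. f y - g y) \<in> L2_sigma"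
proof -
  have sq: "square_integrable lebesgue f" "square_integrable lebesgue g" using assms by (auto simp: L2_sigma_iff)
  have "(LINT x|lebesgue. cdot (f x - g x) (grad \<psi> x)) = 0" if \<psi>: "\<psi> \<in> test_functions" for \<psi>
  proof -
    have "cdot (f x - g x) (grad \<psi> x) = cdot (f x) (grad \<psi> x) - cdot (g x) (grad \<psi> x)" for x
      by (simp add: cdot_def sum_subtractf algebra_simps)
    then show ?thesis using assms \<psi> square_integrable_cdot(1)[OF _ grad_square_integrable[OF \<psi>]] sq by (simp add: L2_sigma_iff)
  qed
  then show ?thesis using square_integrable_add_scaleR(1)[OF sq, of "-1"] by (simp add: L2_sigma_iff)
qed

text \<open>
  The functional \<open>\<psi> \<mapsto> - \<integral>\<^sub>Q f \<cdot> \<nabla>\<psi>\<close> depends boundedly on \<open>\<nabla>\<psi>\<close> restricted to the annulus \<open>A\<close>: since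
  \<open>div f = 0\<close> annihilates the gradient of \<open>\<phi>\<close>, it equals \<open>\<integral>\<^sub>A f \<cdot> \<nabla>\<phi>\<close>. Its Riesz representative is the
  correction on \<open>A\<close> that makes \<open>f\<close>, cut off to \<open>Q\<close>, solenoidal again.
\<close>
lemma solenoidal_local_extension:
  fixes f :: "real^'d::finite \<Rightarrow> complex^'d"
  assumes R: "0 < R" and f: "f \<in> L2_sigma" and C: "0 < C"
    and cut: "\<And>\<psi>. \<psi> \<in> test_functions \<Longrightarrow> \<exists>\<phi>\<in>test_functions.
      (\<forall>y. (1 / R) *\<^sub>R (y - x0) \<in> cube 1 \<longrightarrow> grad \<phi> y = grad \<psi> y) \<and>
      (\<forall>y. (1 / R) *\<^sub>R (y - x0) \<notin> cube 2 \<longrightarrow> grad \<phi> y = 0) \<and>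
      power_integral 2 {y. (1 / R) *\<^sub>R (y - x0) \<in> cube 2 - cube 1} (grad \<phi>) \<le>
        ennreal C * power_integral 2 {y. (1 / R) *\<^sub>R (y - x0) \<in> cube 2 - cube 1} (grad \<psi>)"
  shows "\<exists>g\<in>L2_sigma. (\<forall>y. (1 / R) *\<^sub>R (y - x0) \<in> cube 1 \<longrightarrow> g y = f y) \<and>
    power_integral 2 UNIV g \<le> ennreal (1 + C) * power_integral 2 {y. (1 / R) *\<^sub>R (y - x0) \<in> cube 2} f"
proof -
  define \<sigma> where "\<sigma> y = (1 / R) *\<^sub>R (y - x0)" for y
  define Q where "Q = {y. \<sigma> y \<in> cube 1}"
  define A where "A = {y. \<sigma> y \<in> cube 2 - cube 1}"
  define Q2 where "Q2 = {y. \<sigma> y \<in> cube 2}"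
  have Q2: "Q2 = Q \<union> A" "Q \<inter> A = {}"
  proof -
    have "y \<in> cube 2" if "y \<in> cube 1" for y :: "real^'d"
      unfolding cube_def
    proof (intro CollectI allI)
      fix i
      have "\<bar>y $ i\<bar> < 1" using that by (simp add: cube_def)
      then show "\<bar>y $ i\<bar> < 2" by simp
    qed
    then show "Q2 = Q \<union> A" "Q \<inter> A = {}" by (auto simp: Q2_def Q_def A_def)
  qed
  have "\<sigma> -` S \<in> sets borel" if "S \<in> sets borel" for S
  proof -
    have "\<sigma> -` S \<inter> space borel \<in> sets borel" unfolding \<sigma>_def by (rule measurable_sets[OF _ that]) auto
    then show ?thesis by simp
  qed
  from this[of "cube 1"] this[of "cube 2 - cube 1"] have "Q \<in> sets borel" "A \<in> sets borel"
    by (auto simp: Q_def A_def vimage_def cube_eq_box)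
  then have QA [measurable]: "Q \<in> sets lebesgue" "A \<in> sets lebesgue" by (auto intro: borel_in_lebesgue)
  have fs: "square_integrable lebesgue f" using f by (simp add: L2_sigma_iff)
  note gs = grad_square_integrable
  define FA where "FA = (LINT y|lebesgue. (norm (indicator A y *\<^sub>R f y))\<^sup>2)"
  have FA: "power_integral 2 A f = ennreal FA" "FA \<ge> 0"
    unfolding FA_def by (simp_all add: power_integral_2_eq[OF fs])
  define K where "K = sqrt FA * sqrt C"
  define a where "a \<psi> = (LINT y|lebesgue. cdot (indicator Q y *\<^sub>R f y) (grad \<psi> y))" for \<psi>
  have Nint: "power_integral 2 A (grad \<psi>) = ennreal (LINT y|lebesgue. (norm (indicator A y *\<^sub>R grad \<psi> y))\<^sup>2)"
    if "\<psi> \<in> test_functions" for \<psi>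
    by (rule power_integral_2_eq[OF gs[OF that] QA(2)])
  have a_bound: "norm (a \<psi>) \<le> K * sqrt (LINT y|lebesgue. (norm (indicator A y *\<^sub>R grad \<psi> y))\<^sup>2)"
    if \<psi>: "\<psi> \<in> test_functions" for \<psi>
  proof -
    let ?N = "\<lambda>\<psi>. LINT y|lebesgue. (norm (indicator A y *\<^sub>R grad \<psi> y))\<^sup>2"
    obtain \<phi> where \<phi>: "\<phi> \<in> test_functions" and in1: "\<And>y. y \<in> Q \<Longrightarrow> grad \<phi> y = grad \<psi> y"
      and out: "\<And>y. y \<notin> Q2 \<Longrightarrow> grad \<phi> y = 0"
      and le: "power_integral 2 A (grad \<phi>) \<le> ennreal C * power_integral 2 A (grad \<psi>)"
      using cut[OF \<psi>] unfolding \<sigma>_def[symmetric] A_def Q_def Q2_def by auto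
    have "ennreal (?N \<phi>) \<le> ennreal (C * ?N \<psi>)"
      using le C unfolding Nint[OF \<phi>] Nint[OF \<psi>] by (simp add: ennreal_mult)
    then have N: "?N \<phi> \<le> C * ?N \<psi>" using C by (subst (asm) ennreal_le_iff) auto
    have eq: "cdot (f y) (grad \<phi> y) = cdot (indicator Q y *\<^sub>R f y) (grad \<psi> y) + cdot (indicator A y *\<^sub>R f y) (indicator A y *\<^sub>R grad \<phi> y)" for y
      using in1[of y] out[of y] Q2 by (auto simp: indicator_def cdot_simps) (auto simp: cdot_def)
    have "0 = (LINT y|lebesgue. cdot (f y) (grad \<phi> y))" using f \<phi> by (simp add: L2_sigma_iff)
    also have "\<dots> = (LINT y|lebesgue. cdot (indicator Q y *\<^sub>R f y) (grad \<psi> y) + cdot (indicator A y *\<^sub>R f y) (indicator A y *\<^sub>R grad \<phi> y))"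
      by (rule Bochner_Integration.integral_cong[OF refl eq])
    also have "\<dots> = a \<psi> + (LINT y|lebesgue. cdot (indicator A y *\<^sub>R f y) (indicator A y *\<^sub>R grad \<phi> y))"
      unfolding a_def by (intro Bochner_Integration.integral_add square_integrable_cdot square_integrable_indicator fs gs \<phi> \<psi> QA)
    finally have "a \<psi> = - (LINT y|lebesgue. cdot (indicator A y *\<^sub>R f y) (indicator A y *\<^sub>R grad \<phi> y))"
      by (simp add: eq_neg_iff_add_eq_0)
    then have "norm (a \<psi>) = norm (LINT y|lebesgue. cdot (indicator A y *\<^sub>R f y) (indicator A y *\<^sub>R grad \<phi> y))" by simp
    also have "\<dots> \<le> sqrt FA * sqrt (?N \<phi>)"
      unfolding FA_def by (intro square_integrable_cdot square_integrable_indicator fs gs \<phi> QA)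
    also have "\<dots> \<le> sqrt FA * sqrt (C * ?N \<psi>)" using N FA by (intro mult_left_mono real_sqrt_le_mono) auto
    finally show ?thesis by (simp add: K_def real_sqrt_mult mult.assoc)
  qed
  define G where "G = (\<lambda>\<psi>. (\<lambda>y. indicator A y *\<^sub>R grad \<psi> y, - Re (a \<psi>))) ` test_functions"
  have K0: "K \<ge> 0" using FA C by (simp add: K_def)
  obtain h where h: "square_integrable lebesgue h" and hK: "(LINT y|lebesgue. (norm (h y))\<^sup>2) \<le> K\<^sup>2"
    and hG: "\<And>u b. (u, b) \<in> G \<Longrightarrow> (LINT y|lebesgue. h y \<bullet> u y) = b"
  proof (rule Riesz_representation_L2[of G lebesgue K])
    show "square_integrable lebesgue u" if "(u, b) \<in> G" for u b
      using that by (auto simp: G_def intro!: square_integrable_indicator gs QA)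
    have "grad (\<lambda>_. 0) y = (0 :: complex^'d)" for y by (simp add: grad_def vec_eq_iff partial_deriv_locally_const[of UNIV])
    then show "((\<lambda>y. 0), 0) \<in> G"
      unfolding G_def by (intro image_eqI[of _ _ "\<lambda>_. 0"] test_functions_zero) (simp add: a_def cdot_def)
    show "((\<lambda>x. u x + c *\<^sub>R v x), b + c * e) \<in> G" if uG: "(u, b) \<in> G" and vG: "(v, e) \<in> G" for u b v e c
    proof -
      obtain \<psi> where \<psi>: "\<psi> \<in> test_functions" "u = (\<lambda>y. indicator A y *\<^sub>R grad \<psi> y)" "b = - Re (a \<psi>)" using uG by (auto simp: G_def)
      obtain \<phi> where \<phi>: "\<phi> \<in> test_functions" "v = (\<lambda>y. indicator A y *\<^sub>R grad \<phi> y)" "e = - Re (a \<phi>)" using vG by (auto simp: G_def)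
      define \<xi> where "\<xi> y = \<psi> y + complex_of_real c * \<phi> y" for y
      have \<xi>: "\<xi> \<in> test_functions" unfolding \<xi>_def using \<psi> \<phi> by (intro test_functions_add test_functions_cmult)
      have g: "grad \<xi> y = grad \<psi> y + c *\<^sub>R grad \<phi> y" for y
      proof -
        have "grad \<xi> y = grad \<psi> y + complex_of_real c *s grad \<phi> y"
          unfolding \<xi>_def using grad_add[OF test_functionsD(3)[OF \<psi>(1)] test_functionsD(3)[OF test_functions_cmult(1)[OF \<phi>(1)]]]
            test_functions_cmult(2)[OF \<phi>(1)] by simp
        moreover have "complex_of_real c *s grad \<phi> y = c *\<^sub>R grad \<phi> y" by (simp add: vec_eq_iff) (simp add: scaleR_conv_of_real)
        ultimately show ?thesis by simp
      qed
      have "a \<xi> = (LINT y|lebesgue. cdot (indicator Q y *\<^sub>R f y) (grad \<psi> y) + c *\<^sub>R cdot (indicator Q y *\<^sub>R f y) (grad \<phi> y))"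
        unfolding a_def g by (simp add: cdot_simps)
      also have "\<dots> = a \<psi> + c *\<^sub>R a \<phi>"
        unfolding a_def
        by (subst Bochner_Integration.integral_add)
          (auto intro!: square_integrable_cdot square_integrable_indicator fs gs \<phi> \<psi> QA integrable_scaleR_right)
      finally have "b + c * e = - Re (a \<xi>)" using \<psi> \<phi> by simp
      moreover have "(\<lambda>x. u x + c *\<^sub>R v x) = (\<lambda>y. indicator A y *\<^sub>R grad \<xi> y)"
        using \<psi> \<phi> by (simp add: g scaleR_right_distrib mult.commute)
      ultimately show ?thesis using \<xi> by (auto simp: G_def)
    qed
    show "\<bar>b\<bar> \<le> K * sqrt (LINT x|lebesgue. (norm (u x))\<^sup>2)" if "(u, b) \<in> G" for u b
      using that a_bound abs_Re_le_cmod order_trans by (auto simp: G_def) fastforce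
    show "0 \<le> K" by (rule K0)
  qed blast
  \<comment> \<open>The real inner product of \<open>h\<close> and \<open>\<nabla>\<psi>\<close>
    is the real part of the pairing of \<open>\<nabla>\<psi>\<close> with the conjugate of
    \<open>h\<close>.\<close>
  define h' where "h' y = (\<chi> i. cnj (h y $ i))" for y
  have h'n: "norm (h' y) = norm (h y)" for y by (simp add: h'_def norm_vec_def)
  have h's: "square_integrable lebesgue h'"
  proof -
    have [measurable]: "h \<in> borel_measurable lebesgue" using h by (simp add: square_integrable_def)
    have "continuous_on UNIV (\<lambda>v :: complex^'d. \<chi> i. cnj (v $ i))" by (intro continuous_intros)
    then have "(\<lambda>v :: complex^'d. \<chi> i. cnj (v $ i)) \<in> borel_measurable borel" by (rule borel_measurable_continuous_onI)
    then have "h' \<in> borel_measurable lebesgue" unfolding h'_def by measurable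
    then show ?thesis using h by (simp add: square_integrable_def h'n)
  qed
  define g where "g y = indicator Q y *\<^sub>R f y + 1 *\<^sub>R (indicator A y *\<^sub>R h' y)" for y
  have g_sq: "square_integrable lebesgue g"
    unfolding g_def by (intro square_integrable_add_scaleR square_integrable_indicator fs h's QA)
  define b where "b \<psi> = (LINT y|lebesgue. cdot (indicator A y *\<^sub>R h' y) (grad \<psi> y))" for \<psi>
  have Re_b: "Re (b \<psi>) = - Re (a \<psi>)" if \<psi>: "\<psi> \<in> test_functions" for \<psi>
  proof -
    have i: "integrable lebesgue (\<lambda>y. cdot (indicator A y *\<^sub>R h' y) (grad \<psi> y))"
      by (intro square_integrable_cdot square_integrable_indicator h's gs \<psi> QA)
    have "Re (b \<psi>) = (LINT y|lebesgue. Re (cdot (indicator A y *\<^sub>R h' y) (grad \<psi> y)))"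
      unfolding b_def using i by simp
    also have "\<dots> = (LINT y|lebesgue. h y \<bullet> (indicator A y *\<^sub>R grad \<psi> y))"
      by (intro Bochner_Integration.integral_cong refl)
        (simp add: cdot_def h'_def inner_vec_def inner_complex_def sum_distrib_left algebra_simps)
    also have "\<dots> = - Re (a \<psi>)" using \<psi> by (intro hG) (auto simp: G_def)
    finally show ?thesis .
  qed
  have b: "b \<psi> = - a \<psi>" if \<psi>: "\<psi> \<in> test_functions" for \<psi>
  proof -
    \<comment> \<open>The identity for imaginary parts is the one for real parts, applied to
      \<open>- \<i> \<psi>\<close>.\<close>
    let ?\<psi> = "\<lambda>y. - \<i> * \<psi> y"
    have "a ?\<psi> = - \<i> * a \<psi>" "b ?\<psi> = - \<i> * b \<psi>"
      unfolding a_def b_def test_functions_cmult(2)[OF \<psi>] cdot_simps(5) by (rule integral_mult_right_zero)+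
    then have "Im (b \<psi>) = - Im (a \<psi>)" using Re_b[OF test_functions_cmult(1)[OF \<psi>, of "- \<i>"]] by simp
    then show ?thesis using Re_b[OF \<psi>] by (simp add: complex_eq_iff)
  qed
  have "g \<in> L2_sigma"
    unfolding L2_sigma_iff
  proof (intro conjI ballI)
    fix \<psi> :: "real^'d \<Rightarrow> complex" assume \<psi>: "\<psi> \<in> test_functions"
    have "(LINT y|lebesgue. cdot (g y) (grad \<psi> y)) = a \<psi> + b \<psi>"
      unfolding g_def a_def b_def cdot_simps(1) scaleR_one
      by (intro Bochner_Integration.integral_add square_integrable_cdot square_integrable_indicator fs gs h's \<psi> QA)
    then show "(LINT y|lebesgue. cdot (g y) (grad \<psi> y)) = 0" using b[OF \<psi>] by simp
  qed (rule g_sq)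
  moreover have "g y = f y" if "(1 / R) *\<^sub>R (y - x0) \<in> cube 1" for y
  proof -
    have "y \<in> Q" "y \<notin> A" using that Q2 by (auto simp: Q_def \<sigma>_def)
    then show ?thesis by (simp add: g_def)
  qed
  moreover have "power_integral 2 UNIV g \<le> ennreal (1 + C) * power_integral 2 Q2 f"
  proof -
    have [measurable]: "f \<in> borel_measurable lebesgue" "h \<in> borel_measurable lebesgue" using fs h by (auto simp: square_integrable_def)
    have "power_integral 2 UNIV g \<le> (\<integral>\<^sup>+y. ennreal (norm (f y) powr 2) * indicator Q y + ennreal ((norm (h y))\<^sup>2) \<partial>lebesgue)"
      unfolding power_integral_def using Q2(2)
      by (intro nn_integral_mono) (auto simp: g_def indicator_def h'n)
    also have "\<dots> = power_integral 2 Q f + (\<integral>\<^sup>+y. ennreal ((norm (h y))\<^sup>2) \<partial>lebesgue)"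
      unfolding power_integral_def by (rule nn_integral_add) auto
    also have "(\<integral>\<^sup>+y. ennreal ((norm (h y))\<^sup>2) \<partial>lebesgue) = ennreal (LINT y|lebesgue. (norm (h y))\<^sup>2)"
      using h by (intro nn_integral_eq_integral) (auto simp: square_integrable_def)
    also have "\<dots> \<le> ennreal (FA * C)" using hK FA C by (intro ennreal_leI) (simp add: K_def power_mult_distrib)
    also have "\<dots> = ennreal C * power_integral 2 A f" using FA C by (simp add: ennreal_mult mult.commute)
    also have "power_integral 2 Q f + ennreal C * power_integral 2 A f \<le> power_integral 2 Q2 f + ennreal C * power_integral 2 Q2 f"
      using Q2 by (intro add_mono mult_left_mono power_integral_mono_set) auto
    also have "\<dots> = ennreal (1 + C) * power_integral 2 Q2 f" using C by (simp add: ennreal_plus distrib_right)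
    finally show ?thesis by (simp add: add_left_mono)
  qed
  ultimately show ?thesis unfolding Q2_def \<sigma>_def by blast
qed

lemma L2_sigma_has_local_extensions:
  assumes d: "CARD('d::finite) \<ge> 2"
  obtains K where "0 < K" "has_local_extensions (L2_sigma :: (real^'d \<Rightarrow> complex^'d) set) (2 * real CARD('d) + 1) K"
proof -
  obtain C where C: "0 < C"
    and cut: "\<And>(x0 :: real^'d) R \<psi>. \<lbrakk>0 < R; \<psi> \<in> test_functions\<rbrakk> \<Longrightarrow> \<exists>\<phi>\<in>test_functions.
      (\<forall>y. (1 / R) *\<^sub>R (y - x0) \<in> cube 1 \<longrightarrow> grad \<phi> y = grad \<psi> y) \<and>
      (\<forall>y. (1 / R) *\<^sub>R (y - x0) \<notin> cube 2 \<longrightarrow> grad \<phi> y = 0) \<and>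
      power_integral 2 {y. (1 / R) *\<^sub>R (y - x0) \<in> cube 2 - cube 1} (grad \<phi>) \<le>
        ennreal C * power_integral 2 {y. (1 / R) *\<^sub>R (y - x0) \<in> cube 2 - cube 1} (grad \<psi>)"
    by (rule cutoff_gradient_bound[OF d]) blast
  show thesis
  proof (rule that[of "1 + C"])
    show "has_local_extensions (L2_sigma :: (real^'d \<Rightarrow> complex^'d) set) (2 * real CARD('d) + 1) (1 + C)"
      unfolding has_local_extensions_def
    proof (intro allI impI ballI)
      fix x :: "real^'d" and R :: real and f :: "real^'d \<Rightarrow> complex^'d" assume R: "0 < R" and f: "f \<in> L2_sigma"
      obtain g where g: "g \<in> L2_sigma" "\<And>y. (1 / R) *\<^sub>R (y - x) \<in> cube 1 \<Longrightarrow> g y = f y"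
        and le: "power_integral 2 UNIV g \<le> ennreal (1 + C) * power_integral 2 {y. (1 / R) *\<^sub>R (y - x) \<in> cube 2} f"
        using solenoidal_local_extension[OF R f C cut[OF R]] by blast
      have "g y = f y" if "y \<in> ball x R" for y
      proof (rule g(2))
        have "\<bar>(y - x) $ i\<bar> < R" for i
          using component_le_norm_cart[of "y - x" i] that by (simp add: dist_norm norm_minus_commute)
        then show "(1 / R) *\<^sub>R (y - x) \<in> cube 1" using R by (simp add: cube_def abs_mult divide_simps)
      qed
      moreover have "{y. (1 / R) *\<^sub>R (y - x) \<in> cube 2} \<subseteq> ball x ((2 * real CARD('d) + 1) * R)"
      proof
        fix y assume "y \<in> {y. (1 / R) *\<^sub>R (y - x) \<in> cube 2}"
        then have "norm ((1 / R) *\<^sub>R (y - x)) \<le> real CARD('d) * 2" by (intro norm_cube_le) simp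
        then have "norm (y - x) / R < 2 * real CARD('d) + 1" using R by simp
        then show "y \<in> ball x ((2 * real CARD('d) + 1) * R)" using R by (simp add: dist_norm norm_minus_commute divide_simps)
      qed
      ultimately show "\<exists>g\<in>L2_sigma. (\<forall>y\<in>ball x R. g y = f y) \<and>
        power_integral 2 UNIV g \<le> ennreal (1 + C) * power_integral 2 (ball x ((2 * real CARD('d) + 1) * R)) f"
        using g(1) le by (intro bexI[of _ g]) (auto intro: order_trans[OF le mult_left_mono[OF power_integral_mono_set]])
    qed
  qed (use C in simp)
qed

lemma L2_matrix_has_local_extensions:
  "has_local_extensions (L2_matrix :: (real^'d::finite \<Rightarrow> complex^'d^'d) set) 1 1"
  unfolding has_local_extensions_def
proof (intro allI impI ballI)
  fix x :: "real^'d" and R :: real and f :: "real^'d \<Rightarrow> complex^'d^'d" assume f: "f \<in> L2_matrix"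
  have "(\<lambda>y. indicator (ball x R) y *\<^sub>R f y) \<in> L2_matrix"
    using f unfolding L2_matrix_def Lp_space_2_iff by (rule square_integrable_indicator) simp
  moreover have "power_integral 2 UNIV (\<lambda>y. indicator (ball x R) y *\<^sub>R f y) = power_integral 2 (ball x R) f"
    unfolding power_integral_def by (intro nn_integral_cong) (auto simp: indicator_def)
  ultimately show "\<exists>g\<in>L2_matrix. (\<forall>y\<in>ball x R. g y = f y) \<and> power_integral 2 UNIV g \<le> ennreal 1 * power_integral 2 (ball x (1 * R)) f"
    by (intro bexI[of _ "\<lambda>y. indicator (ball x R) y *\<^sub>R f y"]) auto
qed

section \<open>Uniform boundedness\<close>

text \<open>
  Here \<open>\<theta> = 1 - d/\<nu>\<close>, and \<open>r < p\<^sub>\<theta>\<close> says that \<open>1/r\<close> is larger than the point with parameter \<open>\<theta>\<close> between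
  \<open>1/q\<close> and \<open>1/p\<close>. So the parameter \<open>t\<close> of \<open>1/r\<close> is smaller than \<open>\<theta>\<close>, whence
  \<open>\<nu> (1 - t) > \<nu> (1 - \<theta>) = d\<close>.
\<close>
lemma interpolation_parameter:
  fixes q p p\<^sub>\<theta> r :: ennreal
  assumes \<nu>: "d < \<nu>" "0 < d" and q: "2 \<le> q" "q < p"
    and \<theta>: "\<theta> = Sup {t \<in> {0<..<1}. \<nu> * (1 - t) > d}"
    and p\<theta>: "1 / p\<^sub>\<theta> = ennreal (1 - \<theta>) / q + ennreal \<theta> / p"
    and r: "q \<le> r" "r < p\<^sub>\<theta>"
  obtains t where "0 \<le> t" "t < 1" "d < \<nu> * (1 - t)" "r < p" "erecip r = (1 - t) * erecip q + t * erecip p"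
proof -
  have \<nu>0: "\<nu> > 0" using \<nu> by simp
  define e where "e = d / \<nu>"
  have e: "0 < e" using \<nu> \<nu>0 by (simp add: e_def)
  have iff: "\<nu> * (1 - t) > d \<longleftrightarrow> t < 1 - e" for t
    unfolding e_def using pos_divide_less_eq[OF \<nu>0, of d "1 - t"] by (auto simp: mult.commute)
  have "{t \<in> {0<..<1}. \<nu> * (1 - t) > d} = {0<..<1 - e}"
    unfolding iff using e by auto
  moreover have e1: "e < 1" using \<nu> \<nu>0 by (simp add: e_def)
  ultimately have \<theta>e: "\<theta> = 1 - e" using \<theta> by simp
  then have \<theta>': "\<theta> = 1 - d / \<nu>" by (simp add: e_def)
  have \<theta>01: "0 < \<theta>" "\<theta> < 1" using \<theta>e e e1 by auto
  obtain q' where q': "q = ennreal q'" "2 \<le> q'"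
    using q by (cases q) (auto simp flip: ennreal_numeral)
  obtain r' where r': "r = ennreal r'" "q' \<le> r'"
    using r q' by (cases r) auto
  define b where "b = erecip p"
  have a: "erecip q = 1 / q'" "erecip r = 1 / r'"
    using q' r' by (auto simp: erecip_def divide_ennreal simp flip: ennreal_1)
  have inv: "1 / p = ennreal b"
  proof (cases p)
    case (real x)
    then show ?thesis using q q' by (auto simp: b_def erecip_def divide_ennreal ennreal_less_iff simp flip: ennreal_1)
  qed (simp add: b_def erecip_def)
  have b: "0 \<le> b" "b < 1 / q'"
  proof -
    show "0 \<le> b" by (simp add: b_def erecip_def)
    show "b < 1 / q'"
    proof (cases p)
      case (real x)
      then have "q' < x" using q q' by (simp add: ennreal_less_iff)
      then have "b = 1 / x" using real q' by (simp add: b_def erecip_def divide_ennreal flip: ennreal_1)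
      then show ?thesis using \<open>q' < x\<close> q' by (simp add: frac_less2)
    qed (use q' in \<open>simp add: b_def erecip_def\<close>)
  qed
  have "ennreal (1 - \<theta>) / q = ennreal ((1 - \<theta>) * (1 / q'))" using q' \<theta>01 by (simp add: divide_ennreal)
  moreover have "ennreal \<theta> / p = ennreal (\<theta> * b)"
  proof -
    have "ennreal \<theta> / p = ennreal \<theta> * (1 / p)" by (simp add: ennreal_times_divide)
    then show ?thesis using inv \<theta>01 b by (simp add: ennreal_mult)
  qed
  ultimately have "1 / p\<^sub>\<theta> = ennreal ((1 - \<theta>) * (1 / q')) + ennreal (\<theta> * b)" using p\<theta> by simp
  also have "\<dots> = ennreal ((1 - \<theta>) * (1 / q') + \<theta> * b)" using \<theta>01 q' b by (intro ennreal_plus[symmetric]) auto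
  finally have p\<theta>': "1 / p\<^sub>\<theta> = ennreal ((1 - \<theta>) * (1 / q') + \<theta> * b)" .
  have pos: "(1 - \<theta>) * (1 / q') + \<theta> * b > 0" using \<theta>01 q' b by (simp add: add_pos_nonneg)
  obtain x where x: "p\<^sub>\<theta> = ennreal x" "r' < x"
  proof (cases p\<^sub>\<theta>)
    case (real x)
    then show ?thesis using that r r' q' by (simp add: ennreal_less_iff)
  next
    case top
    then show ?thesis using p\<theta>' pos by simp
  qed
  have "ennreal (1 / x) = ennreal ((1 - \<theta>) * (1 / q') + \<theta> * b)"
    using p\<theta>' x r' q' by (simp add: divide_ennreal flip: ennreal_1)
  then have "1 / x = (1 - \<theta>) * (1 / q') + \<theta> * b" using x r' q' pos by (subst (asm) ennreal_inj) auto
  moreover have "1 / x < 1 / r'" using x r' q' by (simp add: frac_less2)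
  moreover have "(1 - \<theta>) * (1 / q') + \<theta> * b = 1 / q' - \<theta> * (1 / q' - b)"
    by (simp add: diff_divide_distrib right_diff_distrib)
  ultimately have lt: "1 / q' - \<theta> * (1 / q' - b) < 1 / r'" by simp
  define t where "t = (1 / q' - 1 / r') / (1 / q' - b)"
  have t\<theta>: "t < \<theta>" using lt b by (simp add: t_def divide_less_eq) 
  have "1 / r' \<le> 1 / q'" using r' q' by (simp add: frac_le)
  then have t0: "0 \<le> t" using b by (simp add: t_def)
  show thesis
  proof (rule that[OF t0])
    show "t < 1" using t\<theta> \<theta>01 by simp
    have "\<nu> * (1 - \<theta>) = d" using \<theta>' \<nu>0 by simp
    moreover have "\<nu> * (1 - \<theta>) < \<nu> * (1 - t)" using t\<theta> \<nu>0 by simp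
    ultimately show "d < \<nu> * (1 - t)" by simp
    have "t * (1 / q' - b) = 1 / q' - 1 / r'" using b by (simp add: t_def)
    then show "erecip r = (1 - t) * erecip q + t * erecip p" unfolding a b_def[symmetric] by (simp add: algebra_simps diff_divide_distrib)
    have "b < 1 / r'"
    proof -
      have "\<theta> * (1 / q' - b) \<le> 1 * (1 / q' - b)" using \<theta>01 b by (intro mult_right_mono) auto
      then show ?thesis using lt by simp
    qed
    show "r < p"
    proof (cases p)
      case (real y)
      then have y: "q' < y" using q q' by (simp add: ennreal_less_iff)
      then have "b = 1 / y" using real q' by (simp add: b_def erecip_def divide_ennreal flip: ennreal_1)
      have "\<not> y \<le> r'"
      proof
        assume "y \<le> r'"
        then have "1 / r' \<le> 1 / y" using y q' by (intro frac_le) auto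
        then show False using \<open>b < 1 / r'\<close> \<open>b = 1 / y\<close> by simp
      qed
      then have "r' < y" by simp
      then show ?thesis using real r' q' by (simp add: ennreal_less_iff)
    qed (use r' in simp)
  qed
qed

lemma operator_family_bounded:
  fixes T :: "complex \<Rightarrow> ('a::euclidean_space \<Rightarrow> 'v::euclidean_space) \<Rightarrow> 'a \<Rightarrow> 'w::euclidean_space"
  assumes ext: "has_local_extensions V L K" and L: "0 < L" and K: "0 < K"
    and V_sub: "V \<subseteq> Lp_space 2" and W_sub: "W \<subseteq> Lp_space 2"
    and V_diff: "\<And>f g. f \<in> V \<Longrightarrow> g \<in> V \<Longrightarrow> (\<lambda>y. f y - g y) \<in> V"
    and sV: "\<And>v. sV (-1) v = - v" and sW: "\<And>w. sW (-1) w = - w"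
    and T: "\<forall>z\<in>\<Omega>. bounded_operator sV sW V W (T z)"
    and decay: "L2_Lp_decay \<Omega> V T \<nu> q" and bounds: "L2_Lp_bounds \<Omega> V T p"
    and \<Omega>: "\<Omega> \<subseteq> UNIV - {0}" and \<nu>: "real DIM('a) < \<nu>" and q: "2 \<le> q" "q < p"
    and \<theta>: "\<theta> = Sup {t \<in> {0<..<1}. \<nu> * (1 - t) > real DIM('a)}"
    and p\<theta>: "1 / p\<^sub>\<theta> = ennreal (1 - \<theta>) / q + ennreal \<theta> / p"
    and r: "q \<le> r" "r < p\<^sub>\<theta>"
  shows "uniformly_Lr_bounded \<Omega> V T r"
proof -
  obtain t where t: "0 \<le> t" "t < 1" "real DIM('a) < \<nu> * (1 - t)" "r < p" "erecip r = (1 - t) * erecip q + t * erecip p"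
    using interpolation_parameter[OF \<nu> _ q \<theta> p\<theta> r] by auto
  have neg: "(\<lambda>y. - g y) \<in> V" if "g \<in> V" for g
    using V_diff[OF V_diff[OF that that] that] by simp
  show ?thesis
  proof (rule extrapolation[OF ext L K V_sub V_diff _ _ decay bounds _ t(3) q(1) r(1) t(4,1,2,5)])
    fix z assume z: "z \<in> \<Omega>"
    then have B: "bounded_operator sV sW V W (T z)" using T by blast
    show "T z f \<in> borel_measurable lebesgue" if "f \<in> V" for f
      using B that W_sub by (auto simp: bounded_operator_def Lp_space_def)
    fix f g assume f: "f \<in> V" and g: "g \<in> V"
    have add: "\<forall>f\<in>V. \<forall>g\<in>V. AE x in lebesgue. T z (\<lambda>y. f y + g y) x = T z f x + T z g x"
      and scale: "\<forall>c. \<forall>f\<in>V. AE x in lebesgue. T z (\<lambda>y. sV c (f y)) x = sW c (T z f x)"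
      using B unfolding bounded_operator_def by simp_all
    have "AE x in lebesgue. T z (\<lambda>y. f y + - g y) x = T z f x + T z (\<lambda>y. - g y) x"
      using bspec[OF bspec[OF add f] neg[OF g]] .
    moreover have "AE x in lebesgue. T z (\<lambda>y. sV (-1) (g y)) x = sW (-1) (T z g x)"
      using bspec[OF spec[OF scale] g] .
    ultimately show "AE y in lebesgue. T z (\<lambda>y. f y - g y) y = T z f y - T z g y"
      unfolding sV sW by eventually_elim simp
  qed (use \<Omega> in auto)
qed

theorem corollary4p12:
  fixes \<Omega> :: "complex set"
    and \<nu> \<theta> :: real
    and q p p\<^sub>\<theta> :: ennreal
  assumes "CARD('d::finite) \<ge> 2"
    and "open \<Omega>" "\<Omega> \<subseteq> UNIV - {0}"
    and "\<nu> > real CARD('d)"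
    and "2 \<le> q" "q < p"
    and "\<theta> = Sup {t \<in> {0<..<1}. \<nu> * (1 - t) > real CARD('d)}"
    and "1 / p\<^sub>\<theta> = ennreal (1 - \<theta>) / q + ennreal \<theta> / p"
  shows
    "(\<forall>T :: complex \<Rightarrow> (real^'d \<Rightarrow> complex^'d) \<Rightarrow> (real^'d \<Rightarrow> complex^'d).
        (\<forall>z\<in>\<Omega>. bounded_operator (*s) (*s) L2_sigma L2_sigma (T z)) \<longrightarrow>
        L2_Lp_decay \<Omega> L2_sigma T \<nu> q \<longrightarrow> L2_Lp_bounds \<Omega> L2_sigma T p \<longrightarrow>
        (\<forall>r. q \<le> r \<and> r < p\<^sub>\<theta> \<longrightarrow> uniformly_Lr_bounded \<Omega> L2_sigma T r)) \<and>
     (\<forall>T :: complex \<Rightarrow> (real^'d \<Rightarrow> complex^'d) \<Rightarrow> (real^'d \<Rightarrow> complex^'d^'d).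
        (\<forall>z\<in>\<Omega>. bounded_operator (*s) matrix_scale L2_sigma L2_matrix (T z)) \<longrightarrow>
        L2_Lp_decay \<Omega> L2_sigma T \<nu> q \<longrightarrow> L2_Lp_bounds \<Omega> L2_sigma T p \<longrightarrow>
        (\<forall>r. q \<le> r \<and> r < p\<^sub>\<theta> \<longrightarrow> uniformly_Lr_bounded \<Omega> L2_sigma T r)) \<and>
     (\<forall>T :: complex \<Rightarrow> (real^'d \<Rightarrow> complex^'d^'d) \<Rightarrow> (real^'d \<Rightarrow> complex^'d).
        (\<forall>z\<in>\<Omega>. bounded_operator matrix_scale (*s) L2_matrix L2_sigma (T z)) \<longrightarrow>
        L2_Lp_decay \<Omega> L2_matrix T \<nu> q \<longrightarrow> L2_Lp_bounds \<Omega> L2_matrix T p \<longrightarrow>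
        (\<forall>r. q \<le> r \<and> r < p\<^sub>\<theta> \<longrightarrow> uniformly_Lr_bounded \<Omega> L2_matrix T r)) \<and>
     (\<forall>T :: complex \<Rightarrow> (real^'d \<Rightarrow> complex^'d^'d) \<Rightarrow> (real^'d \<Rightarrow> complex^'d^'d).
        (\<forall>z\<in>\<Omega>. bounded_operator matrix_scale matrix_scale L2_matrix L2_matrix (T z)) \<longrightarrow>
        L2_Lp_decay \<Omega> L2_matrix T \<nu> q \<longrightarrow> L2_Lp_bounds \<Omega> L2_matrix T p \<longrightarrow>
        (\<forall>r. q \<le> r \<and> r < p\<^sub>\<theta> \<longrightarrow> uniformly_Lr_bounded \<Omega> L2_matrix T r))"
proof -
  obtain K where K: "0 < K" and sigma: "has_local_extensions (L2_sigma :: (real^'d \<Rightarrow> complex^'d) set) (2 * real CARD('d) + 1) K"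
    using L2_sigma_has_local_extensions[OF assms(1)] by blast
  have subs: "L2_sigma \<subseteq> Lp_space 2" "L2_matrix \<subseteq> Lp_space 2" by (auto simp: L2_sigma_def L2_matrix_def)
  have matrix_diff: "(\<lambda>y. f y - g y) \<in> L2_matrix" if "f \<in> L2_matrix" "g \<in> L2_matrix" for f g :: "real^'d \<Rightarrow> complex^'d^'d"
    using square_integrable_add_scaleR(1)[of lebesgue f g "-1"] that by (simp add: L2_matrix_def Lp_space_2_iff)
  have neg: "(-1) *s v = - v" "matrix_scale (-1) m = - m" for v :: "complex^'d" and m :: "complex^'d^'d"
    by (simp_all add: matrix_scale_def vec_eq_iff)
  have dims: "real DIM(real^'d) < \<nu>" "\<theta> = Sup {t \<in> {0<..<1}. \<nu> * (1 - t) > real DIM(real^'d)}"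
    using assms(4,7) by simp_all
  have L: "0 < 2 * real CARD('d) + 1" by simp
  have bounded_ss: "uniformly_Lr_bounded \<Omega> L2_sigma T r"
    if "\<forall>z\<in>\<Omega>. bounded_operator (*s) (*s) L2_sigma L2_sigma (T z)"
      "L2_Lp_decay \<Omega> L2_sigma T \<nu> q" "L2_Lp_bounds \<Omega> L2_sigma T p" "q \<le> r" "r < p\<^sub>\<theta>"
    for T :: "complex \<Rightarrow> (real^'d \<Rightarrow> complex^'d) \<Rightarrow> (real^'d \<Rightarrow> complex^'d)" and r
    by (rule operator_family_bounded[where sV = "(*s)" and sW = "(*s)", OF sigma L K subs(1) subs(1)
          L2_sigma_diff neg(1) neg(1) that(1-3) assms(3) dims(1) assms(5,6) dims(2) assms(8) that(4,5)])
  have bounded_sm: "uniformly_Lr_bounded \<Omega> L2_sigma T r"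
    if "\<forall>z\<in>\<Omega>. bounded_operator (*s) matrix_scale L2_sigma L2_matrix (T z)"
      "L2_Lp_decay \<Omega> L2_sigma T \<nu> q" "L2_Lp_bounds \<Omega> L2_sigma T p" "q \<le> r" "r < p\<^sub>\<theta>"
    for T :: "complex \<Rightarrow> (real^'d \<Rightarrow> complex^'d) \<Rightarrow> (real^'d \<Rightarrow> complex^'d^'d)" and r
    by (rule operator_family_bounded[where sV = "(*s)" and sW = "matrix_scale", OF sigma L K subs(1) subs(2)
          L2_sigma_diff neg(1) neg(2) that(1-3) assms(3) dims(1) assms(5,6) dims(2) assms(8) that(4,5)])
  have bounded_ms: "uniformly_Lr_bounded \<Omega> L2_matrix T r"
    if "\<forall>z\<in>\<Omega>. bounded_operator matrix_scale (*s) L2_matrix L2_sigma (T z)"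
      "L2_Lp_decay \<Omega> L2_matrix T \<nu> q" "L2_Lp_bounds \<Omega> L2_matrix T p" "q \<le> r" "r < p\<^sub>\<theta>"
    for T :: "complex \<Rightarrow> (real^'d \<Rightarrow> complex^'d^'d) \<Rightarrow> (real^'d \<Rightarrow> complex^'d)" and r
    by (rule operator_family_bounded[where sV = "matrix_scale" and sW = "(*s)", OF L2_matrix_has_local_extensions zero_less_one zero_less_one subs(2) subs(1)
          matrix_diff neg(2) neg(1) that(1-3) assms(3) dims(1) assms(5,6) dims(2) assms(8) that(4,5)])
  have bounded_mm: "uniformly_Lr_bounded \<Omega> L2_matrix T r"
    if "\<forall>z\<in>\<Omega>. bounded_operator matrix_scale matrix_scale L2_matrix L2_matrix (T z)"
      "L2_Lp_decay \<Omega> L2_matrix T \<nu> q" "L2_Lp_bounds \<Omega> L2_matrix T p" "q \<le> r" "r < p\<^sub>\<theta>"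
    for T :: "complex \<Rightarrow> (real^'d \<Rightarrow> complex^'d^'d) \<Rightarrow> (real^'d \<Rightarrow> complex^'d^'d)" and r
    by (rule operator_family_bounded[where sV = "matrix_scale" and sW = "matrix_scale", OF L2_matrix_has_local_extensions zero_less_one zero_less_one subs(2) subs(2)
          matrix_diff neg(2) neg(2) that(1-3) assms(3) dims(1) assms(5,6) dims(2) assms(8) that(4,5)])
  show ?thesis
    using bounded_ss bounded_sm bounded_ms bounded_mm by blast
qed

end
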